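(* Let $D\subseteq\mathbb{R}^n$ be a triangulable subspace, let $K\subseteq D$ be a non-empty triangulable subset, and let $\vec\varphi:D\to\mathbb{R}^k$ be continuous. Set $\vec\Phi:D\to\mathbb{R}^{k+1}$, $\vec\Phi=(d_K,\vec\varphi)$, and let $q\in\mathbb{Z}$. Then for every $\vec u,\vec v\in\mathbb{R}^k$ with $\vec u\prec\vec v$ there exists a real number $\hat\beta>0$ such that for every $\beta$ with $0<\beta\le\hat\beta$ there exists a real number $\hat\alpha=\hat\alpha(\beta)$ with $0<\hat\alpha<\beta$ for which $$\rho_{(K,\vec\varphi_{|K}),q}(\vec u,\vec v)=\rho_{(D,\vec\Phi),q}\big((\alpha,\vec u),(\beta,\vec v)\big)$$ for every $\alpha$ with $0\le\alpha\le\hat\alpha$. In particular, $\rho_{(K,\vec\varphi_{|K}),q}(\vec u,\vec v)=\lim_{\beta\to0^+}\rho_{(D,\vec\Phi),q}\big((0,\vec u),(\beta,\vec v)\big)$.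
   Context: Triangulable means homeomorphic to the polyhedron of a finite simplicial complex. On $\mathbb{R}^m$, $\vec u\preceq\vec v$ (resp. $\vec u\prec\vec v$) means $u_i\le v_i$ (resp. $u_i<v_i$) for all $i$. $d_K:D\to\mathbb{R}$ is the distance function $d_K(x)=\min_{y\in K}\|x-y\|$ for a fixed norm on $\mathbb{R}^n$. Rank invariant: for a space $X$ and continuous $\vec f:X\to\mathbb{R}^m$, let $X\langle\vec f\preceq\vec u\rangle=\{x\in X:\vec f(x)\preceq\vec u\}$; for $\vec u\prec\vec v$, $\rho_{(X,\vec f),q}(\vec u,\vec v)$ is the rank of the homomorphism $\check H_q(X\langle\vec f\preceq\vec u\rangle)\to\check H_q(X\langle\vec f\preceq\vec v\rangle)$ induced by inclusion, where $\check H_q$ denotes $q$th Čech homology with coefficients in a fixed field. *)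

theory Defs
  imports "HOL-Analysis.Analysis" "HOL-Library.Extended_Real"
begin

text \<open>Geometric realisation of a finite abstract simplicial complex with vertex set V
 (a finite set of naturals) and simplex family S: the points t (barycentric coordinates,
 functions nat to real with the product topology) supported in V, nonnegative, summing to 1,
 whose support is a simplex of S.  This is (up to homeomorphism) exactly the polyhedron of a
 finite simplicial complex.\<close>

definition abs_simplicial_complex :: "nat set \<Rightarrow> nat set set \<Rightarrow> bool" where
  "abs_simplicial_complex V S \<longleftrightarrow> finite V \<and> (\<forall>s\<in>S. s \<subseteq> V \<and> s \<noteq> {})
     \<and> (\<forall>s\<in>S. \<forall>t. t \<subseteq> s \<and> t \<noteq> {} \<longrightarrow> t \<in> S)"

definition polyhedron_of :: "nat set \<Rightarrow> nat set set \<Rightarrow> (nat \<Rightarrow> real) set" where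
  "polyhedron_of V S = {t. (\<forall>i. i \<notin> V \<longrightarrow> t i = 0) \<and> (\<forall>i. 0 \<le> t i)
       \<and> sum t V = 1 \<and> {i. t i \<noteq> 0} \<in> S}"

definition triangulable :: "'a::topological_space set \<Rightarrow> bool" where
  "triangulable X \<longleftrightarrow> (\<exists>V S. abs_simplicial_complex V S \<and> X homeomorphic polyhedron_of V S)"

definition is_norm :: "('a::real_vector \<Rightarrow> real) \<Rightarrow> bool" where
  "is_norm N \<longleftrightarrow> (\<forall>x. 0 \<le> N x) \<and> (\<forall>x. N x = 0 \<longleftrightarrow> x = 0)
     \<and> (\<forall>c x. N (c *\<^sub>R x) = \<bar>c\<bar> * N x) \<and> (\<forall>x y. N (x + y) \<le> N x + N y)"

definition dist_fun :: "('a::real_vector \<Rightarrow> real) \<Rightarrow> 'a set \<Rightarrow> 'a \<Rightarrow> real" where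
  "dist_fun N K x = (INF y\<in>K. N (x - y))"

definition vle :: "real^'m \<Rightarrow> real^'m \<Rightarrow> bool" where
  "vle u v \<longleftrightarrow> (\<forall>i. u $ i \<le> v $ i)"

definition vlt :: "real^'m \<Rightarrow> real^'m \<Rightarrow> bool" where
  "vlt u v \<longleftrightarrow> (\<forall>i. u $ i < v $ i)"

text \<open>R^(k+1) is represented as real^('k option); the index None is the first coordinate.\<close>

definition vcons :: "real \<Rightarrow> real^'k \<Rightarrow> real^('k option)" where
  "vcons a u = (\<chi> i. case i of None \<Rightarrow> a | Some j \<Rightarrow> u $ j)"

definition Phi :: "('a::real_vector \<Rightarrow> real) \<Rightarrow> 'a set \<Rightarrow> ('a \<Rightarrow> real^'k) \<Rightarrow> 'a \<Rightarrow> real^('k option)" where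
  "Phi N K \<phi> = (\<lambda>x. vcons (dist_fun N K x) (\<phi> x))"

definition sublevel :: "'a set \<Rightarrow> ('a \<Rightarrow> real^'m) \<Rightarrow> real^'m \<Rightarrow> 'a set" where
  "sublevel X f u = {x \<in> X. vle (f x) u}"

text \<open>Open covers of a subspace X of the ambient space: finite families of open sets of the
 ambient space whose union contains X (their traces on X are exactly the finite relatively open
 covers of X, indexed by the ambient sets).  The nerve (ordered version) in degree q consists of
 lists of q+1 members of the cover whose intersection meets X.\<close>

definition ocover :: "'a::topological_space set \<Rightarrow> 'a set set \<Rightarrow> bool" where
  "ocover X U \<longleftrightarrow> finite U \<and> (\<forall>W\<in>U. open W) \<and> X \<subseteq> \<Union>U"

definition nerve :: "'a set \<Rightarrow> 'a set set \<Rightarrow> int \<Rightarrow> 'a set list set" where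
  "nerve X U q = {\<sigma>. 0 \<le> q \<and> int (length \<sigma>) = q + 1 \<and> set \<sigma> \<subseteq> U \<and> \<Inter>(set \<sigma>) \<inter> X \<noteq> {}}"

definition chains :: "'a set \<Rightarrow> 'a set set \<Rightarrow> int \<Rightarrow> ('a set list \<Rightarrow> 'f::field) set" where
  "chains X U q = {c. \<forall>\<sigma>. \<sigma> \<notin> nerve X U q \<longrightarrow> c \<sigma> = 0}"

definition del_nth :: "nat \<Rightarrow> 'b list \<Rightarrow> 'b list" where
  "del_nth i xs = take i xs @ drop (Suc i) xs"

definition bdry :: "'a set \<Rightarrow> 'a set set \<Rightarrow> int \<Rightarrow> ('a set list \<Rightarrow> 'f::field) \<Rightarrow> 'a set list \<Rightarrow> 'f" where
  "bdry X U q c = (\<lambda>\<tau>. if \<tau> \<in> nerve X U (q - 1)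
      then (\<Sum>(\<sigma>, i)\<in>{(\<sigma>, i). \<sigma> \<in> nerve X U q \<and> i < length \<sigma> \<and> del_nth i \<sigma> = \<tau>}.
              (- 1) ^ i * c \<sigma>)
      else 0)"

definition cycles :: "'a set \<Rightarrow> 'a set set \<Rightarrow> int \<Rightarrow> ('a set list \<Rightarrow> 'f::field) set" where
  "cycles X U q = {c \<in> chains X U q. bdry X U q c = (\<lambda>_. 0)}"

definition bdries :: "'a set \<Rightarrow> 'a set set \<Rightarrow> int \<Rightarrow> ('a set list \<Rightarrow> 'f::field) set" where
  "bdries X U q = bdry X U (q + 1) ` chains X U (q + 1)"

definition hclass :: "'a set \<Rightarrow> 'a set set \<Rightarrow> int \<Rightarrow> ('a set list \<Rightarrow> 'f::field) \<Rightarrow> ('a set list \<Rightarrow> 'f) set" where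
  "hclass X U q c = (\<lambda>b \<sigma>. c \<sigma> + b \<sigma>) ` bdries X U q"

definition nerve_homology :: "'a set \<Rightarrow> 'a set set \<Rightarrow> int \<Rightarrow> ('a set list \<Rightarrow> 'f::field) set set" where
  "nerve_homology X U q = hclass X U q ` cycles X U q"

definition refines_by :: "'a set \<Rightarrow> 'a set set \<Rightarrow> 'a set set \<Rightarrow> ('a set \<Rightarrow> 'a set) \<Rightarrow> bool" where
  "refines_by X V U g \<longleftrightarrow> (\<forall>W\<in>V. g W \<in> U \<and> W \<inter> X \<subseteq> g W \<inter> X)"

definition chain_push :: "'a set \<Rightarrow> 'a set set \<Rightarrow> int \<Rightarrow> ('a set \<Rightarrow> 'a set) \<Rightarrow> ('a set list \<Rightarrow> 'f::field) \<Rightarrow> 'a set list \<Rightarrow> 'f" where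
  "chain_push X V q g c = (\<lambda>\<tau>. \<Sum>\<sigma>\<in>{\<sigma> \<in> nerve X V q. map g \<sigma> = \<tau>}. c \<sigma>)"

definition cech :: "'a::topological_space set \<Rightarrow> int \<Rightarrow> ('a set set \<Rightarrow> ('a set list \<Rightarrow> 'f::field) set) set" where
  "cech X q = {x. (\<forall>U. ocover X U \<longrightarrow> x U \<in> nerve_homology X U q)
     \<and> (\<forall>U. \<not> ocover X U \<longrightarrow> x U = {})
     \<and> (\<forall>U V g. ocover X U \<and> ocover X V \<and> refines_by X V U g \<longrightarrow>
            (\<forall>c\<in>x V. chain_push X V q g c \<in> x U))}"

definition cech_incl :: "'a::topological_space set \<Rightarrow> int \<Rightarrow> ('a set set \<Rightarrow> ('a set list \<Rightarrow> 'f::field) set)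
     \<Rightarrow> 'a set set \<Rightarrow> ('a set list \<Rightarrow> 'f) set" where
  "cech_incl Y q x = (\<lambda>U. if ocover Y U
      then {(\<lambda>\<sigma>. c \<sigma> + b \<sigma>) | c b. c \<in> x U \<and> b \<in> bdries Y U q} else {})"

definition cech_zero :: "'a::topological_space set \<Rightarrow> int \<Rightarrow> 'a set set \<Rightarrow> ('a set list \<Rightarrow> 'f::field) set" where
  "cech_zero Y q = (\<lambda>U. if ocover Y U then bdries Y U q else {})"

definition cech_lincomb :: "'a::topological_space set \<Rightarrow> int \<Rightarrow> (nat \<Rightarrow> 'f::field)
     \<Rightarrow> ('a set set \<Rightarrow> ('a set list \<Rightarrow> 'f) set) list \<Rightarrow> 'a set set \<Rightarrow> ('a set list \<Rightarrow> 'f) set" where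
  "cech_lincomb Y q a ys = (\<lambda>U. if ocover Y U then
      {c. \<exists>cs. length cs = length ys \<and> (\<forall>i<length ys. cs ! i \<in> (ys ! i) U)
          \<and> (\<lambda>\<sigma>. c \<sigma> - (\<Sum>i<length ys. a i * (cs ! i) \<sigma>)) \<in> bdries Y U q}
      else {})"

definition cech_lin_indep :: "'a::topological_space set \<Rightarrow> int
     \<Rightarrow> ('a set set \<Rightarrow> ('a set list \<Rightarrow> 'f::field) set) list \<Rightarrow> bool" where
  "cech_lin_indep Y q ys \<longleftrightarrow>
     (\<forall>a. cech_lincomb Y q a ys = cech_zero Y q \<longrightarrow> (\<forall>i<length ys. a i = 0))"

definition cech_rank :: "'f::field itself \<Rightarrow> int \<Rightarrow> 'a::topological_space set \<Rightarrow> 'a set \<Rightarrow> enat" where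
  "cech_rank F q X Y = Sup {enat (length ys) | ys.
      set ys \<subseteq> cech_incl Y q ` (cech X q :: ('a set set \<Rightarrow> ('a set list \<Rightarrow> 'f) set) set)
      \<and> cech_lin_indep Y q ys}"

definition rank_inv :: "'f::field itself \<Rightarrow> int \<Rightarrow> 'a::topological_space set \<Rightarrow> ('a \<Rightarrow> real^'m)
     \<Rightarrow> real^'m \<Rightarrow> real^'m \<Rightarrow> enat" where
  "rank_inv F q X f u v = cech_rank F q (sublevel X f u) (sublevel X f v)"

end

theory Submission
  imports Defs "HOL-Library.Poly_Mapping"
begin

text \<open>Write \<open>A\<^sub>\<alpha> = {d\<^sub>K \<le> \<alpha>, \<phi> \<le> u}\<close> and \<open>B\<^sub>\<beta> = {d\<^sub>K \<le> \<beta>, \<phi> \<le> v}\<close>; the sublevel sets in \<open>K\<close> are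
  \<open>A\<^sub>0\<close> and \<open>B\<^sub>0\<close>. The target is shrunk from \<open>B\<^sub>\<beta>\<close> to \<open>B\<^sub>0\<close> by showing that the classes of \<open>A\<^sub>0\<close> dying in
  \<open>B\<^sub>\<beta>\<close> already die in \<open>B\<^sub>0\<close>, and the source from \<open>A\<^sub>\<alpha>\<close> to \<open>A\<^sub>0\<close> by showing that both have the same image
  in the homology of \<open>B\<^sub>\<beta>\<close>. Two facts make finitely many covers suffice for this. First, a triangulable
  set is a neighbourhood retract, so a cycle that bounds at one fixed coarse cover of \<open>A\<close> can be
  filled inside a slightly larger \<open>B\<close> at every fine cover, by subdividing the filling in Euclidean
  space and retracting it; as nerves of finite covers have finite-dimensional homology, a single cover
  of \<open>B\<close> then detects which classes of \<open>A\<close> vanish in \<open>B\<close>. Second, by the Mittag-Leffler property, the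
  image of the Cech homology of \<open>A\<^sub>0\<close> at a cover is the image of the nerve homology of one finer
  cover. Finally, a shrunk open cover of a compact set has no new intersections on a
  neighbourhood of that set.\<close>

subsection \<open>Chains of lists\<close>

text \<open>Continuity of Cech homology exhibits the homology of an intersection of compact sets as
  a limit over larger sets, but a limit need not be attained at any single \<alpha> or \<beta>.
  Moreover \<phi> is merely continuous, so its sublevel sets are just compact sets, possibly with
  infinite-dimensional homology and without a neighbourhood retraction of their own. What can be
  exploited is the gap between \<open>u\<close> and \<open>v\<close>: the relatively open set where
  \<phi> is strictly below \<open>v\<close> lies between source and target, so a retraction onto
  \<open>K\<close> or \<open>D\<close>, restricted to the preimage of that set, fixes the source and
  lands in the target. The image of the induced homomorphism is then controlled by the nerve of one
  finite cover of the source, and stabilisation arguments in finite dimension apply to it. Changing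
  the target is a question about kernels, changing the source one about images. The cover used for
  the source depends on the target, which is why the bound on \<alpha> is found after
  \<beta>.\<close>

abbreviation lookup where "lookup \<equiv> Poly_Mapping.lookup"
abbreviation keys where "keys \<equiv> Poly_Mapping.keys"

section \<open>Linear extension of maps on generators\<close>

definition gen :: "'b \<Rightarrow> 'b \<Rightarrow>\<^sub>0 'f::field" where
  "gen x = Poly_Mapping.single x 1"

definition smul :: "'f::field \<Rightarrow> ('b \<Rightarrow>\<^sub>0 'f) \<Rightarrow> ('b \<Rightarrow>\<^sub>0 'f)" where
  "smul a p = Poly_Mapping.map ((*) a) p"

text \<open>Cone, boundary, push-forward, prism and subdivision are all used in this form, so
  identities between composites reduce to generators by \<open>lin_lin\<close> and
  \<open>lin_cong\<close>.\<close>

definition lin :: "('b \<Rightarrow> ('c \<Rightarrow>\<^sub>0 'f)) \<Rightarrow> ('b \<Rightarrow>\<^sub>0 'f::field) \<Rightarrow> ('c \<Rightarrow>\<^sub>0 'f)" where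
  "lin f c = (\<Sum>k\<in>keys c. smul (lookup c k) (f k))"

lemma lookup_smul [simp]: "lookup (smul a p) k = a * lookup p k"
  by (simp add: smul_def Poly_Mapping.map.rep_eq when_def)

lemma smul_zero [simp]: "smul a 0 = 0"
  by (rule poly_mapping_eqI) simp

lemma lookup_gen: "lookup (gen x) y = (if x = y then 1 else 0)"
  by (simp add: gen_def lookup_single when_def)

lemma keys_gen [simp]: "keys (gen x :: 'b \<Rightarrow>\<^sub>0 'f::field) = {x}"
  by (simp add: gen_def)

lemma keys_smul: "keys (smul a p) \<subseteq> keys p"
  by (auto simp: in_keys_iff)

lemma keys_diff_subset: "keys (p - q) \<subseteq> keys p \<union> keys (q :: 'b \<Rightarrow>\<^sub>0 'f::field)"
  by (auto simp: in_keys_iff lookup_minus)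

lemma keys_add_subset: "keys (p + q) \<subseteq> keys p \<union> keys (q :: 'b \<Rightarrow>\<^sub>0 'f::field)"
  by (auto simp: in_keys_iff lookup_add)

lemma lookup_lin: "lookup (lin f c) k = (\<Sum>\<sigma>\<in>keys c. lookup c \<sigma> * lookup (f \<sigma>) k)"
  by (simp add: lin_def lookup_sum)

lemma lookup_lin_superset:
  assumes "finite S" "keys c \<subseteq> S"
  shows "lookup (lin f c) k = (\<Sum>\<sigma>\<in>S. lookup c \<sigma> * lookup (f \<sigma>) k)"
  unfolding lookup_lin by (rule sum.mono_neutral_left) (use assms in \<open>auto simp: in_keys_iff\<close>)

lemma lin_zero [simp]: "lin f 0 = 0"
  by (simp add: lin_def)

lemma lin_add: "lin f (c + d) = lin f c + lin f d"
proof (rule poly_mapping_eqI)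
  fix k
  let ?S = "keys c \<union> keys d"
  have *: "finite ?S" "keys (c + d) \<subseteq> ?S" "keys c \<subseteq> ?S" "keys d \<subseteq> ?S"
    using keys_add_subset[of c d] by auto
  show "lookup (lin f (c + d)) k = lookup (lin f c + lin f d) k"
    unfolding lookup_add[of "lin f c"] lookup_lin_superset[OF *(1,2)]
      lookup_lin_superset[OF *(1,3)] lookup_lin_superset[OF *(1,4)]
    by (simp add: lookup_add distrib_right sum.distrib)
qed

lemma lin_smul: "lin f (smul a c) = smul a (lin f c)"
proof (rule poly_mapping_eqI)
  fix k
  show "lookup (lin f (smul a c)) k = lookup (smul a (lin f c)) k"
    unfolding lookup_lin_superset[OF finite_keys keys_smul] lookup_smul
    by (simp add: lookup_lin sum_distrib_left mult.assoc)
qed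

lemma smul_minus_one: "smul (- 1) c = - c"
  by (rule poly_mapping_eqI) simp

lemma lin_uminus: "lin f (- c) = - lin f c"
  using lin_smul[of f "- 1" c] by (simp add: smul_minus_one)

lemma lin_diff: "lin f (c - d) = lin f c - lin f d"
  using lin_add[of f c "- d"] by (simp add: lin_uminus)

lemma lin_sum: "lin f (sum c A) = (\<Sum>i\<in>A. lin f (c i))"
  by (induction A rule: infinite_finite_induct) (auto simp: lin_add)

lemma lin_gen [simp]: "lin f (gen x) = f x"
  by (rule poly_mapping_eqI) (simp add: lookup_lin lookup_gen)

lemma lin_cong: "(\<And>k. k \<in> keys c \<Longrightarrow> f k = g k) \<Longrightarrow> lin f c = lin g c"
  by (simp add: lin_def)

lemma lin_gen_id [simp]: "lin gen c = c"
  by (rule poly_mapping_eqI)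
    (auto simp: lookup_lin lookup_gen if_distrib sum.delta not_in_keys_iff_lookup_eq_zero cong: if_cong)

lemma smul_add: "smul a (c + d) = smul a c + smul a d"
  by (rule poly_mapping_eqI) (simp add: lookup_add algebra_simps)

lemma smul_diff: "smul a (c - d) = smul a c - smul a d"
  by (rule poly_mapping_eqI) (simp add: lookup_minus algebra_simps)

lemma lin_fun_add: "lin (\<lambda>k. f k + g k) c = lin f c + lin g c"
  by (simp add: lin_def smul_add sum.distrib)

lemma lin_fun_diff: "lin (\<lambda>k. f k - g k) c = lin f c - lin g c"
  by (simp add: lin_def smul_diff sum_subtractf)

lemma lin_lin: "lin f (lin g c) = lin (\<lambda>k. lin f (g k)) c"
  by (simp add: lin_def[of g] lin_def[of "\<lambda>k. lin f (g k)"] lin_sum lin_smul)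

lemma keys_lin: "keys (lin f c) \<subseteq> (\<Union>k\<in>keys c. keys (f k))"
proof
  fix \<tau> assume "\<tau> \<in> keys (lin f c)"
  then have "(\<Sum>\<sigma>\<in>keys c. lookup c \<sigma> * lookup (f \<sigma>) \<tau>) \<noteq> 0"
    by (simp add: in_keys_iff lookup_lin)
  then obtain \<sigma> where "\<sigma> \<in> keys c" "lookup c \<sigma> * lookup (f \<sigma>) \<tau> \<noteq> 0"
    by (meson sum.neutral)
  then show "\<tau> \<in> (\<Union>k\<in>keys c. keys (f k))"
    by (auto simp: in_keys_iff)
qed

section \<open>Cone, boundary, push-forward and prism\<close>

definition chain_cone :: "'b \<Rightarrow> ('b list \<Rightarrow>\<^sub>0 'f::field) \<Rightarrow> ('b list \<Rightarrow>\<^sub>0 'f)" where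
  "chain_cone x = lin (\<lambda>\<sigma>. gen (x # \<sigma>))"

text \<open>The boundary is augmented: \<open>bd [x] = gen []\<close>. With this convention
  \<open>\<partial> \<circ> chain_cone x = id - chain_cone x \<circ> \<partial>\<close> holds in every degree.\<close>

fun bd :: "'b list \<Rightarrow> ('b list \<Rightarrow>\<^sub>0 'f::field)" where
  "bd [] = 0"
| "bd (x # \<sigma>) = gen \<sigma> - chain_cone x (bd \<sigma>)"

abbreviation bd_chain :: "('b list \<Rightarrow>\<^sub>0 'f::field) \<Rightarrow> ('b list \<Rightarrow>\<^sub>0 'f)" where
  "bd_chain \<equiv> lin bd"

definition push_chain :: "('b \<Rightarrow> 'c) \<Rightarrow> ('b list \<Rightarrow>\<^sub>0 'f::field) \<Rightarrow> ('c list \<Rightarrow>\<^sub>0 'f)" where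
  "push_chain f = lin (\<lambda>\<sigma>. gen (map f \<sigma>))"

lemmas lin_simps = lin_add lin_diff lin_uminus lin_smul

lemma chain_cone_simps: "chain_cone x (c + d) = chain_cone x c + chain_cone x d" "chain_cone x (c - d) = chain_cone x c - chain_cone x d"
  "chain_cone x 0 = 0" "chain_cone x (gen \<sigma>) = gen (x # \<sigma>)"
  by (simp_all add: chain_cone_def lin_simps)

lemma bd_chain_chain_cone: "bd_chain (chain_cone x c) = c - chain_cone x (bd_chain c)"
proof -
  have "bd_chain (chain_cone x c) = lin (\<lambda>\<sigma>. bd_chain (gen (x # \<sigma>))) c"
    unfolding chain_cone_def by (rule lin_lin)
  also have "\<dots> = lin (\<lambda>\<sigma>. gen \<sigma> - chain_cone x (bd \<sigma>)) c"
    by simp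
  also have "\<dots> = c - chain_cone x (bd_chain c)"
    by (simp add: lin_fun_diff chain_cone_def lin_lin)
  finally show ?thesis .
qed

text \<open>By the cone formula the boundary of \<open>chain_cone x (bd \<sigma>)\<close>
  contributes \<open>bd \<sigma>\<close> again, which cancels the boundary of the face opposite
  \<open>x\<close>; what remains is a cone on \<open>bd_chain (bd \<sigma>)\<close>, zero by
  induction.\<close>

lemma bd_chain_bd: "bd_chain (bd \<sigma>) = 0"
  by (induction \<sigma>) (auto simp: lin_simps bd_chain_chain_cone chain_cone_simps)

lemma bd_chain_bd_chain: "bd_chain (bd_chain c) = 0"
proof -
  have "bd_chain (bd_chain c) = lin (\<lambda>\<sigma>. bd_chain (bd \<sigma>)) c" by (rule lin_lin)
  then show ?thesis by (simp only: bd_chain_bd) (simp add: lin_def)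
qed

lemma keys_chain_cone: "keys (chain_cone x c) \<subseteq> (\<lambda>\<sigma>. x # \<sigma>) ` keys c"
  using keys_lin[of "\<lambda>\<sigma>. gen (x # \<sigma>)" c] by (auto simp: chain_cone_def)

lemma push_chain_chain_cone: "push_chain f (chain_cone x c) = chain_cone (f x) (push_chain f c)"
  by (simp add: push_chain_def chain_cone_def lin_lin)

lemma bd_map: "bd (map f \<sigma>) = push_chain f (bd \<sigma> :: 'b list \<Rightarrow>\<^sub>0 'f::field)"
proof (induction \<sigma>)
  case Nil
  then show ?case by (simp add: push_chain_def)
next
  case (Cons x \<sigma>)
  have "push_chain f (bd (x # \<sigma>) :: 'b list \<Rightarrow>\<^sub>0 'f) = gen (map f \<sigma>) - push_chain f (chain_cone x (bd \<sigma>))"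
    by (simp add: push_chain_def lin_diff)
  then show ?case by (simp only: list.map bd.simps Cons push_chain_chain_cone)
qed

lemma bd_chain_push_chain: "bd_chain (push_chain f c) = push_chain f (bd_chain c)"
  by (simp add: push_chain_def lin_lin bd_map[unfolded push_chain_def])

lemma push_chain_push_chain: "push_chain f (push_chain g c) = push_chain (f \<circ> g) c"
  by (simp add: push_chain_def lin_lin)

lemma keys_push_chain: "keys (push_chain f c) \<subseteq> map f ` keys c"
  using keys_lin[of "\<lambda>\<sigma>. gen (map f \<sigma>)" c] by (auto simp: push_chain_def)

lemma keys_bd: "\<tau> \<in> keys (bd \<sigma> :: 'b list \<Rightarrow>\<^sub>0 'f::field) \<Longrightarrow> Suc (length \<tau>) = length \<sigma> \<and> set \<tau> \<subseteq> set \<sigma>"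
proof (induction \<sigma> arbitrary: \<tau>)
  case Nil
  then show ?case by simp
next
  case (Cons x \<sigma>)
  then have "\<tau> \<in> keys (gen \<sigma> :: 'b list \<Rightarrow>\<^sub>0 'f) \<union> keys (chain_cone x (bd \<sigma>) :: 'b list \<Rightarrow>\<^sub>0 'f)"
    using keys_diff_subset by fastforce
  then consider "\<tau> = \<sigma>" | \<tau>' where "\<tau>' \<in> keys (bd \<sigma> :: 'b list \<Rightarrow>\<^sub>0 'f)" "\<tau> = x # \<tau>'"
    using keys_chain_cone by fastforce
  then show ?case using Cons.IH by cases (auto)
qed

text \<open>The prism between \<open>map f \<sigma>\<close> and \<open>map g \<sigma>\<close>: the alternating sum of the lists
  \<open>f x\<^sub>0, \<dots>, f x\<^sub>i, g x\<^sub>i, \<dots>, g x\<^sub>q\<close>.\<close>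

fun prism :: "('b \<Rightarrow> 'c) \<Rightarrow> ('b \<Rightarrow> 'c) \<Rightarrow> 'b list \<Rightarrow> ('c list \<Rightarrow>\<^sub>0 'f::field)" where
  "prism f g [] = 0"
| "prism f g (x # \<sigma>) = gen (f x # g x # map g \<sigma>) - chain_cone (f x) (prism f g \<sigma>)"

lemma lin_prism_chain_cone:
  "lin (prism f g) (chain_cone x c) = chain_cone (f x) (chain_cone (g x) (push_chain g c)) - chain_cone (f x) (lin (prism f g) c)"
proof -
  have "lin (prism f g) (chain_cone x c) = lin (\<lambda>\<sigma>. gen (f x # g x # map g \<sigma>) - chain_cone (f x) (prism f g \<sigma>)) c"
    by (simp add: chain_cone_def lin_lin)
  also have "\<dots> = chain_cone (f x) (chain_cone (g x) (push_chain g c)) - chain_cone (f x) (lin (prism f g) c)"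
    by (simp add: lin_fun_diff chain_cone_def push_chain_def lin_lin)
  finally show ?thesis .
qed

text \<open>The chain homotopy identity: after expansion by the cone formula, the terms with apex
  \<open>f x\<close> cancel once \<open>lin (prism f g) (bd \<sigma>)\<close> is eliminated by the
  induction hypothesis. The empty list is included, with both sides zero.\<close>

lemma prism_bd:
  "bd_chain (prism f g \<sigma>) + lin (prism f g) (bd \<sigma>)
     = (gen (map g \<sigma>) - gen (map f \<sigma>) :: 'c list \<Rightarrow>\<^sub>0 'f::field)"
proof (induction \<sigma>)
  case Nil
  then show ?case by simp
next
  case (Cons x \<sigma>)
  have IH: "lin (prism f g) (bd \<sigma>)
      = (gen (map g \<sigma>) - gen (map f \<sigma>) - bd_chain (prism f g \<sigma>) :: 'c list \<Rightarrow>\<^sub>0 'f)"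
    unfolding Cons[symmetric] by simp
  have "bd_chain (prism f g (x # \<sigma>) :: 'c list \<Rightarrow>\<^sub>0 'f) = gen (g x # map g \<sigma>) - chain_cone (f x) (gen (map g \<sigma>) - chain_cone (g x) (push_chain g (bd \<sigma>)))
       - (prism f g \<sigma> - chain_cone (f x) (bd_chain (prism f g \<sigma>)))"
    by (simp add: lin_diff bd_chain_chain_cone bd_map)
  moreover have "lin (prism f g) (bd (x # \<sigma>)) = (prism f g \<sigma> :: 'c list \<Rightarrow>\<^sub>0 'f)
      - (chain_cone (f x) (chain_cone (g x) (push_chain g (bd \<sigma>))) - chain_cone (f x) (lin (prism f g) (bd \<sigma>)))"
    by (simp add: lin_diff lin_prism_chain_cone)
  ultimately show ?case
    unfolding IH by (simp add: chain_cone_simps)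
qed

lemma lin_prism_bd: "bd_chain (lin (prism f g) c) + lin (prism f g) (bd_chain c) = push_chain g c - push_chain f c"
proof -
  have "bd_chain (lin (prism f g) c) + lin (prism f g) (bd_chain c)
      = lin (\<lambda>\<sigma>. bd_chain (prism f g \<sigma>) + lin (prism f g) (bd \<sigma>)) c"
    by (simp add: lin_lin lin_fun_add)
  also have "\<dots> = push_chain g c - push_chain f c"
    by (simp add: prism_bd lin_fun_diff push_chain_def)
  finally show ?thesis .
qed

lemma keys_prism:
  "\<tau> \<in> keys (prism f g \<sigma> :: 'c list \<Rightarrow>\<^sub>0 'f::field) \<Longrightarrow> length \<tau> = Suc (length \<sigma>) \<and> set \<tau> \<subseteq> f ` set \<sigma> \<union> g ` set \<sigma>"
proof (induction \<sigma> arbitrary: \<tau>)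
  case Nil
  then show ?case by simp
next
  case (Cons x \<sigma>)
  then have "\<tau> \<in> keys (gen (f x # g x # map g \<sigma>) :: 'c list \<Rightarrow>\<^sub>0 'f) \<union> keys (chain_cone (f x) (prism f g \<sigma>) :: 'c list \<Rightarrow>\<^sub>0 'f)"
    using keys_diff_subset by fastforce
  then consider "\<tau> = f x # g x # map g \<sigma>"
    | \<tau>' where "\<tau>' \<in> keys (prism f g \<sigma> :: 'c list \<Rightarrow>\<^sub>0 'f)" "\<tau> = f x # \<tau>'"
    using keys_chain_cone by fastforce
  then show ?case using Cons.IH by cases (fastforce)+
qed

text \<open>Links the recursive boundary with the alternating sum in \<open>bdry\<close>: putting
  \<open>x\<close> in front moves every deletion position up by one and flips its sign, which is the
  minus before the cone, while position 0 gives the summand \<open>gen \<sigma>\<close>.\<close>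

lemma lookup_bd: "lookup (bd \<sigma> :: 'b list \<Rightarrow>\<^sub>0 'f::field) \<tau> = (\<Sum>i\<in>{i. i < length \<sigma> \<and> del_nth i \<sigma> = \<tau>}. (- 1) ^ i)"
proof (induction \<sigma> arbitrary: \<tau>)
  case Nil
  then show ?case by simp
next
  case (Cons x \<sigma>)
  have chain_cone: "lookup (chain_cone x c) \<tau> = (case \<tau> of [] \<Rightarrow> 0 | y # \<tau>' \<Rightarrow> if y = x then lookup c \<tau>' else 0)"
    for c :: "'b list \<Rightarrow>\<^sub>0 'f"
  proof (cases "\<exists>\<tau>'. \<tau> = x # \<tau>'")
    case True
    then obtain \<tau>' where t: "\<tau> = x # \<tau>'" by auto
    show ?thesis unfolding t
      by (auto simp: chain_cone_def lookup_lin lookup_gen if_distrib sum.delta not_in_keys_iff_lookup_eq_zero cong: if_cong)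
  next
    case False
    then have "x # \<sigma> \<noteq> \<tau>" for \<sigma> by auto
    then show ?thesis using False
      by (auto simp: chain_cone_def lookup_lin lookup_gen split: list.split)
  qed
  have d0: "del_nth 0 (x # \<sigma>) = \<sigma>" by (simp add: del_nth_def)
  have dS: "del_nth (Suc i) (x # \<sigma>) = x # del_nth i \<sigma>" for i by (simp add: del_nth_def)
  let ?S = "{i. i < length \<sigma> \<and> x # del_nth i \<sigma> = \<tau>}"
  have S: "{i. i < length (x # \<sigma>) \<and> del_nth i (x # \<sigma>) = \<tau>}
     = (if \<sigma> = \<tau> then {0} else {}) \<union> Suc ` ?S"
    (is "?L = ?R")
  proof (rule set_eqI)
    fix i show "i \<in> ?L \<longleftrightarrow> i \<in> ?R"
      by (cases i) (auto simp: d0 dS)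
  qed
  have fin: "finite ?S" by simp
  have "(\<Sum>i\<in>{i. i < length (x # \<sigma>) \<and> del_nth i (x # \<sigma>) = \<tau>}. (- 1) ^ i :: 'f)
      = (if \<sigma> = \<tau> then 1 else 0) + (\<Sum>i\<in>Suc ` ?S. (- 1) ^ i)"
    unfolding S by (subst sum.union_disjoint) (use fin in auto)
  also have "(\<Sum>i\<in>Suc ` ?S. (- 1) ^ i :: 'f) = - (\<Sum>i\<in>?S. (- 1) ^ i)"
    by (simp add: sum.reindex sum_negf)
  also have "(\<Sum>i\<in>?S. (- 1) ^ i :: 'f) = lookup (chain_cone x (bd \<sigma>)) \<tau>"
    unfolding chain_cone by (auto simp: Cons split: list.split)
  finally show ?case by (simp add: lookup_minus lookup_gen)
qed

subsection \<open>Barycentric subdivision\<close>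

definition bary :: "'a::real_vector list \<Rightarrow> 'a" where
  "bary \<sigma> = (1 / real (length \<sigma>)) *\<^sub>R sum_list \<sigma>"

text \<open>The first argument is meant to be the length of the list, one more than the dimension.
  It drives the recursion because the faces in \<open>bd \<sigma>\<close> are not structural parts
  of \<sigma>.\<close>

primrec subdiv :: "nat \<Rightarrow> 'a::real_vector list \<Rightarrow> ('a list \<Rightarrow>\<^sub>0 'f::field)" where
  "subdiv 0 \<sigma> = gen \<sigma>"
| "subdiv (Suc n) \<sigma> = chain_cone (bary \<sigma>) (lin (subdiv n) (bd \<sigma>))"

text \<open>The standard chain homotopy from the identity to subdivision: the cone formula returns
  the chain under the cone minus a cone on its boundary, and that boundary is the subdivided
  boundary of \<sigma>, so the cone is \<open>subdiv (Suc n) \<sigma>\<close>.\<close>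

primrec subdiv_htpy :: "nat \<Rightarrow> 'a::real_vector list \<Rightarrow> ('a list \<Rightarrow>\<^sub>0 'f::field)" where
  "subdiv_htpy 0 \<sigma> = 0"
| "subdiv_htpy (Suc n) \<sigma> = chain_cone (bary \<sigma>) (gen \<sigma> - lin (subdiv_htpy n) (bd \<sigma>))"

lemma lin_zero_fun: "(\<And>k. k \<in> keys c \<Longrightarrow> f k = 0) \<Longrightarrow> lin f c = 0"
  by (simp add: lin_def)

text \<open>Subdivision is a chain map: the cone formula leaves a cone on the boundary of the
  subdivided faces, which by induction is the subdivision of a double boundary.\<close>

lemma bd_chain_subdiv:
  "length \<sigma> = Suc n \<Longrightarrow> bd_chain (subdiv (Suc n) \<sigma>) = (lin (subdiv n) (bd \<sigma>) :: 'a::real_vector list \<Rightarrow>\<^sub>0 'f::field)"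
proof (induction n arbitrary: \<sigma>)
  case 0
  have "bd_chain (lin (subdiv 0) (bd \<sigma>) :: 'a list \<Rightarrow>\<^sub>0 'f) = lin (\<lambda>\<tau>. bd_chain (subdiv 0 \<tau>)) (bd \<sigma>)"
    by (rule lin_lin)
  also have "\<dots> = 0"
    by (rule lin_zero_fun) (use 0 keys_bd in fastforce)
  finally show ?case by (simp only: subdiv.simps(2) bd_chain_chain_cone chain_cone_simps diff_zero)
next
  case (Suc n)
  have "bd_chain (lin (subdiv (Suc n)) (bd \<sigma>) :: 'a list \<Rightarrow>\<^sub>0 'f) = lin (\<lambda>\<tau>. bd_chain (subdiv (Suc n) \<tau>)) (bd \<sigma>)"
    by (rule lin_lin)
  also have "\<dots> = lin (\<lambda>\<tau>. lin (subdiv n) (bd \<tau>)) (bd \<sigma>)"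
    by (rule lin_cong) (use Suc keys_bd in fastforce)
  also have "\<dots> = lin (subdiv n) (bd_chain (bd \<sigma>))"
    by (rule lin_lin[symmetric])
  also have "\<dots> = 0" by (simp add: bd_chain_bd)
  finally show ?case by (simp only: subdiv.simps(2)[of "Suc n" \<sigma>] bd_chain_chain_cone chain_cone_simps diff_zero)
qed

text \<open>The truncated \<open>n - 1\<close> is harmless for \<open>n = 0\<close>, where
  \<open>bd \<sigma>\<close> is zero.\<close>

lemma bd_chain_subdiv_htpy:
  "length \<sigma> = n \<Longrightarrow> bd_chain (subdiv_htpy n \<sigma>) = (gen \<sigma> - subdiv n \<sigma> - lin (subdiv_htpy (n - 1)) (bd \<sigma>) :: 'a::real_vector list \<Rightarrow>\<^sub>0 'f::field)"
proof (induction n arbitrary: \<sigma>)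
  case 0
  then show ?case by simp
next
  case (Suc n)
  let ?w = "gen \<sigma> - lin (subdiv_htpy n) (bd \<sigma>) :: 'a list \<Rightarrow>\<^sub>0 'f"
  have "bd_chain (lin (subdiv_htpy n) (bd \<sigma>) :: 'a list \<Rightarrow>\<^sub>0 'f) = lin (\<lambda>\<tau>. bd_chain (subdiv_htpy n \<tau>)) (bd \<sigma>)"
    by (rule lin_lin)
  also have "\<dots> = lin (\<lambda>\<tau>. gen \<tau> - subdiv n \<tau> - lin (subdiv_htpy (n - 1)) (bd \<tau>)) (bd \<sigma>)"
    by (rule lin_cong) (use Suc keys_bd in fastforce)
  also have "\<dots> = bd \<sigma> - lin (subdiv n) (bd \<sigma>) - lin (subdiv_htpy (n - 1)) (bd_chain (bd \<sigma>))"
    by (simp add: lin_fun_diff lin_lin)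
  finally have "bd_chain ?w = lin (subdiv n) (bd \<sigma>)"
    by (simp add: lin_diff bd_chain_bd)
  then show ?case
    by (simp add: bd_chain_chain_cone)
qed

lemma bary_in_hull:
  assumes "\<sigma> \<noteq> []" "set \<sigma> \<subseteq> C" "convex C"
  shows "bary \<sigma> \<in> C"
proof -
  have "bary \<sigma> = (\<Sum>i<length \<sigma>. (1 / real (length \<sigma>)) *\<^sub>R (\<sigma> ! i))"
    by (simp add: bary_def sum_list_sum_nth scaleR_right.sum atLeast0LessThan)
  also have "\<dots> \<in> C"
    by (rule convex_sum) (use assms in \<open>auto simp: subset_iff\<close>)
  finally show ?thesis .
qed

definition mesh_le :: "real \<Rightarrow> 'a::metric_space list \<Rightarrow> bool" where
  "mesh_le d \<sigma> \<longleftrightarrow> (\<forall>x\<in>set \<sigma>. \<forall>y\<in>set \<sigma>. dist x y \<le> d)"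

text \<open>\<open>bary \<sigma> - x\<close> is the mean of the differences from \<open>x\<close>
  over all positions of the list; at least one of them is zero, whence the factor.\<close>

lemma dist_bary:
  fixes \<sigma> :: "'a::real_normed_vector list"
  assumes "x \<in> set \<sigma>" "mesh_le d \<sigma>"
  shows "dist (bary \<sigma>) x \<le> (1 - 1 / real (length \<sigma>)) * d"
proof -
  define n where "n = length \<sigma>"
  obtain j where j: "j < n" "\<sigma> ! j = x"
    using assms(1) by (auto simp: in_set_conv_nth n_def)
  then have n: "real n > 0" by auto
  have "bary \<sigma> - x = (1 / real n) *\<^sub>R (\<Sum>i<n. \<sigma> ! i - x)"
    using n by (simp add: bary_def n_def[symmetric] sum_list_sum_nth sum_subtractf atLeast0LessThan
        scaleR_diff_right sum_constant_scaleR)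
  also have "(\<Sum>i<n. \<sigma> ! i - x) = (\<Sum>i\<in>{..<n} - {j}. \<sigma> ! i - x)"
    by (rule sum.mono_neutral_right) (use j in auto)
  finally have "dist (bary \<sigma>) x = (1 / real n) * norm (\<Sum>i\<in>{..<n} - {j}. \<sigma> ! i - x)"
    using n by (simp add: dist_norm)
  also have "norm (\<Sum>i\<in>{..<n} - {j}. \<sigma> ! i - x) \<le> real (card ({..<n} - {j})) * d"
    by (rule order_trans[OF norm_sum], rule order_trans[OF sum_bounded_above[where K=d]])
      (use assms in \<open>auto simp: mesh_le_def dist_norm n_def\<close>)
  also have "card ({..<n} - {j}) = n - 1"
    using j by simp
  finally show ?thesis
    using n j by (simp add: n_def[symmetric] field_simps of_nat_diff)
qed

text \<open>Balls are convex; this is used once for each of the two endpoints.\<close>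

lemma mesh_le_hull:
  fixes \<sigma> :: "'a::real_normed_vector list"
  assumes "mesh_le d \<sigma>" "set \<tau> \<subseteq> convex hull (set \<sigma>)"
  shows "mesh_le d \<tau>"
proof -
  have 1: "dist x y \<le> d" if "x \<in> set \<sigma>" "y \<in> convex hull (set \<sigma>)" for x y
  proof -
    have "convex hull (set \<sigma>) \<subseteq> cball x d"
      by (rule hull_minimal) (use assms that in \<open>auto simp: mesh_le_def\<close>)
    then show ?thesis using that by auto
  qed
  have "dist y x \<le> d" if "x \<in> convex hull (set \<sigma>)" "y \<in> convex hull (set \<sigma>)" for x y
  proof -
    have "convex hull (set \<sigma>) \<subseteq> cball y d"
      by (rule hull_minimal) (use 1 that in \<open>auto simp: dist_commute\<close>)
    then show ?thesis using that by auto
  qed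
  then show ?thesis using assms(2) by (auto simp: mesh_le_def)
qed

text \<open>A simplex of the subdivision joins the barycentre to a simplex of a subdivided face.
  Edges at the barycentre are bounded by \<open>dist_bary\<close>, extended from vertices to the
  hull by convexity of balls; edges inside the face have shrunk by the smaller factor of one
  dimension less.\<close>

lemma keys_subdiv:
  assumes "\<tau> \<in> keys (subdiv n \<sigma> :: 'a::real_normed_vector list \<Rightarrow>\<^sub>0 'f::field)" "length \<sigma> = n" "mesh_le d \<sigma>" "0 \<le> d"
  shows "length \<tau> = n \<and> set \<tau> \<subseteq> convex hull (set \<sigma>) \<and> mesh_le ((1 - 1 / real n) * d) \<tau>"
  using assms
proof (induction n arbitrary: \<sigma> \<tau>)
  case 0
  then show ?case by (auto simp: mesh_le_def)
next
  case (Suc n)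
  have "keys (lin (subdiv n) (bd \<sigma>) :: 'a list \<Rightarrow>\<^sub>0 'f) \<subseteq> (\<Union>\<rho>\<in>keys (bd \<sigma> :: 'a list \<Rightarrow>\<^sub>0 'f). keys (subdiv n \<rho> :: 'a list \<Rightarrow>\<^sub>0 'f))"
    by (rule keys_lin)
  moreover obtain \<tau>' where \<tau>': "\<tau> = bary \<sigma> # \<tau>'" "\<tau>' \<in> keys (lin (subdiv n) (bd \<sigma>) :: 'a list \<Rightarrow>\<^sub>0 'f)"
    using subsetD[OF keys_chain_cone Suc.prems(1)[unfolded subdiv.simps]] by auto
  ultimately obtain \<rho> where \<rho>: "\<rho> \<in> keys (bd \<sigma> :: 'a list \<Rightarrow>\<^sub>0 'f)" "\<tau>' \<in> keys (subdiv n \<rho> :: 'a list \<Rightarrow>\<^sub>0 'f)"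
    by auto
  have \<rho>': "length \<rho> = n" "set \<rho> \<subseteq> set \<sigma>" using keys_bd[OF \<rho>(1)] Suc.prems by auto
  then have "mesh_le d \<rho>" using Suc.prems by (auto simp: mesh_le_def)
  from Suc.IH[OF \<rho>(2) \<rho>'(1) this \<open>0 \<le> d\<close>]
  have IH: "length \<tau>' = n" "set \<tau>' \<subseteq> convex hull (set \<rho>)" "mesh_le ((1 - 1 / real n) * d) \<tau>'" by auto
  have h: "set \<tau>' \<subseteq> convex hull (set \<sigma>)" using IH(2) hull_mono[OF \<rho>'(2)] by blast
  have \<sigma>: "\<sigma> \<noteq> []" using Suc.prems by auto
  have b: "bary \<sigma> \<in> convex hull (set \<sigma>)"
    by (rule bary_in_hull) (use \<sigma> in \<open>auto simp: hull_subset\<close>)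
  let ?d = "(1 - 1 / real (Suc n)) * d"
  have "?d \<ge> 0" using \<open>0 \<le> d\<close> by (simp add: field_simps)
  have hc: "convex hull (set \<sigma>) \<subseteq> cball (bary \<sigma>) ?d"
    by (rule hull_minimal) (use dist_bary[OF _ Suc.prems(3)] Suc.prems(2) in auto)
  have "mesh_le ?d \<tau>'"
  \<comment> \<open>For \<open>n = 0\<close> division by zero makes the inductive factor 1, too
    large for \<open>?d\<close>, but then \<tau>' is empty.\<close>
  proof (cases "n = 0")
    case True
    then show ?thesis using IH(1) by (simp add: mesh_le_def)
  next
    case False
    then have "(1 - 1 / real n) * d \<le> ?d"
      by (intro mult_right_mono \<open>0 \<le> d\<close>) (simp add: field_simps)
    then show ?thesis using IH(3) by (force simp: mesh_le_def)
  qed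
  then have "mesh_le ?d \<tau>"
    using hc h \<open>?d \<ge> 0\<close> unfolding \<tau>'(1) mesh_le_def
    by (auto simp: dist_commute subset_iff)
  then show ?case using IH(1) h b \<tau>'(1) by auto
qed

lemma keys_subdiv_htpy:
  assumes "\<tau> \<in> keys (subdiv_htpy n \<sigma> :: 'a::real_normed_vector list \<Rightarrow>\<^sub>0 'f::field)" "length \<sigma> = n"
  shows "length \<tau> = Suc n \<and> set \<tau> \<subseteq> convex hull (set \<sigma>)"
  using assms
proof (induction n arbitrary: \<sigma> \<tau>)
  case 0
  then show ?case by simp
next
  case (Suc n)
  obtain \<tau>' where \<tau>': "\<tau> = bary \<sigma> # \<tau>'" "\<tau>' \<in> keys (gen \<sigma> - lin (subdiv_htpy n) (bd \<sigma>) :: 'a list \<Rightarrow>\<^sub>0 'f)"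
    using subsetD[OF keys_chain_cone Suc.prems(1)[unfolded subdiv_htpy.simps]] by auto
  have \<sigma>: "\<sigma> \<noteq> []" using Suc.prems by auto
  have b: "bary \<sigma> \<in> convex hull (set \<sigma>)"
    by (rule bary_in_hull) (use \<sigma> in \<open>auto simp: hull_subset\<close>)
  from \<tau>'(2) consider "\<tau>' = \<sigma>" | \<rho> where
    "\<rho> \<in> keys (bd \<sigma> :: 'a list \<Rightarrow>\<^sub>0 'f)" "\<tau>' \<in> keys (subdiv_htpy n \<rho> :: 'a list \<Rightarrow>\<^sub>0 'f)"
    using keys_diff_subset[of "gen \<sigma> :: 'a list \<Rightarrow>\<^sub>0 'f" "lin (subdiv_htpy n) (bd \<sigma>)"]
      keys_lin[of "subdiv_htpy n" "bd \<sigma> :: 'a list \<Rightarrow>\<^sub>0 'f"] by fastforce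
  then show ?case
  proof cases
    case 1
    then show ?thesis using \<tau>'(1) b Suc.prems by (auto simp: hull_inc)
  next
    case 2
    then have "length \<rho> = n" "set \<rho> \<subseteq> set \<sigma>" using keys_bd[OF 2(1)] Suc.prems by auto
    with Suc.IH[OF 2(2)] show ?thesis using hull_mono[of "set \<rho>" "set \<sigma>" convex] b \<tau>'(1) by auto
  qed
qed

section \<open>Fine fillings of fine cycles\<close>

definition fine_in :: "'a::real_normed_vector set \<Rightarrow> real \<Rightarrow> nat \<Rightarrow> 'a list \<Rightarrow> bool" where
  "fine_in Q d n \<sigma> \<longleftrightarrow> length \<sigma> = n \<and> convex hull (set \<sigma>) \<subseteq> Q \<and> mesh_le d \<sigma>"

text \<open>The subdivision of \<open>E\<close> fills the subdivision of \<open>c\<close>; adding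
  the homotopy of \<open>c\<close> gives a filling of \<open>c\<close> itself. The simplices of this
  correction lie in hulls of simplices of \<open>c\<close>, so their mesh is bounded by \<delta>
  only, which accounts for the maximum. As \<open>fine_in\<close> puts whole hulls into
  \<open>Q\<close>, subdividing never leaves \<open>Q\<close>.\<close>

lemma subdivide_filling:
  fixes E c :: "'a::real_normed_vector list \<Rightarrow>\<^sub>0 'f::field"
  assumes E: "\<And>\<tau>. \<tau> \<in> keys E \<Longrightarrow> fine_in Q \<rho> (Suc n) \<tau>" and bE: "bd_chain E = c"
    and c: "\<And>\<sigma>. \<sigma> \<in> keys c \<Longrightarrow> mesh_le \<delta> \<sigma>" and "\<rho> \<ge> 0" "\<delta> \<ge> 0"
  shows "\<exists>E' :: 'a list \<Rightarrow>\<^sub>0 'f. (\<forall>\<tau>\<in>keys E'. fine_in Q (max \<delta> ((1 - 1 / real (Suc n)) * \<rho>)) (Suc n) \<tau>) \<and> bd_chain E' = c"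
proof (intro exI conjI ballI)
  let ?E' = "lin (subdiv (Suc n)) E + lin (subdiv_htpy n) c :: 'a list \<Rightarrow>\<^sub>0 'f"
  have ck: "length \<sigma> = n \<and> convex hull (set \<sigma>) \<subseteq> Q" if "\<sigma> \<in> keys c" for \<sigma>
  proof -
    obtain \<tau> where "\<tau> \<in> keys E" "\<sigma> \<in> keys (bd \<tau> :: 'a list \<Rightarrow>\<^sub>0 'f)"
      using \<open>\<sigma> \<in> keys c\<close> keys_lin[of bd E] bE by auto
    then show ?thesis using E[of \<tau>] keys_bd[of \<sigma> \<tau>] hull_mono[of "set \<sigma>" "set \<tau>" convex]
      unfolding fine_in_def by fastforce
  qed
  have "bd_chain (lin (subdiv (Suc n)) E) = lin (\<lambda>\<tau>. bd_chain (subdiv (Suc n) \<tau>)) E" by (rule lin_lin)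
  also have "\<dots> = lin (\<lambda>\<tau>. lin (subdiv n) (bd \<tau>)) E"
    by (rule lin_cong, rule bd_chain_subdiv) (use E in \<open>auto simp: fine_in_def\<close>)
  also have "\<dots> = lin (subdiv n) c" unfolding bE[symmetric] by (rule lin_lin[symmetric])
  finally have 1: "bd_chain (lin (subdiv (Suc n)) E) = lin (subdiv n) c" .
  have "bd_chain (lin (subdiv_htpy n) c) = lin (\<lambda>\<tau>. bd_chain (subdiv_htpy n \<tau>)) c" by (rule lin_lin)
  also have "\<dots> = lin (\<lambda>\<sigma>. gen \<sigma> - subdiv n \<sigma> - lin (subdiv_htpy (n - 1)) (bd \<sigma>)) c"
    by (rule lin_cong, rule bd_chain_subdiv_htpy) (use ck in auto)
  also have "\<dots> = c - lin (subdiv n) c - lin (subdiv_htpy (n - 1)) (bd_chain c)"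
    by (simp add: lin_fun_diff lin_lin)
  also have "bd_chain c = 0" unfolding bE[symmetric] by (rule bd_chain_bd_chain)
  finally have 2: "bd_chain (lin (subdiv_htpy n) c) = c - lin (subdiv n) c" by simp
  show "bd_chain ?E' = c" using 1 2 by (simp add: lin_add)
  fix \<tau> assume "\<tau> \<in> keys ?E'"
  then consider "\<tau> \<in> keys (lin (subdiv (Suc n)) E)" | "\<tau> \<in> keys (lin (subdiv_htpy n) c)"
    using keys_add_subset[of "lin (subdiv (Suc n)) E" "lin (subdiv_htpy n) c"] by auto
  then show "fine_in Q (max \<delta> ((1 - 1 / real (Suc n)) * \<rho>)) (Suc n) \<tau>"
  proof cases
    case 1
    then obtain \<sigma> where \<sigma>: "\<sigma> \<in> keys E" "\<tau> \<in> keys (subdiv (Suc n) \<sigma> :: 'a list \<Rightarrow>\<^sub>0 'f)"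
      using keys_lin[of "subdiv (Suc n)" E] by auto
    from keys_subdiv[OF this(2) _ _ \<open>\<rho> \<ge> 0\<close>] E[OF \<sigma>(1)]
    have "length \<tau> = Suc n" "set \<tau> \<subseteq> convex hull (set \<sigma>)" "mesh_le ((1 - 1 / real (Suc n)) * \<rho>) \<tau>"
      by (auto simp: fine_in_def)
    moreover from this(2) have "convex hull (set \<tau>) \<subseteq> convex hull (set \<sigma>)"
      by (simp add: hull_minimal)
    ultimately show ?thesis using E[OF \<sigma>(1)] by (force simp: fine_in_def mesh_le_def)
  next
    case 2
    then obtain \<sigma> where \<sigma>: "\<sigma> \<in> keys c" "\<tau> \<in> keys (subdiv_htpy n \<sigma> :: 'a list \<Rightarrow>\<^sub>0 'f)"
      using keys_lin[of "subdiv_htpy n" c] by auto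
    from keys_subdiv_htpy[OF this(2)] ck[OF \<sigma>(1)]
    have \<tau>: "length \<tau> = Suc n" "set \<tau> \<subseteq> convex hull (set \<sigma>)" by auto
    then have "mesh_le \<delta> \<tau>" using mesh_le_hull[OF c[OF \<sigma>(1)]] by auto
    moreover from \<tau>(2) have "convex hull (set \<tau>) \<subseteq> convex hull (set \<sigma>)"
      by (simp add: hull_minimal)
    ultimately show ?thesis using \<tau> ck[OF \<sigma>(1)] by (force simp: fine_in_def mesh_le_def)
  qed
qed

text \<open>The factor \<open>t < 1\<close> depends on the number of vertices alone, so finitely
  many subdivisions bring the mesh below \<delta>; the corrections added on the way never exceed
  \<delta>.\<close>

lemma fine_filling:
  fixes E c :: "'a::real_normed_vector list \<Rightarrow>\<^sub>0 'f::field"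
  assumes E: "\<And>\<tau>. \<tau> \<in> keys E \<Longrightarrow> fine_in Q \<rho> (Suc n) \<tau>" and bE: "bd_chain E = c"
    and c: "\<And>\<sigma>. \<sigma> \<in> keys c \<Longrightarrow> mesh_le \<delta> \<sigma>" and "\<rho> \<ge> 0" "\<delta> > 0"
  obtains E' :: "'a list \<Rightarrow>\<^sub>0 'f" where "\<forall>\<tau>\<in>keys E'. fine_in Q \<delta> (Suc n) \<tau>" "bd_chain E' = c"
proof -
  define t where "t = 1 - 1 / real (Suc n)"
  have t: "0 \<le> t" "t < 1" by (auto simp: t_def field_simps)
  have mono: "fine_in Q d n \<tau> \<Longrightarrow> d \<le> d' \<Longrightarrow> fine_in Q d' n \<tau>" for d d' n and \<tau> :: "'a list"
    by (force simp: fine_in_def mesh_le_def)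
  have "\<exists>E'. (\<forall>\<tau>\<in>keys E'. fine_in Q (max \<delta> (t ^ k * \<rho>)) (Suc n) \<tau>) \<and> bd_chain E' = c" for k
  proof (induction k)
    case 0
    show ?case by (rule exI[of _ E]) (use E bE mono in force)
  next
    case (Suc k)
    then obtain E' where E': "\<forall>\<tau>\<in>keys E'. fine_in Q (max \<delta> (t ^ k * \<rho>)) (Suc n) \<tau>" "bd_chain E' = c" by auto
    have "max \<delta> (t ^ k * \<rho>) \<ge> 0" using \<open>\<delta> > 0\<close> by auto
    from subdivide_filling[OF E'(1)[rule_format] E'(2) c this] \<open>\<delta> > 0\<close>
    obtain E'' where E'': "\<forall>\<tau>\<in>keys E''. fine_in Q (max \<delta> (t * max \<delta> (t ^ k * \<rho>))) (Suc n) \<tau>" "bd_chain E'' = c"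
      unfolding t_def[symmetric] by auto
    have "t * \<delta> \<le> \<delta>" using t \<open>\<delta> > 0\<close> by (simp add: mult_left_le_one_le)
    then have "max \<delta> (t * max \<delta> (t ^ k * \<rho>)) \<le> max \<delta> (t ^ Suc k * \<rho>)"
      using t by (auto simp: max_def mult.assoc)
    then show ?case using E'' mono by blast
  qed
  moreover have "(\<lambda>k. t ^ k * \<rho>) \<longlonglongrightarrow> 0 * \<rho>"
    by (intro tendsto_intros LIMSEQ_realpow_zero t)
  then have "eventually (\<lambda>k. t ^ k * \<rho> < \<delta>) sequentially"
    using \<open>\<delta> > 0\<close> by (auto dest: order_tendstoD)
  then obtain k where "t ^ k * \<rho> < \<delta>" by (auto simp: eventually_sequentially)
  then have "max \<delta> (t ^ k * \<rho>) = \<delta>" by auto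
  ultimately show ?thesis using that by metis
qed

subsection \<open>Chains on nerves\<close>

lemma finite_nerve [simp]: "finite U \<Longrightarrow> finite (nerve X U q)"
proof -
  assume "finite U"
  have "nerve X U q \<subseteq> {\<sigma>. set \<sigma> \<subseteq> U \<and> length \<sigma> = nat (q + 1)}"
    by (auto simp: nerve_def)
  then show ?thesis
    using finite_lists_length_eq[OF \<open>finite U\<close>] finite_subset by blast
qed

lemma nerve_neg: "q < 0 \<Longrightarrow> nerve X U q = {}"
  by (auto simp: nerve_def)

text \<open>Passage from the plain functions of the definitions to finitely supported ones, on which
  the operators above act; it rests on the finiteness of the nerve.\<close>

lemma chains_lookup:
  assumes "finite U" "c \<in> chains X U q"
  obtains C :: "'a set list \<Rightarrow>\<^sub>0 'f::field" where "lookup C = c" "keys C \<subseteq> nerve X U q"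
proof -
  have "{\<sigma>. c \<sigma> \<noteq> 0} \<subseteq> nerve X U q" using assms(2) by (auto simp: chains_def)
  then have "finite {\<sigma>. c \<sigma> \<noteq> 0}" by (rule finite_subset) (simp add: assms)
  then have "lookup (Abs_poly_mapping c) = c" by simp
  moreover from this have "keys (Abs_poly_mapping c) \<subseteq> nerve X U q"
    using \<open>{\<sigma>. c \<sigma> \<noteq> 0} \<subseteq> nerve X U q\<close> by (auto simp: in_keys_iff)
  ultimately show thesis by (rule that)
qed

lemma lookup_chains: "keys C \<subseteq> nerve X U q \<Longrightarrow> lookup C \<in> chains X U q"
  by (auto simp: chains_def in_keys_iff)

lemma nerve_bd:
  assumes "\<sigma> \<in> nerve X U q" "q \<ge> 1" "\<tau> \<in> keys (bd \<sigma> :: 'a set list \<Rightarrow>\<^sub>0 'f::field)"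
  shows "\<tau> \<in> nerve X U (q - 1)"
proof -
  have "set \<tau> \<subseteq> set \<sigma>" "Suc (length \<tau>) = length \<sigma>" using keys_bd[OF assms(3)] by auto
  moreover from this have "\<Inter>(set \<sigma>) \<subseteq> \<Inter>(set \<tau>)" by blast
  moreover have "\<Inter>(set \<sigma>) \<inter> X \<noteq> {}" using assms(1) by (simp add: nerve_def)
  ultimately have "\<Inter>(set \<tau>) \<inter> X \<noteq> {}" by blast
  with \<open>set \<tau> \<subseteq> set \<sigma>\<close> \<open>Suc (length \<tau>) = length \<sigma>\<close> show ?thesis
    using assms(1,2) unfolding nerve_def by auto
qed

lemma keys_bd_chain_nerve:
  assumes "keys (C :: 'a set list \<Rightarrow>\<^sub>0 'f::field) \<subseteq> nerve X U q" "q \<ge> 1"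
  shows "keys (bd_chain C) \<subseteq> nerve X U (q - 1)"
  using keys_lin[of bd C] nerve_bd[OF _ assms(2)] assms(1) by blast

text \<open>In degree 0 the two boundaries differ: \<open>bd\<close> augments to the empty list,
  while \<open>bdry\<close> vanishes because the nerve in degree -1 is empty. This is the origin of
  the alternative \<open>q \<le> 0\<close> in the descriptions of cycles below.\<close>

lemma bdry_lookup:
  fixes C :: "'a set list \<Rightarrow>\<^sub>0 'f::field"
  assumes "finite U" "keys C \<subseteq> nerve X U q" "q \<ge> 1"
  shows "bdry X U q (lookup C) = lookup (bd_chain C)"
proof
  fix \<tau>
  show "bdry X U q (lookup C) \<tau> = lookup (bd_chain C) \<tau>"
  proof (cases "\<tau> \<in> nerve X U (q - 1)")
    case False
    then show ?thesis using keys_bd_chain_nerve[OF assms(2,3)]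
      by (auto simp: bdry_def in_keys_iff)
  next
    case True
    have "{(\<sigma>, i). \<sigma> \<in> nerve X U q \<and> i < length \<sigma> \<and> del_nth i \<sigma> = \<tau>}
        = (SIGMA \<sigma>:nerve X U q. {i. i < length \<sigma> \<and> del_nth i \<sigma> = \<tau>})" by auto
    then have "bdry X U q (lookup C) \<tau>
        = (\<Sum>\<sigma>\<in>nerve X U q. \<Sum>i\<in>{i. i < length \<sigma> \<and> del_nth i \<sigma> = \<tau>}. (- 1) ^ i * lookup C \<sigma>)"
      using True assms(1) by (simp add: bdry_def sum.Sigma)
    also have "\<dots> = (\<Sum>\<sigma>\<in>nerve X U q. lookup C \<sigma> * lookup (bd \<sigma>) \<tau>)"
      by (simp add: lookup_bd sum_distrib_left mult.commute)
    also have "\<dots> = lookup (bd_chain C) \<tau>"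
      by (rule lookup_lin_superset[symmetric]) (use assms in auto)
    finally show ?thesis .
  qed
qed

lemma bdry_nonpos:
  assumes "q \<le> 0"
  shows "bdry X U q c = (\<lambda>_. 0)"
  using nerve_neg[of "q - 1" X U] assms by (auto simp: bdry_def)

lemma mem_cycles_iff:
  fixes c :: "'a set list \<Rightarrow> 'f::field"
  assumes "finite U"
  shows "c \<in> cycles X U q \<longleftrightarrow> (\<exists>C. lookup C = c \<and> keys C \<subseteq> nerve X U q \<and> (q \<le> 0 \<or> bd_chain C = 0))"
proof
  assume c: "c \<in> cycles X U q"
  then obtain C where C: "lookup C = c" "keys C \<subseteq> nerve X U q"
    using chains_lookup[OF assms] unfolding cycles_def by blast
  show "\<exists>C. lookup C = c \<and> keys C \<subseteq> nerve X U q \<and> (q \<le> 0 \<or> bd_chain C = 0)"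
  proof (cases "q \<ge> 1")
    case True
    have "lookup (bd_chain C) = (\<lambda>_. 0)"
      using c bdry_lookup[OF assms C(2) True] C(1) by (auto simp: cycles_def)
    then have "bd_chain C = 0" by (intro poly_mapping_eqI) simp
    then show ?thesis using C by auto
  qed (use C in auto)
next
  assume "\<exists>C. lookup C = c \<and> keys C \<subseteq> nerve X U q \<and> (q \<le> 0 \<or> bd_chain C = 0)"
  then obtain C where C: "lookup C = c" "keys C \<subseteq> nerve X U q" "q \<le> 0 \<or> bd_chain C = 0" by auto
  have "bdry X U q c = (\<lambda>_. 0)"
  proof (cases "q \<le> 0")
    case False
    then show ?thesis using bdry_lookup[OF assms C(2)] C by auto
  qed (rule bdry_nonpos)
  then show "c \<in> cycles X U q" using lookup_chains[OF C(2)] C(1) by (auto simp: cycles_def)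
qed

lemma mem_bdries_iff:
  fixes c :: "'a set list \<Rightarrow> 'f::field"
  assumes "finite U" "q \<ge> 0"
  shows "c \<in> bdries X U q \<longleftrightarrow> (\<exists>B. lookup (bd_chain B) = c \<and> keys B \<subseteq> nerve X U (q + 1))"
proof
  assume "c \<in> bdries X U q"
  then obtain b where b: "b \<in> chains X U (q + 1)" "c = bdry X U (q + 1) b" by (auto simp: bdries_def)
  obtain B where B: "lookup B = b" "keys B \<subseteq> nerve X U (q + 1)"
    using chains_lookup[OF assms(1) b(1)] .
  show "\<exists>B. lookup (bd_chain B) = c \<and> keys B \<subseteq> nerve X U (q + 1)"
    using bdry_lookup[OF assms(1) B(2)] B b assms by auto
next
  assume "\<exists>B. lookup (bd_chain B) = c \<and> keys B \<subseteq> nerve X U (q + 1)"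
  then obtain B where B: "lookup (bd_chain B) = c" "keys B \<subseteq> nerve X U (q + 1)" by auto
  show "c \<in> bdries X U q"
    unfolding bdries_def using lookup_chains[OF B(2)] bdry_lookup[OF assms(1) B(2)] B assms
    by (intro image_eqI[of _ _ "lookup B"]) auto
qed

lemma cyclesE:
  fixes c :: "'a set list \<Rightarrow> 'f::field"
  assumes "finite U" "c \<in> cycles X U q"
  obtains C where "lookup C = c" "keys C \<subseteq> nerve X U q" "q \<le> 0 \<or> bd_chain C = 0"
  using assms(2) unfolding mem_cycles_iff[OF assms(1)] by auto

lemma cyclesI:
  assumes "finite U" "keys C \<subseteq> nerve X U q" "q \<le> 0 \<or> bd_chain C = 0"
  shows "lookup C \<in> cycles X U q"
  using assms(2,3) unfolding mem_cycles_iff[OF assms(1)] by auto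

lemma bdriesE:
  fixes c :: "'a set list \<Rightarrow> 'f::field"
  assumes "finite U" "q \<ge> 0" "c \<in> bdries X U q"
  obtains B where "lookup (bd_chain B) = c" "keys B \<subseteq> nerve X U (q + 1)"
  using assms(3) unfolding mem_bdries_iff[OF assms(1,2)] by auto

lemma bdriesI:
  assumes "finite U" "q \<ge> 0" "keys B \<subseteq> nerve X U (q + 1)"
  shows "lookup (bd_chain B) \<in> bdries X U q"
  using assms(3) unfolding mem_bdries_iff[OF assms(1,2)] by auto

lemma zero_chains: "(\<lambda>_. 0) \<in> chains X U q"
  by (auto simp: chains_def)

lemma bdries_neg: "q < 0 \<Longrightarrow> bdries X U q = {\<lambda>_. 0}"
  using zero_chains by (fastforce simp: bdries_def bdry_nonpos)

lemma chains_neg: "q < 0 \<Longrightarrow> chains X U q = {\<lambda>_. 0}"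
  by (auto simp: chains_def nerve_neg)

lemma chain_push_lookup:
  fixes C :: "'a set list \<Rightarrow>\<^sub>0 'f::field"
  assumes "finite V" "keys C \<subseteq> nerve X V q"
  shows "chain_push X V q g (lookup C) = lookup (push_chain g C)"
proof
  fix \<tau>
  have "lookup (push_chain g C) \<tau> = (\<Sum>\<sigma>\<in>nerve X V q. if map g \<sigma> = \<tau> then lookup C \<sigma> else 0)"
    unfolding push_chain_def
    by (subst lookup_lin_superset[OF finite_nerve[OF assms(1)] assms(2)]) (auto simp: lookup_gen intro: sum.cong)
  also have "\<dots> = (\<Sum>\<sigma>\<in>{\<sigma>\<in>nerve X V q. map g \<sigma> = \<tau>}. lookup C \<sigma>)"
    using assms(1) by (simp add: sum.inter_filter)
  finally show "chain_push X V q g (lookup C) \<tau> = lookup (push_chain g C) \<tau>"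
    by (simp add: chain_push_def)
qed

section \<open>Cycles and boundaries as linear subspaces\<close>

definition lin_subspace :: "('b \<Rightarrow> 'f::field) set \<Rightarrow> bool" where
  "lin_subspace W \<longleftrightarrow> (\<lambda>_. 0) \<in> W \<and> (\<forall>c\<in>W. \<forall>d\<in>W. \<forall>a b. (\<lambda>\<sigma>. a * c \<sigma> + b * d \<sigma>) \<in> W)"

lemma subspD: "lin_subspace W \<Longrightarrow> c \<in> W \<Longrightarrow> d \<in> W \<Longrightarrow> (\<lambda>\<sigma>. a * c \<sigma> + b * d \<sigma>) \<in> W"
  by (auto simp: lin_subspace_def)

lemma lin_subspace_zero: "lin_subspace W \<Longrightarrow> (\<lambda>_. 0) \<in> W"
  by (auto simp: lin_subspace_def)

lemma lin_subspace_add: "lin_subspace W \<Longrightarrow> c \<in> W \<Longrightarrow> d \<in> W \<Longrightarrow> (\<lambda>\<sigma>. c \<sigma> + d \<sigma>) \<in> W"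
  using subspD[of W c d 1 1] by simp

lemma lin_subspace_diff: "lin_subspace W \<Longrightarrow> c \<in> W \<Longrightarrow> d \<in> W \<Longrightarrow> (\<lambda>\<sigma>. c \<sigma> - d \<sigma>) \<in> W"
  using subspD[of W c d 1 "- 1"] by simp

lemma lin_subspace_scale: "lin_subspace W \<Longrightarrow> c \<in> W \<Longrightarrow> (\<lambda>\<sigma>. a * c \<sigma>) \<in> W"
  using subspD[of W c c a 0] by simp

lemma lin_subspace_sum:
  assumes "lin_subspace W" "\<And>i. i \<in> I \<Longrightarrow> c i \<in> W"
  shows "(\<lambda>\<sigma>. \<Sum>i\<in>I. a i * c i \<sigma>) \<in> W"
  using assms(2)
proof (induction I rule: infinite_finite_induct)
  case (insert x F)
  then have "(\<lambda>\<sigma>. a x * c x \<sigma> + 1 * (\<Sum>i\<in>F. a i * c i \<sigma>)) \<in> W"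
    using assms(1) by (intro subspD) auto
  then show ?case using insert by simp
qed (use assms in \<open>auto simp: lin_subspace_zero\<close>)

lemma lin_subspace_chains: "lin_subspace (chains X U q)"
  by (auto simp: lin_subspace_def chains_def)

lemma bdry_lincomb:
  "bdry X U q (\<lambda>\<sigma>. a * c \<sigma> + b * d \<sigma>) = (\<lambda>\<sigma>. a * bdry X U q c \<sigma> + b * bdry X U q d \<sigma>)"
  by (rule ext) (auto simp: bdry_def sum_distrib_left sum.distrib[symmetric] algebra_simps intro!: sum.cong)

lemma lin_subspace_cycles: "lin_subspace (cycles X U q)"
proof -
  have "(\<lambda>_. 0) \<in> cycles X U q"
    using zero_chains by (simp add: cycles_def bdry_def fun_eq_iff)
  moreover have "(\<lambda>\<sigma>. a * c \<sigma> + b * d \<sigma>) \<in> cycles X U q" if "c \<in> cycles X U q" "d \<in> cycles X U q" for c d a b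
  proof -
    have "bdry X U q c = (\<lambda>_. 0)" "bdry X U q d = (\<lambda>_. 0)" "c \<in> chains X U q" "d \<in> chains X U q"
      using that by (auto simp: cycles_def)
    then show ?thesis
      using subspD[OF lin_subspace_chains, of c X U q d a b] bdry_lincomb[of X U q a c b d] unfolding cycles_def by simp
  qed
  ultimately show ?thesis unfolding lin_subspace_def by blast
qed

lemma lin_subspace_bdries: "lin_subspace (bdries X U q)"
proof -
  have "(\<lambda>_. 0) = bdry X U (q + 1) (\<lambda>_. 0)" by (simp add: bdry_def fun_eq_iff)
  then have "(\<lambda>_. 0) \<in> bdries X U q" using zero_chains unfolding bdries_def by blast
  moreover have "(\<lambda>\<sigma>. a * c \<sigma> + b * d \<sigma>) \<in> bdries X U q" if cd: "c \<in> bdries X U q" "d \<in> bdries X U q" for c d a b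
  proof -
    obtain c' d' where "c' \<in> chains X U (q + 1)" "d' \<in> chains X U (q + 1)"
      "c = bdry X U (q + 1) c'" "d = bdry X U (q + 1) d'"
      using cd by (auto simp: bdries_def)
    note c'd' = this
    have "(\<lambda>\<sigma>. a * c \<sigma> + b * d \<sigma>) = bdry X U (q + 1) (\<lambda>\<sigma>. a * c' \<sigma> + b * d' \<sigma>)"
      by (simp only: bdry_lincomb c'd'(3,4))
    then show ?thesis
      unfolding bdries_def using subspD[OF lin_subspace_chains c'd'(1,2)] by (rule image_eqI)
  qed
  ultimately show ?thesis unfolding lin_subspace_def by blast
qed

lemma bdries_subset_cycles:
  assumes "finite U"
  shows "bdries X U q \<subseteq> (cycles X U q :: ('a set list \<Rightarrow> 'f::field) set)"
proof (cases "q \<ge> 0")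
  case False
  then show ?thesis using lin_subspace_zero[OF lin_subspace_cycles] by (simp add: bdries_neg)
next
  case True
  show ?thesis
  proof
    fix c :: "'a set list \<Rightarrow> 'f" assume "c \<in> bdries X U q"
    then obtain B where B: "lookup (bd_chain B) = c" "keys B \<subseteq> nerve X U (q + 1)"
      using bdriesE[OF assms True] by metis
    have "keys (bd_chain B) \<subseteq> nerve X U q" using keys_bd_chain_nerve[OF B(2)] True by simp
    then have "lookup (bd_chain B) \<in> cycles X U q" by (rule cyclesI[OF assms]) (simp add: bd_chain_bd_chain)
    then show "c \<in> cycles X U q" using B by simp
  qed
qed

lemma chain_push_lincomb:
  "chain_push X V q g (\<lambda>\<sigma>. a * c \<sigma> + b * d \<sigma>) = (\<lambda>\<sigma>. a * chain_push X V q g c \<sigma> + b * chain_push X V q g d \<sigma>)"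
  by (rule ext) (auto simp: chain_push_def sum_distrib_left sum.distrib)

lemma chain_push_diff:
  "chain_push X V q g (\<lambda>\<sigma>. c \<sigma> - d \<sigma>) = (\<lambda>\<sigma>. chain_push X V q g c \<sigma> - chain_push X V q g d \<sigma>)"
  using chain_push_lincomb[of X V q g 1 c "- 1" d] by simp

lemma chain_push_sum:
  "chain_push X V q g (\<lambda>\<sigma>. \<Sum>i\<in>I. a i * c i \<sigma>) = (\<lambda>\<sigma>. \<Sum>i\<in>I. a i * chain_push X V q g (c i) \<sigma>)"
proof
  fix \<tau>
  have "chain_push X V q g (\<lambda>\<sigma>. \<Sum>i\<in>I. a i * c i \<sigma>) \<tau>
    = (\<Sum>\<sigma>\<in>{\<sigma> \<in> nerve X V q. map g \<sigma> = \<tau>}. \<Sum>i\<in>I. a i * c i \<sigma>)" by (simp add: chain_push_def)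
  also have "\<dots> = (\<Sum>i\<in>I. a i * chain_push X V q g (c i) \<tau>)"
    by (subst sum.swap) (simp add: chain_push_def sum_distrib_left)
  finally show "chain_push X V q g (\<lambda>\<sigma>. \<Sum>i\<in>I. a i * c i \<sigma>) \<tau>
    = (\<Sum>i\<in>I. a i * chain_push X V q g (c i) \<tau>)" .
qed

lemma nerve_mono: "X \<subseteq> Y \<Longrightarrow> nerve X U q \<subseteq> nerve Y U q"
  by (auto simp: nerve_def)

text \<open>Simplices of the nerve of \<open>Y\<close> that do not meet \<open>X\<close> carry the
  coefficient zero.\<close>

lemma chain_push_mono:
  assumes "finite V" "X \<subseteq> Y" "c \<in> chains X V q"
  shows "chain_push Y V q g c = chain_push X V q g c"
proof
  fix \<tau>
  show "chain_push Y V q g c \<tau> = chain_push X V q g c \<tau>"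
    unfolding chain_push_def
    by (rule sum.mono_neutral_right) (use assms nerve_mono[OF assms(2), of V q] in \<open>auto simp: chains_def\<close>)
qed

lemma cycles_mono:
  assumes "finite U" "X \<subseteq> Y"
  shows "cycles X U q \<subseteq> (cycles Y U q :: ('a set list \<Rightarrow> 'f::field) set)"
proof
  fix c :: "'a set list \<Rightarrow> 'f" assume "c \<in> cycles X U q"
  then obtain C where C: "lookup C = c" "keys C \<subseteq> nerve X U q" "q \<le> 0 \<or> bd_chain C = 0"
    using cyclesE[OF assms(1)] by metis
  then have "keys C \<subseteq> nerve Y U q" using nerve_mono[OF assms(2)] by blast
  with C show "c \<in> cycles Y U q" using cyclesI[OF assms(1)] by metis
qed

lemma bdries_mono:
  assumes "finite U" "X \<subseteq> Y"
  shows "bdries X U q \<subseteq> (bdries Y U q :: ('a set list \<Rightarrow> 'f::field) set)"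
proof (cases "q \<ge> 0")
  case True
  show ?thesis
  proof
    fix c :: "'a set list \<Rightarrow> 'f" assume "c \<in> bdries X U q"
    then obtain B where B: "lookup (bd_chain B) = c" "keys B \<subseteq> nerve X U (q + 1)"
      using bdriesE[OF assms(1) True] by metis
    then have "keys B \<subseteq> nerve Y U (q + 1)" using nerve_mono[OF assms(2)] by blast
    with B show "c \<in> bdries Y U q" using bdriesI[OF assms(1) True] by metis
  qed
qed (simp add: bdries_neg)

lemma cycles_subset_chains: "c \<in> cycles X U q \<Longrightarrow> c \<in> chains X U q"
  by (simp add: cycles_def)

text \<open>Contiguity of vertex maps, with \<open>f = g\<close> expressing that \<open>f\<close> is
  simplicial. Source and target nerve belong to different spaces, neither assumed to contain the
  other: shrinking a cover will give maps from the nerve of a larger set back to that of a smaller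
  one.\<close>

definition contig :: "'a set \<Rightarrow> 'a set set \<Rightarrow> 'a set \<Rightarrow> 'a set set \<Rightarrow> ('a set \<Rightarrow> 'a set) \<Rightarrow> ('a set \<Rightarrow> 'a set) \<Rightarrow> bool" where
  "contig X V Y U f g \<longleftrightarrow> (\<forall>s\<subseteq>V. s \<noteq> {} \<and> \<Inter>s \<inter> X \<noteq> {} \<longrightarrow> f ` s \<union> g ` s \<subseteq> U \<and> \<Inter>(f ` s \<union> g ` s) \<inter> Y \<noteq> {})"

lemma contig_nerve:
  assumes "contig X V Y U f g" "\<sigma> \<in> nerve X V q" "set \<tau> \<subseteq> f ` set \<sigma> \<union> g ` set \<sigma>" "int (length \<tau>) = q' + 1" "q' \<ge> 0"
  shows "\<tau> \<in> nerve Y U q'"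
proof -
  have "set \<sigma> \<subseteq> V \<and> set \<sigma> \<noteq> {} \<and> \<Inter>(set \<sigma>) \<inter> X \<noteq> {}"
    using assms(2) by (auto simp: nerve_def)
  then have "f ` set \<sigma> \<union> g ` set \<sigma> \<subseteq> U" "\<Inter>(f ` set \<sigma> \<union> g ` set \<sigma>) \<inter> Y \<noteq> {}"
    using assms(1) unfolding contig_def by blast+
  moreover have "\<Inter>(f ` set \<sigma> \<union> g ` set \<sigma>) \<subseteq> \<Inter>(set \<tau>)" using assms(3) by (rule Inter_anti_mono)
  ultimately have "\<Inter>(set \<tau>) \<inter> Y \<noteq> {}" by (metis Int_mono order_refl subset_empty)
  moreover have "set \<tau> \<subseteq> U" using assms(3) \<open>f ` set \<sigma> \<union> g ` set \<sigma> \<subseteq> U\<close> by (rule subset_trans)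
  ultimately show ?thesis using assms(4,5) unfolding nerve_def by simp
qed

lemma push_nerve:
  assumes "contig X V Y U f f" "keys C \<subseteq> nerve X V q"
  shows "keys (push_chain f C) \<subseteq> nerve Y U q"
proof
  fix \<tau> assume "\<tau> \<in> keys (push_chain f C)"
  then obtain \<sigma> where "\<sigma> \<in> keys C" "\<tau> = map f \<sigma>" using keys_push_chain by blast
  then show "\<tau> \<in> nerve Y U q"
    using assms(2) by (intro contig_nerve[OF assms(1), of \<sigma> q]) (auto simp: nerve_def)
qed

lemma push_cycles:
  fixes c :: "'a set list \<Rightarrow> 'f::field"
  assumes "finite V" "finite U" "contig X V Y U f f" "c \<in> cycles X V q"
  shows "chain_push X V q f c \<in> cycles Y U q"
proof -
  obtain C where C: "lookup C = c" "keys C \<subseteq> nerve X V q" "q \<le> 0 \<or> bd_chain C = 0"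
    using cyclesE[OF assms(1,4)] by metis
  have "chain_push X V q f c = lookup (push_chain f C)"
    using chain_push_lookup[OF assms(1) C(2)] C(1) by simp
  moreover have "q \<le> 0 \<or> bd_chain (push_chain f C) = 0" using C(3) by (auto simp: bd_chain_push_chain) (simp add: push_chain_def)
  ultimately show ?thesis using push_nerve[OF assms(3) C(2)] cyclesI[OF assms(2)] by metis
qed

lemma push_bdries:
  fixes c :: "'a set list \<Rightarrow> 'f::field"
  assumes "finite V" "finite U" "contig X V Y U f f" "c \<in> bdries X V q"
  shows "chain_push X V q f c \<in> bdries Y U q"
proof (cases "q \<ge> 0")
  case False
  then have "c = (\<lambda>_. 0)" using assms by (simp add: bdries_neg)
  then show ?thesis using lin_subspace_zero[OF lin_subspace_bdries] by (simp add: chain_push_def)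
next
  case True
  obtain B where B: "lookup (bd_chain B) = c" "keys B \<subseteq> nerve X V (q + 1)"
    using bdriesE[OF assms(1) True assms(4)] by metis
  have "keys (bd_chain B) \<subseteq> nerve X V q" using keys_bd_chain_nerve[OF B(2)] True by simp
  then have "chain_push X V q f c = lookup (bd_chain (push_chain f B))"
    using chain_push_lookup[OF assms(1), of "bd_chain B"] B(1) by (simp add: bd_chain_push_chain)
  then show ?thesis using push_nerve[OF assms(3) B(2)] bdriesI[OF assms(2) True] by metis
qed

text \<open>In degree 0 the augmented boundary of a cycle need not vanish, but it is a multiple of
  the empty list, on which the prism is zero.\<close>

lemma prism_cycle:
  fixes C :: "'a set list \<Rightarrow>\<^sub>0 'f::field"
  assumes "keys C \<subseteq> nerve X V q" "q \<le> 0 \<or> bd_chain C = 0" "q \<ge> 0"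
  shows "bd_chain (lin (prism f g) C) = push_chain g C - push_chain f C"
proof -
  have "lin (prism f g) (bd_chain C) = 0"
  proof (cases "q = 0")
    case True
    have "keys (bd_chain C) \<subseteq> {[]}"
    proof
      fix \<tau> assume "\<tau> \<in> keys (bd_chain C)"
      then obtain \<sigma> where \<sigma>: "\<sigma> \<in> keys C" "\<tau> \<in> keys (bd \<sigma> :: 'a set list \<Rightarrow>\<^sub>0 'f)"
        using keys_lin[of bd C] by auto
      then have "length \<sigma> = 1" using assms(1) True by (auto simp: nerve_def)
      then show "\<tau> \<in> {[]}" using keys_bd[OF \<sigma>(2)] by simp
    qed
    then show ?thesis by (intro lin_zero_fun) auto
  qed (use assms in auto)
  then show ?thesis using lin_prism_bd[of f g C] by simp
qed

text \<open>The prism is a chain homotopy, and contiguity is exactly what keeps its simplices in the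
  nerve of \<open>U\<close> on \<open>Y\<close>.\<close>

lemma push_contig:
  fixes c :: "'a set list \<Rightarrow> 'f::field"
  assumes "finite V" "finite U" "contig X V Y U f g" "c \<in> cycles X V q"
  shows "(\<lambda>\<sigma>. chain_push X V q g c \<sigma> - chain_push X V q f c \<sigma>) \<in> bdries Y U q"
proof (cases "q \<ge> 0")
  case False
  then have "c = (\<lambda>_. 0)" using assms(4) by (simp add: cycles_def chains_neg)
  then show ?thesis using lin_subspace_zero[OF lin_subspace_bdries] by (simp add: chain_push_def)
next
  case True
  obtain C where C: "lookup C = c" "keys C \<subseteq> nerve X V q" "q \<le> 0 \<or> bd_chain C = 0"
    using cyclesE[OF assms(1,4)] by metis
  have eq: "bd_chain (lin (prism f g) C) = push_chain g C - push_chain f C"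
    by (rule prism_cycle[OF C(2,3) True])
  have "keys (lin (prism f g) C) \<subseteq> nerve Y U (q + 1)"
  proof
    fix \<tau> assume "\<tau> \<in> keys (lin (prism f g) C)"
    then obtain \<sigma> where \<sigma>: "\<sigma> \<in> keys C" "\<tau> \<in> keys (prism f g \<sigma> :: 'a set list \<Rightarrow>\<^sub>0 'f)"
      using keys_lin[of "prism f g" C] by auto
    show "\<tau> \<in> nerve Y U (q + 1)"
      by (rule contig_nerve[OF assms(3), of \<sigma> q])
        (use \<sigma> C(2) keys_prism[OF \<sigma>(2)] True in \<open>auto simp: nerve_def\<close>)
  qed
  moreover have "(\<lambda>\<sigma>. chain_push X V q g c \<sigma> - chain_push X V q f c \<sigma>) = lookup (push_chain g C - push_chain f C)"
    using chain_push_lookup[OF assms(1) C(2)] C(1) by (auto simp: lookup_minus)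
  ultimately show ?thesis using bdriesI[OF assms(2) True] unfolding eq[symmetric] by simp
qed

text \<open>\<open>chain_push\<close> sums over simplices of the nerve only; as \<open>f\<close> is
  simplicial, nothing is lost in between.\<close>

lemma chain_push_comp:
  fixes c :: "'a set list \<Rightarrow> 'f::field"
  assumes "finite V" "finite U" "contig X V Y U f f" "c \<in> chains X V q"
  shows "chain_push Y U q g (chain_push X V q f c) = chain_push X V q (g \<circ> f) c"
proof -
  obtain C where C: "lookup C = c" "keys C \<subseteq> nerve X V q" using chains_lookup[OF assms(1,4)] .
  show ?thesis
    using chain_push_lookup[OF assms(2) push_nerve[OF assms(3) C(2)]] chain_push_lookup[OF assms(1) C(2)] C(1)
    by (simp add: push_chain_push_chain)
qed

text \<open>A point of \<open>X\<close> common to the members of a simplex lies in all their images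
  under both maps. Hence the map induced on homology does not depend on the choice of the refinement
  map.\<close>

lemma refines_contig:
  assumes "refines_by X V U f" "refines_by X V U g"
  shows "contig X V X U f g"
  unfolding contig_def
proof (intro allI impI)
  fix s assume s: "s \<subseteq> V" "s \<noteq> {} \<and> \<Inter>s \<inter> X \<noteq> {}"
  then obtain z where "z \<in> \<Inter>s \<inter> X" by auto
  then have "z \<in> \<Inter>(f ` s \<union> g ` s) \<inter> X" "f ` s \<union> g ` s \<subseteq> U"
    using assms s unfolding refines_by_def by blast+
  then show "f ` s \<union> g ` s \<subseteq> U \<and> \<Inter>(f ` s \<union> g ` s) \<inter> X \<noteq> {}" by blast
qed

lemma refines_comp: "refines_by X V U f \<Longrightarrow> refines_by X U T g \<Longrightarrow> refines_by X V T (g \<circ> f)"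
  unfolding refines_by_def by auto

subsection \<open>Cech classes\<close>

lemma mem_hclass_iff: "e \<in> hclass X U q c \<longleftrightarrow> (\<lambda>\<sigma>. e \<sigma> - c \<sigma>) \<in> bdries X U q"
proof
  assume "e \<in> hclass X U q c"
  then obtain b where "b \<in> bdries X U q" "e = (\<lambda>\<sigma>. c \<sigma> + b \<sigma>)" by (auto simp: hclass_def)
  then show "(\<lambda>\<sigma>. e \<sigma> - c \<sigma>) \<in> bdries X U q" by simp
next
  assume "(\<lambda>\<sigma>. e \<sigma> - c \<sigma>) \<in> bdries X U q"
  then have "(\<lambda>\<sigma>. c \<sigma> + (e \<sigma> - c \<sigma>)) \<in> hclass X U q c" unfolding hclass_def by (rule imageI)
  then show "e \<in> hclass X U q c" by simp
qed

lemma hclass_self: "c \<in> hclass X U q c"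
  by (simp add: mem_hclass_iff lin_subspace_zero[OF lin_subspace_bdries])

lemma hclass_eq:
  assumes "(\<lambda>\<sigma>. e \<sigma> - c \<sigma>) \<in> bdries X U q"
  shows "hclass X U q e = hclass X U q c"
proof (rule set_eqI)
  fix d
  have "(\<lambda>\<sigma>. d \<sigma> - c \<sigma>) \<in> bdries X U q" if "(\<lambda>\<sigma>. d \<sigma> - e \<sigma>) \<in> bdries X U q"
    using lin_subspace_add[OF lin_subspace_bdries that assms] by simp
  moreover have "(\<lambda>\<sigma>. d \<sigma> - e \<sigma>) \<in> bdries X U q" if "(\<lambda>\<sigma>. d \<sigma> - c \<sigma>) \<in> bdries X U q"
    using lin_subspace_diff[OF lin_subspace_bdries that assms] by simp
  ultimately show "d \<in> hclass X U q e \<longleftrightarrow> d \<in> hclass X U q c"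
    by (auto simp: mem_hclass_iff)
qed

lemma hclass_zero: "hclass X U q (\<lambda>_. 0) = bdries X U q"
  by (auto simp: mem_hclass_iff)

lemma hclass_bdries: "c \<in> bdries X U q \<Longrightarrow> hclass X U q c = bdries X U q"
  using hclass_eq[of c "\<lambda>_. 0" X U q] by (simp add: hclass_zero)

lemma ocover_mono: "ocover Y U \<Longrightarrow> X \<subseteq> Y \<Longrightarrow> ocover X U"
  by (auto simp: ocover_def)

lemma ocover_finite: "ocover X U \<Longrightarrow> finite U"
  by (simp add: ocover_def)

lemma refines_mono: "refines_by Y V U g \<Longrightarrow> X \<subseteq> Y \<Longrightarrow> refines_by X V U g"
  by (auto simp: refines_by_def)

lemma cech_class:
  assumes "x \<in> cech X q" "ocover X U" "c \<in> x U"
  shows "x U = hclass X U q c"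
proof -
  obtain d where "x U = hclass X U q d"
    using assms(1,2) by (auto simp: cech_def nerve_homology_def)
  then show ?thesis using assms(3) hclass_eq mem_hclass_iff by metis
qed

lemma cech_obtain:
  assumes "x \<in> cech X q" "ocover X U"
  obtains c where "c \<in> cycles X U q" "c \<in> x U"
proof -
  obtain d where "d \<in> cycles X U q" "x U = hclass X U q d"
    using assms(1,2) by (auto simp: cech_def nerve_homology_def)
  then show ?thesis using hclass_self[of d X U q] that by metis
qed

lemma cech_cycle:
  assumes "x \<in> cech X q" "ocover X U" "c \<in> x U"
  shows "c \<in> cycles X U q"
proof -
  obtain d where d: "d \<in> cycles X U q" "d \<in> x U" using cech_obtain[OF assms(1,2)] .
  have "(\<lambda>\<sigma>. c \<sigma> - d \<sigma>) \<in> cycles X U q"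
    using cech_class[OF assms(1,2) d(2)] assms(3) bdries_subset_cycles[OF ocover_finite[OF assms(2)]]
    by (auto simp: mem_hclass_iff)
  from lin_subspace_add[OF lin_subspace_cycles this d(1)] show ?thesis by simp
qed

lemma cech_mem_iff:
  assumes "x \<in> cech X q" "ocover X U" "c \<in> x U"
  shows "d \<in> x U \<longleftrightarrow> (\<lambda>\<sigma>. d \<sigma> - c \<sigma>) \<in> bdries X U q"
  using cech_class[OF assms] mem_hclass_iff by metis

lemma cech_push:
  assumes "x \<in> cech X q" "ocover X U" "ocover X V" "refines_by X V U g" "c \<in> x V"
  shows "chain_push X V q g c \<in> x U"
  using assms unfolding cech_def by blast

text \<open>Compatibility needs testing on one representative only, since pushing forward preserves
  boundaries.\<close>

lemma cechI:
  fixes x :: "'a::topological_space set set \<Rightarrow> ('a set list \<Rightarrow> 'f::field) set"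
  assumes "\<And>U. ocover X U \<Longrightarrow> \<exists>c\<in>cycles X U q. x U = hclass X U q c"
    and "\<And>U. \<not> ocover X U \<Longrightarrow> x U = {}"
    and "\<And>U V g. ocover X U \<Longrightarrow> ocover X V \<Longrightarrow> refines_by X V U g \<Longrightarrow> \<exists>c\<in>x V. chain_push X V q g c \<in> x U"
  shows "x \<in> cech X q"
proof -
  have "chain_push X V q g d \<in> x U"
    if UV: "ocover X U" "ocover X V" "refines_by X V U g" and d: "d \<in> x V" for U V g d
  proof -
    obtain c where c: "c \<in> x V" "chain_push X V q g c \<in> x U" using assms(3)[OF UV] by auto
    have dc: "(\<lambda>\<sigma>. d \<sigma> - c \<sigma>) \<in> bdries X V q"
    proof -
      obtain e where "x V = hclass X V q e" using assms(1)[OF UV(2)] by auto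
      then have "x V = hclass X V q c" using c(1) hclass_eq mem_hclass_iff by metis
      then show ?thesis using d mem_hclass_iff by metis
    qed
    have "chain_push X V q g (\<lambda>\<sigma>. d \<sigma> - c \<sigma>) \<in> bdries X U q"
      by (rule push_bdries[OF _ _ refines_contig[OF UV(3,3)] dc]) (use UV in \<open>auto simp: ocover_def\<close>)
    then have "(\<lambda>\<sigma>. chain_push X V q g d \<sigma> - chain_push X V q g c \<sigma>) \<in> bdries X U q"
      by (simp add: chain_push_diff)
    moreover obtain e where e: "x U = hclass X U q e" using assms(1)[OF UV(1)] by auto
    ultimately show ?thesis
      using c(2) hclass_eq mem_hclass_iff by metis
  qed
  then show ?thesis using assms(1,2) unfolding cech_def nerve_homology_def by blast
qed

text \<open>Two representatives on \<open>X\<close> differ by a boundary of \<open>X\<close>, hence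
  of \<open>Y\<close>, so the sums collected in \<open>cech_incl\<close> form a single
  coset.\<close>

lemma incl_class:
  fixes x :: "'a::topological_space set set \<Rightarrow> ('a set list \<Rightarrow> 'f::field) set"
  assumes "x \<in> cech X q" "X \<subseteq> Y" "ocover Y U" "c \<in> x U"
  shows "cech_incl Y q x U = hclass Y U q c"
proof (rule set_eqI)
  fix e
  have X: "ocover X U" using assms ocover_mono by blast
  note fin = ocover_finite[OF X]
  show "e \<in> cech_incl Y q x U \<longleftrightarrow> e \<in> hclass Y U q c"
  proof
    assume "e \<in> cech_incl Y q x U"
    then obtain d b where db: "d \<in> x U" "b \<in> bdries Y U q" "e = (\<lambda>\<sigma>. d \<sigma> + b \<sigma>)"
      using assms(3) by (auto simp: cech_incl_def)
    then have "(\<lambda>\<sigma>. d \<sigma> - c \<sigma>) \<in> bdries Y U q"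
      using cech_mem_iff[OF assms(1) X assms(4)] bdries_mono[OF fin assms(2)] by blast
    from lin_subspace_add[OF lin_subspace_bdries this db(2)] show "e \<in> hclass Y U q c"
      unfolding mem_hclass_iff db(3) by (simp add: algebra_simps)
  next
    assume "e \<in> hclass Y U q c"
    then obtain b where "b \<in> bdries Y U q" "e = (\<lambda>\<sigma>. c \<sigma> + b \<sigma>)" by (auto simp: hclass_def)
    then show "e \<in> cech_incl Y q x U" using assms(3,4) by (auto simp: cech_incl_def)
  qed
qed

lemma incl_cech:
  fixes x :: "'a::topological_space set set \<Rightarrow> ('a set list \<Rightarrow> 'f::field) set"
  assumes "x \<in> cech X q" "X \<subseteq> Y"
  shows "cech_incl Y q x \<in> cech Y q"
proof (rule cechI)
  fix U assume U: "ocover Y U"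
  then obtain c where c: "c \<in> cycles X U q" "c \<in> x U"
    using cech_obtain[OF assms(1) ocover_mono[OF U assms(2)]] by metis
  then show "\<exists>c\<in>cycles Y U q. cech_incl Y q x U = hclass Y U q c"
    using incl_class[OF assms U c(2)] cycles_mono[OF ocover_finite[OF U] assms(2)] by blast
next
  fix U assume "\<not> ocover Y U"
  then show "cech_incl Y q x U = {}" by (simp add: cech_incl_def)
next
  fix U V g assume UV: "ocover Y U" "ocover Y V" "refines_by Y V U g"
  note X = ocover_mono[OF UV(1) assms(2)] ocover_mono[OF UV(2) assms(2)] refines_mono[OF UV(3) assms(2)]
  obtain c where c: "c \<in> cycles X V q" "c \<in> x V"
    using cech_obtain[OF assms(1) X(2)] by metis
  have "chain_push X V q g c \<in> x U" by (rule cech_push[OF assms(1) X c(2)])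
  moreover have "chain_push Y V q g c = chain_push X V q g c"
    by (rule chain_push_mono[OF ocover_finite[OF UV(2)] assms(2) cycles_subset_chains[OF c(1)]])
  ultimately have "chain_push Y V q g c \<in> cech_incl Y q x U"
    using incl_class[OF assms UV(1)] hclass_self by metis
  moreover have "c \<in> cech_incl Y q x V"
    using incl_class[OF assms UV(2) c(2)] hclass_self by metis
  ultimately show "\<exists>c\<in>cech_incl Y q x V. chain_push Y V q g c \<in> cech_incl Y q x U" by blast
qed

section \<open>Linear combinations of Cech classes\<close>

lemma lincomb_class:
  fixes ys :: "('a::topological_space set set \<Rightarrow> ('a set list \<Rightarrow> 'f::field) set) list"
  assumes U: "ocover Y U" and cs: "length cs = length ys"
    and eq: "\<And>i. i < length ys \<Longrightarrow> (ys ! i) U = hclass Y U q (cs ! i)"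
  shows "cech_lincomb Y q a ys U = hclass Y U q (\<lambda>\<sigma>. \<Sum>i<length ys. a i * (cs ! i) \<sigma>)"
proof (rule set_eqI)
  fix e
  show "e \<in> cech_lincomb Y q a ys U \<longleftrightarrow> e \<in> hclass Y U q (\<lambda>\<sigma>. \<Sum>i<length ys. a i * (cs ! i) \<sigma>)"
  proof
    assume "e \<in> cech_lincomb Y q a ys U"
    then obtain ds where ds: "length ds = length ys" "\<And>i. i < length ys \<Longrightarrow> ds ! i \<in> (ys ! i) U"
      "(\<lambda>\<sigma>. e \<sigma> - (\<Sum>i<length ys. a i * (ds ! i) \<sigma>)) \<in> bdries Y U q"
      using U by (auto simp: cech_lincomb_def)
    have "(\<lambda>\<sigma>. (ds ! i) \<sigma> - (cs ! i) \<sigma>) \<in> bdries Y U q" if "i < length ys" for i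
      using ds(2)[OF that] eq[OF that] by (simp add: mem_hclass_iff)
    then have "(\<lambda>\<sigma>. \<Sum>i<length ys. a i * ((ds ! i) \<sigma> - (cs ! i) \<sigma>)) \<in> bdries Y U q"
      by (intro lin_subspace_sum lin_subspace_bdries) auto
    from lin_subspace_add[OF lin_subspace_bdries ds(3) this]
    show "e \<in> hclass Y U q (\<lambda>\<sigma>. \<Sum>i<length ys. a i * (cs ! i) \<sigma>)"
      by (simp add: mem_hclass_iff right_diff_distrib sum_subtractf)
  next
    assume "e \<in> hclass Y U q (\<lambda>\<sigma>. \<Sum>i<length ys. a i * (cs ! i) \<sigma>)"
    then show "e \<in> cech_lincomb Y q a ys U"
      using U cs eq hclass_self by (auto simp: cech_lincomb_def mem_hclass_iff intro!: exI[of _ cs])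
  qed
qed

lemma cech_list_obtain:
  fixes xs :: "('a::topological_space set set \<Rightarrow> ('a set list \<Rightarrow> 'f::field) set) list"
  assumes "set xs \<subseteq> cech X q" "ocover X U"
  obtains cs where "length cs = length xs"
    "\<And>i. i < length xs \<Longrightarrow> cs ! i \<in> cycles X U q \<and> cs ! i \<in> (xs ! i) U"
proof -
  have "\<forall>i. \<exists>c. i < length xs \<longrightarrow> c \<in> cycles X U q \<and> c \<in> (xs ! i) U"
    using cech_obtain[OF _ assms(2)] assms(1) nth_mem by (metis subsetD)
  then obtain f where f: "\<And>i. i < length xs \<Longrightarrow> f i \<in> cycles X U q \<and> f i \<in> (xs ! i) U" by metis
  show ?thesis by (rule that[of "map f [0..<length xs]"]) (use f in auto)
qed

lemma lincomb_mem:
  fixes xs :: "('a::topological_space set set \<Rightarrow> ('a set list \<Rightarrow> 'f::field) set) list"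
  assumes "set xs \<subseteq> cech X q" "ocover X U" "length cs = length xs"
    and "\<And>i. i < length xs \<Longrightarrow> cs ! i \<in> (xs ! i) U"
  shows "cech_lincomb X q a xs U = hclass X U q (\<lambda>\<sigma>. \<Sum>i<length xs. a i * (cs ! i) \<sigma>)"
  by (rule lincomb_class[OF assms(2,3)]) (use assms cech_class nth_mem in blast)

lemma lincomb_cech:
  fixes xs :: "('a::topological_space set set \<Rightarrow> ('a set list \<Rightarrow> 'f::field) set) list"
  assumes "set xs \<subseteq> cech X q"
  shows "cech_lincomb X q a xs \<in> cech X q"
proof (rule cechI)
  fix U assume U: "ocover X U"
  obtain cs where cs: "length cs = length xs"
    "\<And>i. i < length xs \<Longrightarrow> cs ! i \<in> cycles X U q \<and> cs ! i \<in> (xs ! i) U"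
    using cech_list_obtain[OF assms U] by metis
  have "(\<lambda>\<sigma>. \<Sum>i<length xs. a i * (cs ! i) \<sigma>) \<in> cycles X U q"
    by (rule lin_subspace_sum[OF lin_subspace_cycles]) (use cs in auto)
  then show "\<exists>c\<in>cycles X U q. cech_lincomb X q a xs U = hclass X U q c"
    using lincomb_mem[OF assms U cs(1)] cs(2) by blast
next
  fix U assume "\<not> ocover X U"
  then show "cech_lincomb X q a xs U = {}" by (simp add: cech_lincomb_def)
next
  fix U V g assume UV: "ocover X U" "ocover X V" "refines_by X V U g"
  obtain cs where cs: "length cs = length xs"
    "\<And>i. i < length xs \<Longrightarrow> cs ! i \<in> cycles X V q \<and> cs ! i \<in> (xs ! i) V"
    using cech_list_obtain[OF assms UV(2)] by metis
  let ?c = "\<lambda>\<sigma>. \<Sum>i<length xs. a i * (cs ! i) \<sigma>"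
  have 1: "?c \<in> cech_lincomb X q a xs V"
    using lincomb_mem[OF assms UV(2) cs(1)] cs(2) hclass_self by blast
  let ?ds = "map (chain_push X V q g) cs"
  have "?ds ! i \<in> (xs ! i) U" if "i < length xs" for i
    using cech_push[OF _ UV] cs that assms by (metis nth_map nth_mem subsetD)
  then have "cech_lincomb X q a xs U = hclass X U q (\<lambda>\<sigma>. \<Sum>i<length xs. a i * (?ds ! i) \<sigma>)"
    by (intro lincomb_mem[OF assms UV(1)]) (use cs in auto)
  also have "(\<lambda>\<sigma>. \<Sum>i<length xs. a i * (?ds ! i) \<sigma>) = chain_push X V q g ?c"
    unfolding chain_push_sum using cs(1) by auto
  finally have "chain_push X V q g ?c \<in> cech_lincomb X q a xs U"
    by (simp only: hclass_self)
  with 1 show "\<exists>c\<in>cech_lincomb X q a xs V. chain_push X V q g c \<in> cech_lincomb X q a xs U" by blast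
qed

lemma lincomb_incl:
  fixes xs :: "('a::topological_space set set \<Rightarrow> ('a set list \<Rightarrow> 'f::field) set) list"
  assumes "set xs \<subseteq> cech X q" "X \<subseteq> Y"
  shows "cech_lincomb Y q a (map (cech_incl Y q) xs) = cech_incl Y q (cech_lincomb X q a xs)"
proof
  fix U
  show "cech_lincomb Y q a (map (cech_incl Y q) xs) U = cech_incl Y q (cech_lincomb X q a xs) U"
  proof (cases "ocover Y U")
    case False
    then show ?thesis by (simp add: cech_lincomb_def cech_incl_def)
  next
    case True
    note X = ocover_mono[OF True assms(2)]
    obtain cs where cs: "length cs = length xs"
      "\<And>i. i < length xs \<Longrightarrow> cs ! i \<in> cycles X U q \<and> cs ! i \<in> (xs ! i) U"
      using cech_list_obtain[OF assms(1) X] by metis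
    let ?c = "\<lambda>\<sigma>. \<Sum>i<length xs. a i * (cs ! i) \<sigma>"
    have "map (cech_incl Y q) xs ! i = cech_incl Y q (xs ! i)
      \<and> cech_incl Y q (xs ! i) U = hclass Y U q (cs ! i)" if "i < length xs" for i
      using incl_class[OF subsetD[OF assms(1) nth_mem[OF that]] assms(2) True, of "cs ! i"] cs(2)[OF that] that by simp
    then have "cech_lincomb Y q a (map (cech_incl Y q) xs) U = hclass Y U q ?c"
      using lincomb_class[OF True, of cs "map (cech_incl Y q) xs" q a] cs(1) by simp
    moreover have "?c \<in> cech_lincomb X q a xs U"
      using lincomb_mem[OF assms(1) X cs(1)] cs(2) hclass_self by blast
    from incl_class[OF lincomb_cech[OF assms(1)] assms(2) True this]
    have "cech_incl Y q (cech_lincomb X q a xs) U = hclass Y U q ?c" .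
    ultimately show ?thesis by simp
  qed
qed

lemma cech_comb2:
  fixes x z :: "'a::topological_space set set \<Rightarrow> ('a set list \<Rightarrow> 'f::field) set"
  assumes "x \<in> cech X q" "z \<in> cech X q"
  obtains w where "w \<in> cech X q"
    "\<And>U c d. ocover X U \<Longrightarrow> c \<in> x U \<Longrightarrow> d \<in> z U \<Longrightarrow> (\<lambda>\<sigma>. a * c \<sigma> + b * d \<sigma>) \<in> w U"
proof -
  let ?a = "\<lambda>i::nat. if i = 0 then a else b"
  let ?w = "cech_lincomb X q ?a [x, z]"
  have s: "set [x, z] \<subseteq> cech X q" using assms by auto
  show ?thesis
  proof (rule that)
    show "?w \<in> cech X q" by (rule lincomb_cech[OF s])
    fix U c d assume U: "ocover X U" and cd: "c \<in> x U" "d \<in> z U"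
    have nth: "[c, d] ! i \<in> ([x, z] ! i) U" if "i < length [x, z]" for i
      using that cd by (cases i) auto
    have "?w U = hclass X U q (\<lambda>\<sigma>. \<Sum>i<length [x, z]. ?a i * ([c, d] ! i) \<sigma>)"
      by (rule lincomb_mem[OF s U _ nth]) auto
    then show "(\<lambda>\<sigma>. a * c \<sigma> + b * d \<sigma>) \<in> ?w U"
      using hclass_self[of "\<lambda>\<sigma>. a * c \<sigma> + b * d \<sigma>" X U q] by (simp add: eval_nat_numeral)
  qed
qed

lemma incl_zero_iff:
  fixes x :: "'a::topological_space set set \<Rightarrow> ('a set list \<Rightarrow> 'f::field) set"
  assumes "x \<in> cech X q" "X \<subseteq> Y"
  shows "cech_incl Y q x = cech_zero Y q \<longleftrightarrow> (\<forall>U. ocover Y U \<longrightarrow> x U \<subseteq> bdries Y U q)"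
proof
  assume L: "cech_incl Y q x = cech_zero Y q"
  show "\<forall>U. ocover Y U \<longrightarrow> x U \<subseteq> bdries Y U q"
  proof (intro allI impI subsetI)
    fix U c assume "ocover Y U" "c \<in> x U"
    then show "c \<in> bdries Y U q"
      using incl_class[OF assms, of U c] hclass_self[of c Y U q] L by (simp add: cech_zero_def)
  qed
next
  assume R: "\<forall>U. ocover Y U \<longrightarrow> x U \<subseteq> bdries Y U q"
  show "cech_incl Y q x = cech_zero Y q"
  proof
    fix U
    show "cech_incl Y q x U = cech_zero Y q U"
    proof (cases "ocover Y U")
      case True
      then obtain c where c: "c \<in> x U" using cech_obtain[OF assms(1) ocover_mono[OF True assms(2)]] by metis
      then have "c \<in> bdries Y U q" using R True by blast
      then show ?thesis using incl_class[OF assms True c] True hclass_bdries[of c Y U q] by (simp add: cech_zero_def)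
    qed (simp add: cech_incl_def cech_zero_def)
  qed
qed

text \<open>One bounding representative is enough, as the others differ from it by boundaries of
  \<open>X\<close>.\<close>

lemma cech_vanish:
  fixes x :: "'a::topological_space set set \<Rightarrow> ('a set list \<Rightarrow> 'f::field) set"
  assumes "x \<in> cech X q" "X \<subseteq> Y" "ocover Y U" "c \<in> x U" "c \<in> bdries Y U q"
  shows "x U \<subseteq> bdries Y U q"
proof
  fix d assume "d \<in> x U"
  then have "(\<lambda>\<sigma>. d \<sigma> - c \<sigma>) \<in> bdries Y U q"
    using cech_mem_iff[OF assms(1) ocover_mono[OF assms(3,2)] assms(4)]
      bdries_mono[OF ocover_finite[OF assms(3)] assms(2)] by blast
  from lin_subspace_add[OF lin_subspace_bdries this assms(5)] show "d \<in> bdries Y U q" by simp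
qed

lemma incl_eqI:
  fixes x :: "'a::topological_space set set \<Rightarrow> ('a set list \<Rightarrow> 'f::field) set"
  assumes "x \<in> cech X q" "X \<subseteq> Y" "x' \<in> cech X' q" "X' \<subseteq> Y"
    and "\<And>U. ocover Y U \<Longrightarrow> \<exists>c\<in>x U. \<exists>d\<in>x' U. (\<lambda>\<sigma>. c \<sigma> - d \<sigma>) \<in> bdries Y U q"
  shows "cech_incl Y q x = cech_incl Y q x'"
proof
  fix U
  show "cech_incl Y q x U = cech_incl Y q x' U"
  proof (cases "ocover Y U")
    case True
    then show ?thesis
      using assms(5)[OF True] incl_class[OF assms(1,2) True] incl_class[OF assms(3,4) True] hclass_eq by metis
  qed (simp add: cech_incl_def)
qed

section \<open>The rank through the kernel of the inclusion\<close>

lemma list_in_image: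
  "set ys \<subseteq> f ` A \<Longrightarrow> \<exists>xs. set xs \<subseteq> A \<and> ys = map f xs"
  by (induction ys) (auto simp: Cons_eq_map_conv, metis (no_types, lifting) image_iff insert_subset list.set(2))

text \<open>Lifting a list from the image to classes of \<open>X\<close> turns independence into a
  condition on which combinations of them die in \<open>Y\<close>. For fixed \<open>X\<close> the
  rank thus depends only on the kernel, which makes different targets comparable.\<close>

lemma cech_rank_alt:
  assumes "X \<subseteq> Y"
  shows "cech_rank TYPE('f::field) q X Y = Sup {enat (length xs) | xs.
    set xs \<subseteq> (cech X q :: ('a::topological_space set set \<Rightarrow> ('a set list \<Rightarrow> 'f) set) set) \<and>
    (\<forall>a. cech_incl Y q (cech_lincomb X q a xs) = cech_zero Y q \<longrightarrow> (\<forall>i<length xs. a i = 0))}"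
    (is "_ = Sup ?R")
proof -
  let ?L = "{enat (length ys) | ys. set ys \<subseteq> cech_incl Y q ` (cech X q :: ('a set set \<Rightarrow> ('a set list \<Rightarrow> 'f) set) set)
      \<and> cech_lin_indep Y q ys}"
  have "?L = ?R"
  proof (intro set_eqI iffI)
    fix n assume "n \<in> ?L"
    then obtain ys where ys: "n = enat (length ys)" "cech_lin_indep Y q ys"
      "set ys \<subseteq> cech_incl Y q ` (cech X q :: ('a set set \<Rightarrow> ('a set list \<Rightarrow> 'f) set) set)" by auto
    then obtain xs where xs: "set xs \<subseteq> (cech X q :: ('a set set \<Rightarrow> ('a set list \<Rightarrow> 'f) set) set)"
      "ys = map (cech_incl Y q) xs" using list_in_image by metis
    then show "n \<in> ?R" using ys lincomb_incl[OF xs(1) assms] by (auto simp: cech_lin_indep_def)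
  next
    fix n assume "n \<in> ?R"
    then obtain xs where xs: "n = enat (length xs)" "set xs \<subseteq> (cech X q :: ('a set set \<Rightarrow> ('a set list \<Rightarrow> 'f) set) set)"
      "\<forall>a. cech_incl Y q (cech_lincomb X q a xs) = cech_zero Y q \<longrightarrow> (\<forall>i<length xs. a i = 0)" by auto
    then show "n \<in> ?L"
      using lincomb_incl[OF xs(2) assms] image_mono[OF xs(2), of "cech_incl Y q"]
      by (auto simp: cech_lin_indep_def intro!: exI[of _ "map (cech_incl Y q) xs"])
  qed
  then show ?thesis by (simp add: cech_rank_def)
qed

lemma cech_rank_cong_kernel:
  assumes "X \<subseteq> Y" "X \<subseteq> Y'"
    and "\<And>x. x \<in> (cech X q :: ('a::topological_space set set \<Rightarrow> ('a set list \<Rightarrow> 'f::field) set) set) \<Longrightarrow>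
      cech_incl Y q x = cech_zero Y q \<longleftrightarrow> cech_incl Y' q x = cech_zero Y' q"
  shows "cech_rank TYPE('f) q X Y = cech_rank TYPE('f) q X Y'"
proof -
  have "cech_incl Y q (cech_lincomb X q a xs) = cech_zero Y q \<longleftrightarrow>
      cech_incl Y' q (cech_lincomb X q a xs) = cech_zero Y' q"
    if "set xs \<subseteq> (cech X q :: ('a set set \<Rightarrow> ('a set list \<Rightarrow> 'f) set) set)" for a xs
    by (rule assms(3)[OF lincomb_cech[OF that]])
  then show ?thesis unfolding cech_rank_alt[OF assms(1)] cech_rank_alt[OF assms(2)]
    by (intro arg_cong[of _ _ Sup]) blast
qed

subsection \<open>Covers of compact sets\<close>

text \<open>Descending chain condition in finite dimension, by induction on the coordinates: the
  subspaces where coordinate \<open>s\<close> vanishes stabilise, and coordinate \<open>s\<close>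
  itself is either nonzero somewhere on every \<open>W n\<close> or identically zero from some index
  on.\<close>

lemma lin_subspace_decreasing_stabilises:
  fixes W :: "nat \<Rightarrow> ('b \<Rightarrow> 'f::field) set"
  assumes "finite N" "\<And>n. lin_subspace (W n)" "\<And>n. W (Suc n) \<subseteq> W n"
    and "\<And>n c \<sigma>. c \<in> W n \<Longrightarrow> \<sigma> \<notin> N \<Longrightarrow> c \<sigma> = 0"
  shows "\<exists>n0. \<forall>n\<ge>n0. W n = W n0"
  using assms
proof (induction N arbitrary: W rule: finite_induct)
  case empty
  then have "W n = {\<lambda>_. 0}" for n using lin_subspace_zero[of "W n"] by fastforce
  then show ?case by auto
next
  case (insert s N)
  let ?W = "\<lambda>n. {c \<in> W n. c s = 0}"
  have dec: "W m \<subseteq> W n" if "n \<le> m" for n m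
    using that by (rule lift_Suc_antimono_le[of W, OF insert.prems(2)])
  have "\<exists>n0. \<forall>n\<ge>n0. ?W n = ?W n0"
  proof (rule insert.IH)
    show "lin_subspace (?W n)" for n
      using insert.prems(1)[of n] by (auto simp: lin_subspace_def)
    show "?W (Suc n) \<subseteq> ?W n" for n using insert.prems(2) by auto
    show "c \<sigma> = 0" if "c \<in> ?W n" "\<sigma> \<notin> N" for n c \<sigma>
      using insert.prems(3)[of c n \<sigma>] that by (cases "\<sigma> = s") auto
  qed
  then obtain n1 where n1: "\<And>n. n \<ge> n1 \<Longrightarrow> ?W n = ?W n1" by blast
  show ?case
  proof (cases "\<forall>n. \<exists>d\<in>W n. d s \<noteq> 0")
    case True
    have "W n = W n1" if "n \<ge> n1" for n
    proof
      show "W n \<subseteq> W n1" by (rule dec[OF that])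
      show "W n1 \<subseteq> W n"
      proof
        fix c assume c: "c \<in> W n1"
        obtain d where d: "d \<in> W n" "d s \<noteq> 0" using True by blast
        \<comment> \<open>Subtracting a multiple of \<open>d\<close> kills coordinate
          \<open>s\<close>, which moves the element into the part already known to be
          stable.\<close>
        let ?c = "\<lambda>\<sigma>. 1 * c \<sigma> + (- (c s / d s)) * d \<sigma>"
        have "?c \<in> W n1" by (rule subspD[OF insert.prems(1) c]) (use d dec[OF that] in auto)
        moreover have "?c s = 0" using d by simp
        ultimately have "?c \<in> ?W n1" by blast
        then have "?c \<in> W n" using n1[OF that] by blast
        from subspD[OF insert.prems(1) this d(1), of 1 "c s / d s"] show "c \<in> W n" by simp
      qed
    qed
    then show ?thesis by blast
  next
    case False
    then obtain n2 where n2: "\<And>d. d \<in> W n2 \<Longrightarrow> d s = 0" by blast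
    have "W n = W (max n1 n2)" if "n \<ge> max n1 n2" for n
    proof -
      have eq: "W m = ?W m" if "m \<ge> n2" for m using n2 dec[OF that] by blast
      have "W n = ?W n" by (rule eq) (use that in simp)
      also have "\<dots> = ?W (max n1 n2)" using n1[of n] n1[of "max n1 n2"] that by simp
      also have "\<dots> = W (max n1 n2)" by (rule eq[symmetric]) simp
      finally show ?thesis .
    qed
    then show ?thesis by blast
  qed
qed

text \<open>Unlike \<open>refines_by X\<close>, this is containment in the ambient space, so it persists on every set that
  the cover \<open>V\<close> happens to cover besides \<open>X\<close>.\<close>

definition srefines :: "'a set set \<Rightarrow> 'a set set \<Rightarrow> ('a set \<Rightarrow> 'a set) \<Rightarrow> bool" where
  "srefines V U g \<longleftrightarrow> (\<forall>W\<in>V. g W \<in> U \<and> W \<subseteq> g W)"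

lemma srefines_refines: "srefines V U g \<Longrightarrow> refines_by X V U g"
  by (auto simp: srefines_def refines_by_def)

lemma srefines_comp: "srefines V U f \<Longrightarrow> srefines U T g \<Longrightarrow> srefines V T (g \<circ> f)"
  unfolding srefines_def comp_def by (meson order_trans)

lemma srefines_id: "srefines V V (\<lambda>W. W)"
  by (simp add: srefines_def)

section \<open>Lebesgue numbers and cofinal sequences of covers\<close>

lemma ball_cover:
  fixes X :: "'a::metric_space set"
  assumes "compact X" "e > 0"
  obtains V where "finite V" "\<And>W. W \<in> V \<Longrightarrow> \<exists>x\<in>X. W = ball x e" "X \<subseteq> \<Union>V"
proof -
  have "X \<subseteq> (\<Union>x\<in>X. ball x e)" using assms(2) by auto
  then obtain T where T: "T \<subseteq> X" "finite T" "X \<subseteq> (\<Union>x\<in>T. ball x e)"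
    using compactE_image[OF assms(1), of X "\<lambda>x. ball x e"] by auto
  show thesis by (rule that[of "(\<lambda>x. ball x e) ` T"]) (use T in auto)
qed

lemma ball_cover_ocover:
  assumes "finite V" "\<And>W. W \<in> V \<Longrightarrow> \<exists>x\<in>X. W = ball x e" "X \<subseteq> \<Union>V"
  shows "ocover X V"
  using assms by (auto simp: ocover_def)

lemma lebesgue_cover:
  fixes X :: "'a::metric_space set"
  assumes "compact X" "ocover X U"
  obtains e where "e > 0" "\<And>x. x \<in> X \<Longrightarrow> \<exists>W\<in>U. ball x e \<subseteq> W"
  using Heine_Borel_lemma[OF assms(1), of U] assms(2) unfolding ocover_def by metis

lemma lebesgue_refines:
  assumes "\<And>x. x \<in> X \<Longrightarrow> \<exists>W\<in>U. ball x e \<subseteq> W" "\<And>W. W \<in> V \<Longrightarrow> \<exists>x\<in>X. W = ball x d" "d \<le> e"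
  obtains g where "srefines V U g"
proof -
  have "\<forall>W. \<exists>G. W \<in> V \<longrightarrow> G \<in> U \<and> W \<subseteq> G"
  proof
    fix W
    show "\<exists>G. W \<in> V \<longrightarrow> G \<in> U \<and> W \<subseteq> G"
    proof (cases "W \<in> V")
      case True
      then obtain x where x: "x \<in> X" "W = ball x d" using assms(2) by blast
      then obtain G where "G \<in> U" "ball x e \<subseteq> G" using assms(1) by blast
      then show ?thesis using x(2) subset_ball[OF assms(3), of x] by blast
    qed blast
  qed
  then show ?thesis using that unfolding srefines_def by metis
qed

text \<open>A sequence replaces the directed family of all covers, so that elements of the inverse
  limit can be built by recursion.\<close>

definition cofinal :: "'a::topological_space set \<Rightarrow> (nat \<Rightarrow> 'a set set) \<Rightarrow> bool" where
  "cofinal X V \<longleftrightarrow> (\<forall>n. ocover X (V n)) \<and> (\<forall>n. \<exists>g. srefines (V (Suc n)) (V n) g)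
     \<and> (\<forall>U. ocover X U \<longrightarrow> (\<exists>n g. srefines (V n) U g))"

lemma cofinal_exists:
  fixes X :: "'a::metric_space set"
  assumes "compact X"
  obtains V where "cofinal X V"
proof -
  define P where "P n V \<longleftrightarrow> (\<exists>e\<le>inverse (real (Suc n)). finite V \<and> (\<forall>W\<in>V. \<exists>x\<in>X. W = ball x e) \<and> X \<subseteq> \<Union>V)"
    for n and V :: "'a set set"
  have P_cover: "ocover X V" if "P n V" for n V
    using that ball_cover_ocover unfolding P_def by metis
  have "\<exists>V. \<forall>n. P n (V n) \<and> (\<exists>g. srefines (V (Suc n)) (V n) g)"
  proof (rule dependent_nat_choice)
    obtain V where "finite V" "\<And>W. W \<in> V \<Longrightarrow> \<exists>x\<in>X. W = ball x 1" "X \<subseteq> \<Union>V"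
      using ball_cover[OF assms, of 1] by auto
    then show "\<exists>V. P 0 V" unfolding P_def by (metis inverse_1 of_nat_1 One_nat_def order_refl)
  next
    fix V n assume "P n V"
    then have "ocover X V" by (rule P_cover)
    then obtain e where e: "e > 0" "\<And>x. x \<in> X \<Longrightarrow> \<exists>W\<in>V. ball x e \<subseteq> W"
      using lebesgue_cover[OF assms] by metis
    \<comment> \<open>The first bound makes the new cover refine \<open>V\<close>; the second sends
      the radii to zero, below the Lebesgue number of any cover.\<close>
    define d where "d = min e (inverse (real (Suc (Suc n))))"
    have d: "d > 0" "d \<le> e" "d \<le> inverse (real (Suc (Suc n)))"
      unfolding d_def using e(1) by (auto simp del: of_nat_Suc)
    obtain V' where V': "finite V'" "\<And>W. W \<in> V' \<Longrightarrow> \<exists>x\<in>X. W = ball x d" "X \<subseteq> \<Union>V'"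
      using ball_cover[OF assms d(1)] by metis
    obtain g where "srefines V' V g" using lebesgue_refines[OF e(2) V'(2) d(2)] by metis
    moreover have "P (Suc n) V'" using V' d(3) unfolding P_def by blast
    ultimately show "\<exists>V'. P (Suc n) V' \<and> (\<exists>g. srefines V' V g)" by blast
  qed
  then obtain V where V: "\<And>n. P n (V n)" "\<And>n. \<exists>g. srefines (V (Suc n)) (V n) g" by blast
  have "\<exists>n g. srefines (V n) U g" if U: "ocover X U" for U
  proof -
    obtain e where e: "e > 0" "\<And>x. x \<in> X \<Longrightarrow> \<exists>W\<in>U. ball x e \<subseteq> W"
      using lebesgue_cover[OF assms U] by metis
    obtain n where n: "inverse (real (Suc n)) < e" using reals_Archimedean[OF e(1)] by blast
    obtain d where d: "d \<le> inverse (real (Suc n))" "\<And>W. W \<in> V n \<Longrightarrow> \<exists>x\<in>X. W = ball x d"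
      using V(1)[of n] unfolding P_def by blast
    then have "d \<le> e" using n by linarith
    then show ?thesis using lebesgue_refines[OF e(2) d(2)] by metis
  qed
  then have "cofinal X V" unfolding cofinal_def using V P_cover by blast
  then show thesis by (rule that)
qed

lemma cofinal_srefines:
  assumes "cofinal X V" "n \<le> m"
  shows "\<exists>g. srefines (V m) (V n) g"
  using assms(2)
proof (induction m rule: dec_induct)
  case base
  then show ?case using srefines_id by blast
next
  case (step m)
  then show ?case using assms(1) srefines_comp unfolding cofinal_def by metis
qed

lemma cofinal_shift:
  assumes "cofinal X V"
  shows "cofinal X (\<lambda>k. V (n0 + k))"
proof -
  have "\<exists>k g. srefines (V (n0 + k)) U g" if U: "ocover X U" for U
  proof -
    obtain n g where g: "srefines (V n) U g" using assms U unfolding cofinal_def by blast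
    obtain h where "srefines (V (n0 + n)) (V n) h" using cofinal_srefines[OF assms, of n "n0 + n"] by auto
    then show ?thesis using g srefines_comp by blast
  qed
  then show ?thesis using assms unfolding cofinal_def by auto
qed

section \<open>Homologous cycles and threads of compatible classes\<close>

abbreviation homol :: "'a set \<Rightarrow> 'a set set \<Rightarrow> int \<Rightarrow> ('a set list \<Rightarrow> 'f::field) \<Rightarrow> ('a set list \<Rightarrow> 'f) \<Rightarrow> bool" where
  "homol X U q c d \<equiv> (\<lambda>\<sigma>. c \<sigma> - d \<sigma>) \<in> bdries X U q"

lemma homol_refl: "homol X U q c c"
  by (simp add: lin_subspace_zero[OF lin_subspace_bdries])

lemma homol_sym: "homol X U q c d \<Longrightarrow> homol X U q d c"
  using lin_subspace_scale[OF lin_subspace_bdries, of "\<lambda>\<sigma>. c \<sigma> - d \<sigma>" X U q "- 1"] by simp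

lemma homol_trans: "homol X U q c d \<Longrightarrow> homol X U q d e \<Longrightarrow> homol X U q c e"
  using lin_subspace_add[OF lin_subspace_bdries, of "\<lambda>\<sigma>. c \<sigma> - d \<sigma>" X U q "\<lambda>\<sigma>. d \<sigma> - e \<sigma>"] by simp

lemma homol_lincomb:
  "homol X U q c c' \<Longrightarrow> homol X U q d d' \<Longrightarrow> homol X U q (\<lambda>\<sigma>. a * c \<sigma> + b * d \<sigma>) (\<lambda>\<sigma>. a * c' \<sigma> + b * d' \<sigma>)"
  using subspD[OF lin_subspace_bdries, of "\<lambda>\<sigma>. c \<sigma> - c' \<sigma>" X U q "\<lambda>\<sigma>. d \<sigma> - d' \<sigma>" a b]
  by (simp add: algebra_simps)

lemma push_refines_cycles:
  "ocover X V \<Longrightarrow> ocover X U \<Longrightarrow> refines_by X V U g \<Longrightarrow> c \<in> cycles X V q \<Longrightarrow> chain_push X V q g c \<in> cycles X U q"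
  by (rule push_cycles) (auto intro: refines_contig ocover_finite)

lemma push_refines_homol:
  assumes "ocover X V" "ocover X U" "refines_by X V U g" "homol X V q c d"
  shows "homol X U q (chain_push X V q g c) (chain_push X V q g d)"
  using push_bdries[OF _ _ refines_contig[OF assms(3,3)] assms(4)] assms(1,2)
  by (simp add: chain_push_diff ocover_finite)

lemma push_refines_unique:
  assumes "ocover X V" "ocover X U" "refines_by X V U g" "refines_by X V U h" "c \<in> cycles X V q"
  shows "homol X U q (chain_push X V q g c) (chain_push X V q h c)"
  using push_contig[OF _ _ refines_contig[OF assms(4,3)] assms(5)] assms(1,2)
  by (simp add: ocover_finite)

lemma push_refines_comp:
  assumes "ocover X V" "ocover X U" "refines_by X V U g" "c \<in> cycles X V q"
  shows "chain_push X U q h (chain_push X V q g c) = chain_push X V q (h \<circ> g) c"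
  by (rule chain_push_comp) (use assms in \<open>auto intro: refines_contig ocover_finite cycles_subset_chains\<close>)

text \<open>A compatible sequence determines the class at an arbitrary cover by pushing any
  sufficiently fine \<open>f k\<close> to it. Two such choices agree because both can be compared
  with the push of one later \<open>f m\<close>, where only the refinement map can differ.\<close>

lemma thread_cech:
  fixes f :: "nat \<Rightarrow> 'a::topological_space set list \<Rightarrow> 'f::field"
  assumes cof: "cofinal X W" and cyc: "\<And>k. f k \<in> cycles X (W k) q"
    and compat: "\<And>k. \<exists>g. refines_by X (W (Suc k)) (W k) g \<and> homol X (W k) q (f k) (chain_push X (W (Suc k)) q g (f (Suc k)))"
  obtains x where "x \<in> cech X q" "\<And>k. f k \<in> x (W k)"
proof -
  have oc: "ocover X (W k)" for k using cof by (simp add: cofinal_def)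
  have ref: "\<exists>g. refines_by X (W m) (W k) g" if "k \<le> m" for k m
    using cofinal_srefines[OF cof that] srefines_refines by blast
  have hom: "homol X (W k) q (f k) (chain_push X (W m) q g (f m))"
    if "k \<le> m" "refines_by X (W m) (W k) g" for k m g
    using that
  proof (induction m arbitrary: g rule: dec_induct)
    case base
    have id: "refines_by X (W k) (W k) (\<lambda>W. W)" by (simp add: refines_by_def)
    have "chain_push X (W k) q (\<lambda>W. W) (f k) = f k"
    proof
      fix \<tau>
      have "{\<sigma> \<in> nerve X (W k) q. map (\<lambda>W. W) \<sigma> = \<tau>} = (if \<tau> \<in> nerve X (W k) q then {\<tau>} else {})" by auto
      then show "chain_push X (W k) q (\<lambda>W. W) (f k) \<tau> = f k \<tau>"
        using cycles_subset_chains[OF cyc[of k]] by (auto simp: chain_push_def chains_def)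
    qed
    with push_refines_unique[OF oc oc id base(1) cyc] show ?case by simp
  next
    case (step m)
    obtain h where h: "refines_by X (W m) (W k) h" using ref[OF step(1)] by blast
    obtain g' where g': "refines_by X (W (Suc m)) (W m) g'"
      "homol X (W m) q (f m) (chain_push X (W (Suc m)) q g' (f (Suc m)))" using compat by blast
    have 1: "homol X (W k) q (f k) (chain_push X (W m) q h (f m))" by (rule step.IH[OF h])
    have 2: "homol X (W k) q (chain_push X (W m) q h (f m))
        (chain_push X (W m) q h (chain_push X (W (Suc m)) q g' (f (Suc m))))"
      by (rule push_refines_homol[OF oc oc h g'(2)])
    have 3: "chain_push X (W m) q h (chain_push X (W (Suc m)) q g' (f (Suc m)))
        = chain_push X (W (Suc m)) q (h \<circ> g') (f (Suc m))"
      by (rule push_refines_comp[OF oc oc g'(1) cyc])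
    have 4: "homol X (W k) q (chain_push X (W (Suc m)) q (h \<circ> g') (f (Suc m))) (chain_push X (W (Suc m)) q g (f (Suc m)))"
      by (rule push_refines_unique[OF oc oc refines_comp[OF g'(1) h] step.prems cyc])
    show ?case by (rule homol_trans[OF 1 homol_trans[OF 2[unfolded 3] 4]])
  qed
  have hom2: "homol X U q (chain_push X (W k) q g (f k)) (chain_push X (W k') q g' (f k'))"
    if U: "ocover X U" and g: "refines_by X (W k) U g" and g': "refines_by X (W k') U g'" for U k g k' g'
  proof -
    define m where "m = max k k'"
    obtain h where h: "refines_by X (W m) (W k) h" using ref[of k m] by (auto simp: m_def)
    obtain h' where h': "refines_by X (W m) (W k') h'" using ref[of k' m] by (auto simp: m_def)
    have 1: "homol X U q (chain_push X (W k) q g (f k)) (chain_push X (W m) q (g \<circ> h) (f m))"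
      using push_refines_homol[OF oc U g hom[OF _ h]] push_refines_comp[OF oc oc h cyc] by (simp add: m_def)
    have 2: "homol X U q (chain_push X (W k') q g' (f k')) (chain_push X (W m) q (g' \<circ> h') (f m))"
      using push_refines_homol[OF oc U g' hom[OF _ h']] push_refines_comp[OF oc oc h' cyc] by (simp add: m_def)
    have 3: "homol X U q (chain_push X (W m) q (g \<circ> h) (f m)) (chain_push X (W m) q (g' \<circ> h') (f m))"
      by (rule push_refines_unique[OF oc U refines_comp[OF h g] refines_comp[OF h' g'] cyc])
    show ?thesis by (rule homol_trans[OF 1 homol_trans[OF 3 homol_sym[OF 2]]])
  qed
  \<comment> \<open>Admitting every index and every refinement map avoids a choice;
    \<open>x_eq\<close> shows that the result is still a single coset.\<close>
  define x where "x U = (if ocover X U then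
      {e. \<exists>k g. refines_by X (W k) U g \<and> homol X U q e (chain_push X (W k) q g (f k))} else {})" for U
  have x_eq: "x U = hclass X U q (chain_push X (W k) q g (f k))"
    if "ocover X U" "refines_by X (W k) U g" for U k g
  proof (rule set_eqI)
    fix e
    have "e \<in> x U \<longleftrightarrow> (\<exists>k g. refines_by X (W k) U g \<and> homol X U q e (chain_push X (W k) q g (f k)))"
      using that(1) by (simp add: x_def)
    also have "\<dots> \<longleftrightarrow> homol X U q e (chain_push X (W k) q g (f k))"
      using homol_trans[OF _ hom2[OF that(1) _ that(2)], of e] that(2) by blast
    finally show "e \<in> x U \<longleftrightarrow> e \<in> hclass X U q (chain_push X (W k) q g (f k))"
      by (simp add: mem_hclass_iff)
  qed
  have ref_U: "\<exists>k g. refines_by X (W k) U g" if "ocover X U" for U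
    using cof that srefines_refines unfolding cofinal_def by blast
  show thesis
  proof (rule that)
    show "x \<in> cech X q"
    proof (rule cechI)
      fix U assume U: "ocover X U"
      then obtain k g where g: "refines_by X (W k) U g" using ref_U by blast
      then show "\<exists>c\<in>cycles X U q. x U = hclass X U q c"
        using x_eq[OF U g] push_refines_cycles[OF oc U g cyc] by blast
    next
      fix U assume "\<not> ocover X U" then show "x U = {}" by (simp add: x_def)
    next
      fix U V g' assume UV: "ocover X U" "ocover X V" "refines_by X V U g'"
      then obtain k g where g: "refines_by X (W k) V g" using ref_U by blast
      let ?c = "chain_push X (W k) q g (f k)"
      have "?c \<in> x V" using x_eq[OF UV(2) g] hclass_self by metis
      moreover have "chain_push X V q g' ?c = chain_push X (W k) q (g' \<circ> g) (f k)"
        by (rule push_refines_comp[OF oc UV(2) g cyc])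
      then have "chain_push X V q g' ?c \<in> x U"
        using x_eq[OF UV(1) refines_comp[OF g UV(3)]] hclass_self by metis
      ultimately show "\<exists>c\<in>x V. chain_push X V q g' c \<in> x U" by blast
    qed
    fix k
    have id: "refines_by X (W k) (W k) (\<lambda>W. W)" by (simp add: refines_by_def)
    show "f k \<in> x (W k)"
      using hom[OF order_refl id] x_eq[OF oc id] by (simp add: mem_hclass_iff)
  qed
qed

text \<open>Along a cofinal sequence \<open>V n\<close> of covers, the images in \<open>H\<^sub>q(V n)\<close> of the finer nerves decrease
  within a finite-dimensional space, so they stabilise; the stable images map onto each other, so their elements lift to threads.\<close>

lemma mittag_leffler:
  fixes X :: "'a::metric_space set"
  assumes X: "compact X" and U: "ocover X U"
  obtains V g where "ocover X V" "srefines V U g"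
    "\<forall>c\<in>cycles X V q. \<exists>x\<in>(cech X q :: ('a set set \<Rightarrow> ('a set list \<Rightarrow> 'f::field) set) set). chain_push X V q g c \<in> x U"
proof -
  obtain V where cof: "cofinal X V" using cofinal_exists[OF X] .
  have oc: "ocover X (V n)" for n using cof by (simp add: cofinal_def)
  define G where "G m n = (SOME g. srefines (V m) (V n) g)" for m n
  have Gs: "srefines (V m) (V n) (G m n)" if "n \<le> m" for m n
    unfolding G_def using cofinal_srefines[OF cof that] by (rule someI_ex)
  then have G: "refines_by X (V m) (V n) (G m n)" if "n \<le> m" for m n
    using srefines_refines that by blast
  \<comment> \<open>The image of the homology of \<open>V m\<close> in that of \<open>V n\<close>,
    recorded as the set of all representing cycles: in this form it is a subspace of functions
    supported on one finite nerve.\<close>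
  define I :: "nat \<Rightarrow> nat \<Rightarrow> ('a set list \<Rightarrow> 'f) set" where "I n m = {c \<in> cycles X (V n) q. \<exists>d\<in>cycles X (V m) q. homol X (V n) q c (chain_push X (V m) q (G m n) d)}" for n m
  have push_I: "chain_push X (V m) q g d \<in> I n m" if "n \<le> m" "d \<in> cycles X (V m) q" "refines_by X (V m) (V n) g" for n m d g
    using push_refines_cycles[OF oc oc that(3,2)] push_refines_unique[OF oc oc that(3) G[OF that(1)] that(2)] that(2)
    unfolding I_def by blast
  have "\<exists>k0. \<forall>k\<ge>k0. I n (n + k) = I n (n + k0)" for n
  proof (rule lin_subspace_decreasing_stabilises)
    show "finite (nerve X (V n) q)" by (rule finite_nerve[OF ocover_finite[OF oc]])
    show "lin_subspace (I n (n + k))" for k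
      unfolding lin_subspace_def
    proof (intro conjI ballI allI)
      have "(\<lambda>_. 0 :: 'f) = chain_push X (V (n + k)) q (G (n + k) n) (\<lambda>_. 0)" by (simp add: chain_push_def)
      then show "(\<lambda>_. 0) \<in> I n (n + k)"
        using push_I[OF _ lin_subspace_zero[OF lin_subspace_cycles] G, of n "n + k"] by simp
      fix c d a b assume "c \<in> I n (n + k)" "d \<in> I n (n + k)"
      then obtain c' d' where *: "c \<in> cycles X (V n) q" "d \<in> cycles X (V n) q"
        "c' \<in> cycles X (V (n + k)) q" "d' \<in> cycles X (V (n + k)) q"
        "homol X (V n) q c (chain_push X (V (n + k)) q (G (n + k) n) c')"
        "homol X (V n) q d (chain_push X (V (n + k)) q (G (n + k) n) d')"
        unfolding I_def by blast
      have "homol X (V n) q (\<lambda>\<sigma>. a * c \<sigma> + b * d \<sigma>) (chain_push X (V (n + k)) q (G (n + k) n) (\<lambda>\<sigma>. a * c' \<sigma> + b * d' \<sigma>))"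
        unfolding chain_push_lincomb by (rule homol_lincomb[OF *(5,6)])
      then show "(\<lambda>\<sigma>. a * c \<sigma> + b * d \<sigma>) \<in> I n (n + k)"
        using subspD[OF lin_subspace_cycles *(1,2), of a b] subspD[OF lin_subspace_cycles *(3,4), of a b] unfolding I_def by blast
    qed
    show "I n (n + Suc k) \<subseteq> I n (n + k)" for k
    proof
      fix c assume c: "c \<in> I n (n + Suc k)"
      let ?m = "n + k" and ?m' = "n + Suc k"
      obtain d where d: "c \<in> cycles X (V n) q" "d \<in> cycles X (V ?m') q" "homol X (V n) q c (chain_push X (V ?m') q (G ?m' n) d)"
        using c unfolding I_def by blast
      have G1: "refines_by X (V ?m') (V ?m) (G ?m' ?m)" "refines_by X (V ?m) (V n) (G ?m n)"
        "refines_by X (V ?m') (V n) (G ?m' n)" by (auto intro!: G)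
      let ?d = "chain_push X (V ?m') q (G ?m' ?m) d"
      have d': "?d \<in> cycles X (V ?m) q" by (rule push_refines_cycles[OF oc oc G1(1) d(2)])
      have "chain_push X (V ?m) q (G ?m n) ?d = chain_push X (V ?m') q (G ?m n \<circ> G ?m' ?m) d"
        by (rule push_refines_comp[OF oc oc G1(1) d(2)])
      moreover have "homol X (V n) q (chain_push X (V ?m') q (G ?m' n) d) (chain_push X (V ?m') q (G ?m n \<circ> G ?m' ?m) d)"
        by (rule push_refines_unique[OF oc oc G1(3) refines_comp[OF G1(1,2)] d(2)])
      ultimately have "homol X (V n) q c (chain_push X (V ?m) q (G ?m n) ?d)"
        using homol_trans[OF d(3)] by simp
      then show "c \<in> I n ?m" using d(1) d' unfolding I_def by blast
    qed
    show "c \<sigma> = 0" if "c \<in> I n (n + k)" "\<sigma> \<notin> nerve X (V n) q" for k c \<sigma>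
      using that cycles_subset_chains unfolding I_def chains_def by blast
  qed
  then obtain K where K: "\<And>n k. k \<ge> K n \<Longrightarrow> I n (n + k) = I n (n + K n)" by metis
  define S where "S n = I n (n + K n)" for n
  have S: "S n = I n m" if "m \<ge> n + K n" for n m
    using K[of n "m - n"] that by (simp add: S_def)
  have lift: "\<exists>c'. c' \<in> S (Suc n) \<and> homol X (V n) q c (chain_push X (V (Suc n)) q (G (Suc n) n) c')" if "c \<in> S n" for c n
  proof -
    \<comment> \<open>So late that both the stable image at \<open>n\<close> and the one at
      \<open>Suc n\<close> are images from \<open>V m\<close>; one cycle there then represents an
      element of the first and its lift to the second.\<close>
    define m where "m = max (n + K n) (Suc n + K (Suc n))"
    have "c \<in> I n m" using that S[of n m] by (simp add: m_def)
    then obtain d where d: "d \<in> cycles X (V m) q" "homol X (V n) q c (chain_push X (V m) q (G m n) d)"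
      unfolding I_def by blast
    have m: "Suc n \<le> m" "n \<le> m" "n \<le> Suc n" by (auto simp: m_def)
    note G1 = G[OF m(1)] G[OF m(2)] G[OF m(3)]
    let ?c = "chain_push X (V m) q (G m (Suc n)) d"
    have "?c \<in> S (Suc n)" using push_I[OF m(1) d(1) G1(1)] S[of "Suc n" m] by (simp add: m_def)
    moreover have "chain_push X (V (Suc n)) q (G (Suc n) n) ?c = chain_push X (V m) q (G (Suc n) n \<circ> G m (Suc n)) d"
      by (rule push_refines_comp[OF oc oc G1(1) d(1)])
    moreover have "homol X (V n) q (chain_push X (V m) q (G m n) d) (chain_push X (V m) q (G (Suc n) n \<circ> G m (Suc n)) d)"
      by (rule push_refines_unique[OF oc oc G1(2) refines_comp[OF G1(1,3)] d(1)])
    ultimately show ?thesis using homol_trans[OF d(2)] by auto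
  qed
  have S_cech: "\<exists>x\<in>cech X q. c \<in> x (V n)" if c: "c \<in> S n" for c n
  proof -
    \<comment> \<open>The clause for \<open>k = 0\<close> makes the thread start at the prescribed
      cycle.\<close>
    have "\<exists>f. \<forall>k. (f k \<in> S (n + k) \<and> (k = 0 \<longrightarrow> f k = c)) \<and>
        homol X (V (n + k)) q (f k) (chain_push X (V (Suc (n + k))) q (G (Suc (n + k)) (n + k)) (f (Suc k)))"
      by (rule dependent_nat_choice) (use c lift in auto)
    then obtain f where f: "\<And>k. f k \<in> S (n + k)" "f 0 = c"
      "\<And>k. homol X (V (n + k)) q (f k) (chain_push X (V (Suc (n + k))) q (G (Suc (n + k)) (n + k)) (f (Suc k)))"
      by blast
    have 1: "f k \<in> cycles X (V (n + k)) q" for k using f(1)[of k] by (auto simp: S_def I_def)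
    have 2: "\<exists>g. refines_by X (V (n + Suc k)) (V (n + k)) g
        \<and> homol X (V (n + k)) q (f k) (chain_push X (V (n + Suc k)) q g (f (Suc k)))" for k
      using f(3)[of k] G[of "n + k" "Suc (n + k)"] by auto
    show ?thesis
    proof (rule thread_cech[OF cofinal_shift[OF cof, of n] 1 2])
      fix x assume "x \<in> cech X q" "\<And>k. f k \<in> x (V (n + k))"
      from this(1) this(2)[of 0] f(2) show "\<exists>x\<in>cech X q. c \<in> x (V n)" by auto
    qed
  qed
  obtain n h where h: "srefines (V n) U h" using cof U unfolding cofinal_def by blast
  \<comment> \<open>Every cycle of this cover pushes into the stable image at \<open>V n\<close>,
    and \<open>V n\<close> already refines \<open>U\<close>.\<close>
  let ?m = "n + K n"
  show thesis
  proof (rule that)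
    show "ocover X (V ?m)" by (rule oc)
    show "srefines (V ?m) U (h \<circ> G ?m n)" by (rule srefines_comp[OF Gs h]) simp
    show "\<forall>c\<in>(cycles X (V ?m) q :: ('a set list \<Rightarrow> 'f) set). \<exists>x\<in>cech X q. chain_push X (V ?m) q (h \<circ> G ?m n) c \<in> x U"
    proof
      fix c :: "'a set list \<Rightarrow> 'f" assume c: "c \<in> cycles X (V ?m) q"
      have G1: "refines_by X (V ?m) (V n) (G ?m n)" by (rule G) simp
      have "chain_push X (V ?m) q (G ?m n) c \<in> S n"
        unfolding S_def by (rule push_I[OF _ c G1]) simp
      then obtain x where x: "x \<in> cech X q" "chain_push X (V ?m) q (G ?m n) c \<in> x (V n)" using S_cech by blast
      have "chain_push X (V n) q h (chain_push X (V ?m) q (G ?m n) c) \<in> x U"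
        by (rule cech_push[OF x(1) U oc srefines_refines[OF h] x(2)])
      then show "\<exists>x\<in>cech X q. chain_push X (V ?m) q (h \<circ> G ?m n) c \<in> x U"
        using x(1) push_refines_comp[OF oc oc G1 c] by metis
    qed
  qed
qed

text \<open>\<open>G\<close> is the union of \<open>V\<close> minus the finitely many intersections
  of closures of members that miss \<open>X\<close>. If an intersection of members meets
  \<open>G\<close>, then the corresponding closures meet inside \<open>X\<close>, and each closure
  lies in the member of \<open>U\<close> chosen by \<open>h\<close>.\<close>

lemma shrink_cover:
  fixes X :: "'a::metric_space set"
  assumes X: "compact X" and U: "ocover X U"
  obtains G V h where "open G" "X \<subseteq> G" "ocover G V" "srefines V U h"
    "\<forall>s\<subseteq>V. \<Inter>s \<inter> G \<noteq> {} \<longrightarrow> \<Inter>(h ` s) \<inter> X \<noteq> {}"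
proof -
  obtain e where e: "e > 0" "\<And>x. x \<in> X \<Longrightarrow> \<exists>W\<in>U. ball x e \<subseteq> W"
    using lebesgue_cover[OF assms] by metis
  obtain V where V: "finite V" "\<And>W. W \<in> V \<Longrightarrow> \<exists>x\<in>X. W = ball x (e / 2)" "X \<subseteq> \<Union>V"
    using ball_cover[OF X, of "e / 2"] e(1) by auto
  have oV: "open W" if "W \<in> V" for W using V(2)[OF that] by auto
  have "\<forall>W. \<exists>H. W \<in> V \<longrightarrow> H \<in> U \<and> closure W \<subseteq> H"
  proof (intro allI)
    fix W
    show "\<exists>H. W \<in> V \<longrightarrow> H \<in> U \<and> closure W \<subseteq> H"
    proof (cases "W \<in> V")
      case True
      then obtain x where x: "x \<in> X" "W = ball x (e / 2)" using V(2) by blast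
      have "closure W \<subseteq> cball x (e / 2)" unfolding x(2) by (rule closure_minimal[OF ball_subset_cball closed_cball])
      also have "\<dots> \<subseteq> ball x e" using e(1) by auto
      finally show ?thesis using e(2)[OF x(1)] by blast
    qed blast
  qed
  then obtain h where h: "\<And>W. W \<in> V \<Longrightarrow> h W \<in> U" "\<And>W. W \<in> V \<Longrightarrow> closure W \<subseteq> h W" by metis
  define F where "F s = \<Inter>(closure ` s)" for s :: "'a set set"
  define G where "G = \<Union>V - \<Union>{F s | s. s \<subseteq> V \<and> F s \<inter> X = {}}"
  have "closed (\<Union>{F s | s. s \<subseteq> V \<and> F s \<inter> X = {}})"
  proof (rule closed_Union)
    have "{F s | s. s \<subseteq> V \<and> F s \<inter> X = {}} \<subseteq> F ` Pow V" by auto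
    then show "finite {F s | s. s \<subseteq> V \<and> F s \<inter> X = {}}" using V(1) by (simp add: finite_subset)
    show "\<forall>S\<in>{F s | s. s \<subseteq> V \<and> F s \<inter> X = {}}. closed S" by (auto simp: F_def)
  qed
  then have oG: "open G" unfolding G_def using oV by auto
  show thesis
  proof (rule that[of G V h])
    show "open G" by (rule oG)
    show "X \<subseteq> G" using V(3) unfolding G_def by blast
    show "ocover G V" using V(1) oV unfolding ocover_def G_def by auto
    show "srefines V U h" using h closure_subset unfolding srefines_def by blast
    show "\<forall>s\<subseteq>V. \<Inter>s \<inter> G \<noteq> {} \<longrightarrow> \<Inter>(h ` s) \<inter> X \<noteq> {}"
    proof (intro allI impI)
      fix s assume s: "s \<subseteq> V" "\<Inter>s \<inter> G \<noteq> {}"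
      then obtain y where y: "y \<in> \<Inter>s" "y \<in> G" by blast
      have "y \<in> F s" unfolding F_def using y(1) closure_subset by blast
      then have "F s \<inter> X \<noteq> {}" using y(2) s(1) unfolding G_def by blast
      moreover have "F s \<subseteq> \<Inter>(h ` s)" unfolding F_def using h(2) s(1) by blast
      ultimately show "\<Inter>(h ` s) \<inter> X \<noteq> {}" by blast
    qed
  qed
qed

text \<open>Provides a simplicial map against the inclusion, from the nerve on a set
  \<open>Y\<close> near \<open>X\<close> to the nerve on \<open>X\<close>.\<close>

lemma shrink_contig:
  assumes "srefines V U h" "\<forall>s\<subseteq>V. \<Inter>s \<inter> G \<noteq> {} \<longrightarrow> \<Inter>(h ` s) \<inter> X \<noteq> {}" "Y \<subseteq> G"
  shows "contig Y V X U h h"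
  unfolding contig_def
proof (intro allI impI)
  fix s assume s: "s \<subseteq> V" "s \<noteq> {} \<and> \<Inter>s \<inter> Y \<noteq> {}"
  then have "\<Inter>(h ` s) \<inter> X \<noteq> {}" using assms(2) s(1) assms(3) by blast
  moreover have "h ` s \<subseteq> U" using s(1) assms(1) unfolding srefines_def by blast
  ultimately show "h ` s \<union> h ` s \<subseteq> U \<and> \<Inter>(h ` s \<union> h ` s) \<inter> X \<noteq> {}" by simp
qed

subsection \<open>Stability of the rank\<close>

lemma compact_enlargement:
  fixes A :: "'a::euclidean_space set"
  assumes "compact A" "open S" "A \<subseteq> S"
  obtains e where "e > 0" "compact (\<Union>x\<in>A. cball x e)" "(\<Union>x\<in>A. cball x e) \<subseteq> S"
proof -
  obtain d where d: "d > 0" "\<And>x. x \<in> A \<Longrightarrow> \<exists>G\<in>{S}. ball x d \<subseteq> G"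
    using Heine_Borel_lemma[OF assms(1), of "{S}"] assms(2,3) by auto
  have "(\<Union>x\<in>A. cball x (d / 2)) = {x + y |x y. x \<in> A \<and> y \<in> cball 0 (d / 2)}"
  proof (intro set_eqI iffI)
    fix z assume "z \<in> (\<Union>x\<in>A. cball x (d / 2))"
    then obtain x where "x \<in> A" "dist x z \<le> d / 2" by auto
    then show "z \<in> {x + y |x y. x \<in> A \<and> y \<in> cball 0 (d / 2)}"
      by (intro CollectI exI[of _ x] exI[of _ "z - x"]) (simp add: dist_norm norm_minus_commute)
  next
    fix z assume "z \<in> {x + y |x y. x \<in> A \<and> y \<in> cball 0 (d / 2)}"
    then obtain x y where "x \<in> A" "norm y \<le> d / 2" "z = x + y" by auto
    then show "z \<in> (\<Union>x\<in>A. cball x (d / 2))" by (intro UN_I[of x]) (simp_all add: dist_norm)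
  qed
  then have "compact (\<Union>x\<in>A. cball x (d / 2))"
    using compact_sums[OF assms(1) compact_cball, of 0 "d / 2"] by simp
  moreover have "cball x (d / 2) \<subseteq> ball x d" for x :: 'a using d(1) by auto
  then have "(\<Union>x\<in>A. cball x (d / 2)) \<subseteq> S" using d(2) by blast
  ultimately show thesis using that[of "d / 2"] d(1) by simp
qed

text \<open>A nerve cycle of \<open>A\<close> that bounds at the fixed coarse cover \<open>U0\<close> bounds a chain of points near \<open>A\<close>;
  subdividing this chain inside the neighbourhood \<open>S\<close> and retracting it by \<open>r\<close> makes it bound in \<open>B\<close>
  at an arbitrarily fine cover.\<close>

lemma bounding_at_coarse_cover:
  fixes A B :: "'a::euclidean_space set"
  assumes A: "compact A" and S: "open S" "A \<subseteq> S" and r: "continuous_on S r" "r ` S \<subseteq> B"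
    and rid: "\<And>x. x \<in> A \<Longrightarrow> r x = x"
  obtains U0 where "ocover A U0"
    "\<And>U'. ocover B U' \<Longrightarrow> \<exists>V g h. ocover A V \<and> refines_by A V U0 g \<and> refines_by A V U' h \<and>
       (\<forall>c\<in>(cycles A V q :: ('a set list \<Rightarrow> 'f::field) set).
          chain_push A V q g c \<in> bdries A U0 q \<longrightarrow> chain_push A V q h c \<in> bdries B U' q)"
proof -
  obtain e where e: "e > 0" and Q: "compact (\<Union>x\<in>A. cball x e)" "(\<Union>x\<in>A. cball x e) \<subseteq> S"
    using compact_enlargement[OF A S] .
  define Q where "Q = (\<Union>x\<in>A. cball x e)"
  \<comment> \<open>With diameters at most \<open>e / 4\<close>, points sampled from members with a
    common point \<open>z\<close> of \<open>A\<close> lie within \<open>e / 4\<close> of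
    \<open>z\<close>, so their hull stays in the \<open>e\<close>-enlargement of
    \<open>A\<close>.\<close>
  obtain U0 where U0: "finite U0" "\<And>W. W \<in> U0 \<Longrightarrow> \<exists>x\<in>A. W = ball x (e / 8)" "A \<subseteq> \<Union>U0"
    using ball_cover[OF A, of "e / 8"] e by auto
  have oU0: "ocover A U0" by (rule ball_cover_ocover[OF U0])
  have diam0: "dist x y \<le> e / 4" if W: "W \<in> U0" "x \<in> W" "y \<in> W" for W x y
  proof -
    obtain a where "W = ball a (e / 8)" using U0(2)[OF W(1)] by blast
    then show ?thesis using W(2,3) dist_triangle2[of x y a] by (auto simp: dist_commute)
  qed
  \<comment> \<open>Sampling a point from each member turns chains on nerves into chains of points.
    The value is arbitrary if \<open>W\<close> misses \<open>A\<close>, which does not happen for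
    members of nerve simplices.\<close>
  define s where "s W = (SOME y. y \<in> W \<inter> A)" for W
  have s: "s W \<in> W \<inter> A" if "W \<inter> A \<noteq> {}" for W
    unfolding s_def using that by (meson ex_in_conv someI_ex)
  have near: "fine_in Q e m \<tau>" if "z \<in> A" "\<And>y. y \<in> set \<tau> \<Longrightarrow> dist z y \<le> e / 4" "length \<tau> = m" for z \<tau> m
  proof -
    have "convex hull (set \<tau>) \<subseteq> cball z (e / 4)" by (rule hull_minimal) (use that(2) in auto)
    also have "\<dots> \<subseteq> Q" unfolding Q_def using that(1) e by (auto intro!: bexI[of _ z])
    finally have "convex hull (set \<tau>) \<subseteq> Q" .
    moreover have "dist x y \<le> e" if "x \<in> set \<tau>" "y \<in> set \<tau>" for x y
      using \<open>\<And>y. y \<in> set \<tau> \<Longrightarrow> dist z y \<le> e / 4\<close>[OF that(1)]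
        \<open>\<And>y. y \<in> set \<tau> \<Longrightarrow> dist z y \<le> e / 4\<close>[OF that(2)] dist_triangle3[of x y z] e by linarith
    ultimately show ?thesis using that(3) by (auto simp: fine_in_def mesh_le_def)
  qed
  show thesis
  proof (rule that[OF oU0])
    fix U' assume U': "ocover B U'"
    note finU' = ocover_finite[OF U']
    let ?\<G> = "(\<lambda>W. S \<inter> r -` W) ` U'"
    have "Q \<subseteq> \<Union>?\<G>"
    proof
      fix y assume "y \<in> Q"
      then have "y \<in> S" using Q(2)[folded Q_def] by (rule rev_subsetD)
      moreover from this have "r y \<in> \<Union>U'" using r(2) U' unfolding ocover_def by blast
      ultimately show "y \<in> \<Union>?\<G>" by auto
    qed
    moreover have "open G" if "G \<in> ?\<G>" for G
      using that U' continuous_open_preimage[OF r(1) S(1)] by (auto simp: ocover_def)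
    ultimately obtain \<delta> where \<delta>: "\<delta> > 0" "\<And>y. y \<in> Q \<Longrightarrow> \<exists>G\<in>?\<G>. ball y \<delta> \<subseteq> G"
      using Heine_Borel_lemma[OF Q(1)[folded Q_def], of ?\<G>] by metis
    then have "\<forall>y. \<exists>W. y \<in> Q \<longrightarrow> W \<in> U' \<and> ball y \<delta> \<subseteq> S \<inter> r -` W" by fastforce
    then obtain p where p: "\<And>y. y \<in> Q \<Longrightarrow> p y \<in> U'" "\<And>y. y \<in> Q \<Longrightarrow> ball y \<delta> \<subseteq> S \<inter> r -` p y" by metis
    obtain d0 where d0: "d0 > 0" "\<And>x. x \<in> A \<Longrightarrow> \<exists>W\<in>U0. ball x d0 \<subseteq> W"
      using lebesgue_cover[OF A oU0] by metis
    \<comment> \<open>The three bounds make \<open>V\<close> refine \<open>U0\<close>, keep the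
      sampled prism inside \<open>Q\<close>, and make the sampled cycle of mesh at most
      \<open>\<delta> / 2\<close>.\<close>
    define d where "d = min d0 (min (e / 8) (\<delta> / 8))"
    have d: "d > 0" "d \<le> d0" "d \<le> e / 8" "d \<le> \<delta> / 8" using d0(1) e \<delta>(1) by (auto simp: d_def)
    obtain V where V: "finite V" "\<And>W. W \<in> V \<Longrightarrow> \<exists>x\<in>A. W = ball x d" "A \<subseteq> \<Union>V"
      using ball_cover[OF A d(1)] by metis
    have oV: "ocover A V" by (rule ball_cover_ocover[OF V])
    obtain g where g: "srefines V U0 g" using lebesgue_refines[OF d0(2) V(2) d(2)] by metis
    have diamV: "dist x y \<le> \<delta> / 4" "dist x y \<le> e / 4" if W: "W \<in> V" "x \<in> W" "y \<in> W" for W x y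
    proof -
      obtain a where "W = ball a d" using V(2)[OF W(1)] by blast
      then have "dist x y \<le> 2 * d" using W(2,3) dist_triangle2[of x y a] by (auto simp: dist_commute)
      then show "dist x y \<le> \<delta> / 4" "dist x y \<le> e / 4" using d by linarith+
    qed
    have VA: "W \<inter> A \<noteq> {}" if "W \<in> V" for W using V(2)[OF that] d(1) by auto
    have AQ: "A \<subseteq> Q" unfolding Q_def using e by auto
    \<comment> \<open>Sample a point of the member, then take a member of \<open>U'\<close> that
      contains the retracted \<delta>-ball around it.\<close>
    define h where "h = p \<circ> s"
    have h: "refines_by A V U' h"
      unfolding refines_by_def
    proof (intro ballI conjI)
      fix W assume W: "W \<in> V"
      have sW: "s W \<in> W \<inter> A" by (rule s[OF VA[OF W]])
      then have sQ: "s W \<in> Q" using AQ by blast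
      show "h W \<in> U'" using p(1)[OF sQ] by (simp add: h_def)
      show "W \<inter> A \<subseteq> h W \<inter> A"
      proof
        fix y assume y: "y \<in> W \<inter> A"
        then have "dist (s W) y \<le> \<delta> / 4" using diamV(1)[OF W] sW by blast
        then have "y \<in> ball (s W) \<delta>" using \<delta>(1) by auto
        then have "r y \<in> p (s W)" using p(2)[OF sQ] by blast
        then show "y \<in> h W \<inter> A" using y rid by (simp add: h_def)
      qed
    qed
    have "chain_push A V q h c \<in> bdries B U' q"
      if c: "c \<in> cycles A V q" and bc: "chain_push A V q g c \<in> bdries A U0 q" for c :: "'a set list \<Rightarrow> 'f"
    proof (cases "q \<ge> 0")
      case False
      then have "c = (\<lambda>_. 0)" using c by (simp add: cycles_def chains_neg)
      then show ?thesis using lin_subspace_zero[OF lin_subspace_bdries] by (simp add: chain_push_def)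
    next
      case True
      obtain C where C: "lookup C = c" "keys C \<subseteq> nerve A V q" "q \<le> 0 \<or> bd_chain C = 0"
        using cyclesE[OF V(1) c] .
      obtain b where b: "lookup (bd_chain b) = chain_push A V q g c" "keys b \<subseteq> nerve A U0 (q + 1)"
        using bdriesE[OF U0(1) True bc] .
      have bdb: "bd_chain b = push_chain g C"
        using b(1) chain_push_lookup[OF V(1) C(2), of g] C(1) by (intro poly_mapping_eqI) simp
      \<comment> \<open>The sampled \<open>b\<close> fills the sample of the pushed cycle
        \<open>push_chain g C\<close>; the prism joins that sample to the one of \<open>C\<close>
        itself.\<close>
      define E where "E = push_chain s b + lin (prism (s \<circ> g) s) C"
      have bdE: "bd_chain E = push_chain s C"
        using prism_cycle[OF C(2,3) True, of "s \<circ> g" s]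
        by (simp add: E_def lin_add bd_chain_push_chain bdb push_chain_push_chain)
      \<comment> \<open>The number of vertices in degree \<open>q\<close>; the simplices of a
        filling have one more.\<close>
      define n where "n = nat (q + 1)"
      have fineE: "fine_in Q e (Suc n) \<tau>" if t: "\<tau> \<in> keys E" for \<tau>
      proof -
        from t consider "\<tau> \<in> keys (push_chain s b)" | "\<tau> \<in> keys (lin (prism (s \<circ> g) s) C)"
          using keys_add_subset[of "push_chain s b" "lin (prism (s \<circ> g) s) C"] by (auto simp: E_def)
        then show ?thesis
        proof cases
          case 1
          then obtain \<sigma> where \<sigma>: "\<sigma> \<in> keys b" "\<tau> = map s \<sigma>" using keys_push_chain[of s b] by auto
          then have \<sigma>': "\<sigma> \<in> nerve A U0 (q + 1)" using b(2) by blast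
          then obtain z where z: "z \<in> A" "\<And>W. W \<in> set \<sigma> \<Longrightarrow> z \<in> W" by (auto simp: nerve_def)
          show ?thesis
          proof (rule near[OF z(1)])
            fix y assume "y \<in> set \<tau>"
            then obtain W where W: "W \<in> set \<sigma>" "y = s W" using \<sigma>(2) by auto
            then have "W \<in> U0" "z \<in> W" using \<sigma>' z by (auto simp: nerve_def)
            then show "dist z y \<le> e / 4" using diam0 s[of W] z(1) W(2) by blast
          qed (use \<sigma>' \<sigma>(2) True in \<open>auto simp: nerve_def n_def\<close>)
        next
          case 2
          then obtain \<sigma> where \<sigma>: "\<sigma> \<in> keys C" "\<tau> \<in> keys (prism (s \<circ> g) s \<sigma> :: 'a list \<Rightarrow>\<^sub>0 'f)"
            using keys_lin[of "prism (s \<circ> g) s" C] by auto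
          have \<tau>: "length \<tau> = Suc (length \<sigma>)" "set \<tau> \<subseteq> (s \<circ> g) ` set \<sigma> \<union> s ` set \<sigma>"
            using keys_prism[OF \<sigma>(2)] by auto
          have \<sigma>': "\<sigma> \<in> nerve A V q" using \<sigma> C(2) by blast
          then obtain z where z: "z \<in> A" "\<And>W. W \<in> set \<sigma> \<Longrightarrow> z \<in> W" by (auto simp: nerve_def)
          show ?thesis
          proof (rule near[OF z(1)])
            fix y assume "y \<in> set \<tau>"
            then obtain W where W: "W \<in> set \<sigma>" "y = s (g W) \<or> y = s W" using \<tau>(2) by auto
            then have WV: "W \<in> V" "z \<in> W" using \<sigma>' z by (auto simp: nerve_def)
            then have "g W \<in> U0" "z \<in> g W" using g by (auto simp: srefines_def)
            then have "dist z (s (g W)) \<le> e / 4" using diam0 s[of "g W"] z(1) by blast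
            moreover have "dist z (s W) \<le> e / 4" using WV diamV(2) s[of W] z(1) by blast
            ultimately show "dist z y \<le> e / 4" using W(2) by auto
          qed (use \<sigma>' \<tau>(1) True in \<open>auto simp: nerve_def n_def\<close>)
        qed
      qed
      have fineC: "mesh_le (\<delta> / 2) \<tau>" if t: "\<tau> \<in> keys (push_chain s C)" for \<tau>
      proof -
        obtain \<sigma> where \<sigma>: "\<sigma> \<in> nerve A V q" "\<tau> = map s \<sigma>" using t keys_push_chain[of s C] C(2) by auto
        then obtain z where z: "z \<in> A" "\<And>W. W \<in> set \<sigma> \<Longrightarrow> z \<in> W" by (auto simp: nerve_def)
        have 1: "dist z y \<le> \<delta> / 4" if y: "y \<in> set \<tau>" for y
        proof -
          obtain W where W: "W \<in> set \<sigma>" "y = s W" using y \<sigma>(2) by auto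
          then have "W \<in> V" "z \<in> W" using \<sigma> z by (auto simp: nerve_def)
          then show ?thesis using diamV(1) s[of W] z(1) W(2) by blast
        qed
        have "dist x y \<le> \<delta> / 2" if "x \<in> set \<tau>" "y \<in> set \<tau>" for x y
          using 1[OF that(1)] 1[OF that(2)] dist_triangle3[of x y z] by linarith
        then show ?thesis by (auto simp: mesh_le_def)
      qed
      have pos: "e \<ge> 0" "\<delta> / 2 > 0" using e \<delta>(1) by auto
      obtain E' where E': "\<forall>\<tau>\<in>keys E'. fine_in Q (\<delta> / 2) (Suc n) \<tau>" "bd_chain E' = push_chain s C"
        by (rule fine_filling[OF _ bdE _ pos]) (rule fineE fineC that; assumption)+
      have "keys (push_chain p E') \<subseteq> nerve B U' (q + 1)"
      proof
        fix \<tau> assume "\<tau> \<in> keys (push_chain p E')"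
        then obtain \<sigma> where \<sigma>: "\<sigma> \<in> keys E'" "\<tau> = map p \<sigma>" using keys_push_chain[of p E'] by auto
        have len: "length \<sigma> = Suc n" and hull: "convex hull (set \<sigma>) \<subseteq> Q" and mesh: "mesh_le (\<delta> / 2) \<sigma>"
          using bspec[OF E'(1) \<sigma>(1)] by (simp_all add: fine_in_def)
        have \<sigma>Q: "y \<in> Q" if "y \<in> set \<sigma>" for y using subsetD[OF hull hull_inc[OF that]] .
        have y0: "hd \<sigma> \<in> set \<sigma>" using len by (intro hd_in_set) auto
        \<comment> \<open>The members of \<open>U'\<close> attached to a fine simplex share the
          retracted image of its first vertex, because all vertices lie within \<delta> of it. This
          common point is in \<open>B\<close>, so the simplex belongs to the nerve on
          \<open>B\<close>.\<close>
        have "r (hd \<sigma>) \<in> p y" if "y \<in> set \<sigma>" for y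
        proof -
          have "dist y (hd \<sigma>) \<le> \<delta> / 2" using mesh that y0 by (auto simp: mesh_le_def)
          then have "hd \<sigma> \<in> ball y \<delta>" using \<delta>(1) by auto
          then show ?thesis using p(2)[OF \<sigma>Q[OF that]] by blast
        qed
        moreover have "r (hd \<sigma>) \<in> B" using subsetD[OF Q(2)[folded Q_def] \<sigma>Q[OF y0]] r(2) by blast
        ultimately have "\<Inter>(set \<tau>) \<inter> B \<noteq> {}" using \<sigma>(2) by auto
        moreover have "set \<tau> \<subseteq> U'" using p(1) \<sigma>Q \<sigma>(2) by auto
        ultimately show "\<tau> \<in> nerve B U' (q + 1)"
          using True len \<sigma>(2) by (simp add: nerve_def n_def)
      qed
      then have "lookup (bd_chain (push_chain p E')) \<in> bdries B U' q" by (rule bdriesI[OF finU' True])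
      also have "bd_chain (push_chain p E') = push_chain h C" by (simp add: bd_chain_push_chain E'(2) push_chain_push_chain h_def)
      also have "lookup (push_chain h C) = chain_push A V q h c"
        using chain_push_lookup[OF V(1) C(2), of h] C(1) by simp
      finally show ?thesis .
    qed
    then show "\<exists>V g h. ocover A V \<and> refines_by A V U0 g \<and> refines_by A V U' h \<and>
       (\<forall>c\<in>(cycles A V q :: ('a set list \<Rightarrow> 'f) set).
          chain_push A V q g c \<in> bdries A U0 q \<longrightarrow> chain_push A V q h c \<in> bdries B U' q)"
      using oV srefines_refines[OF g] h by blast
  qed
qed

text \<open>A relative form of neighbourhood retract: the map fixes \<open>A\<close> but may take
  values anywhere in \<open>B\<close>. Sublevel sets of a continuous function satisfy this for
  suitable pairs even if neither is a neighbourhood retract by itself.\<close>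

definition nbhd_retracts_into :: "'a::topological_space set \<Rightarrow> 'a set \<Rightarrow> bool" where
  "nbhd_retracts_into A B \<longleftrightarrow> (\<exists>S r. open S \<and> A \<subseteq> S \<and> continuous_on S r \<and> r ` S \<subseteq> B \<and> (\<forall>x\<in>A. r x = x))"

lemma nbhd_retracts_into_subset: "nbhd_retracts_into A B \<Longrightarrow> A \<subseteq> B"
  unfolding nbhd_retracts_into_def by (metis image_subset_iff subset_eq)

text \<open>The difference of two classes that agree at the coarse cover bounds there, hence bounds
  in \<open>B\<close> at every cover. So the image in the homology of \<open>B\<close> depends only
  on the value at \<open>U0\<close>.\<close>

lemma cech_determined_by_cover:
  fixes A B :: "'a::euclidean_space set"
  assumes A: "compact A" and AB: "nbhd_retracts_into A B"
  obtains U0 where "ocover A U0"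
    "\<And>x z c U. x \<in> (cech A q :: ('a set set \<Rightarrow> ('a set list \<Rightarrow> 'f::field) set) set) \<Longrightarrow> z \<in> cech A q \<Longrightarrow>
        c \<in> x U0 \<Longrightarrow> c \<in> z U0 \<Longrightarrow> ocover B U \<Longrightarrow> \<exists>c\<in>x U. \<exists>d\<in>z U. homol B U q c d"
proof -
  obtain S r where "open S" "A \<subseteq> S" "continuous_on S r" "r ` S \<subseteq> B" "\<And>x. x \<in> A \<Longrightarrow> r x = x"
    using AB unfolding nbhd_retracts_into_def by blast
  then obtain U0 where U0: "ocover A U0"
    "\<And>U'. ocover B U' \<Longrightarrow> \<exists>V g h. ocover A V \<and> refines_by A V U0 g \<and> refines_by A V U' h \<and>
       (\<forall>c\<in>(cycles A V q :: ('a set list \<Rightarrow> 'f) set).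
          chain_push A V q g c \<in> bdries A U0 q \<longrightarrow> chain_push A V q h c \<in> bdries B U' q)"
    using bounding_at_coarse_cover[OF A] by metis
  show thesis
  proof (rule that[OF U0(1)])
    fix x z :: "'a set set \<Rightarrow> ('a set list \<Rightarrow> 'f) set" and e U
    assume x: "x \<in> cech A q" and z: "z \<in> cech A q" and e: "e \<in> x U0" "e \<in> z U0" and U: "ocover B U"
    obtain V g h where V: "ocover A V" "refines_by A V U0 g" "refines_by A V U h"
      "\<And>c :: 'a set list \<Rightarrow> 'f. c \<in> cycles A V q \<Longrightarrow> chain_push A V q g c \<in> bdries A U0 q \<Longrightarrow> chain_push A V q h c \<in> bdries B U q"
      using U0(2)[OF U] by blast
    have UA: "ocover A U" using ocover_mono[OF U nbhd_retracts_into_subset[OF AB]] .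
    obtain c where c: "c \<in> cycles A V q" "c \<in> x V" using cech_obtain[OF x V(1)] .
    obtain d where d: "d \<in> cycles A V q" "d \<in> z V" using cech_obtain[OF z V(1)] .
    have "homol A U0 q (chain_push A V q g c) e"
      using cech_push[OF x U0(1) V(1,2) c(2)] cech_mem_iff[OF x U0(1) e(1)] by blast
    moreover have "homol A U0 q (chain_push A V q g d) e"
      using cech_push[OF z U0(1) V(1,2) d(2)] cech_mem_iff[OF z U0(1) e(2)] by blast
    ultimately have "homol A U0 q (chain_push A V q g c) (chain_push A V q g d)"
      using homol_trans homol_sym by blast
    then have "chain_push A V q g (\<lambda>\<sigma>. c \<sigma> - d \<sigma>) \<in> bdries A U0 q" by (simp add: chain_push_diff)
    then have "chain_push A V q h (\<lambda>\<sigma>. c \<sigma> - d \<sigma>) \<in> bdries B U q"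
      by (rule V(4)[OF lin_subspace_diff[OF lin_subspace_cycles c(1) d(1)]])
    then have "homol B U q (chain_push A V q h c) (chain_push A V q h d)" by (simp add: chain_push_diff)
    then show "\<exists>c\<in>x U. \<exists>d\<in>z U. homol B U q c d"
      using cech_push[OF x UA V(1,3) c(2)] cech_push[OF z UA V(1,3) d(2)] by blast
  qed
qed

lemma vanish_push:
  fixes x :: "'a::topological_space set set \<Rightarrow> ('a set list \<Rightarrow> 'f::field) set"
  assumes x: "x \<in> cech A q" and AB: "A \<subseteq> B" and V: "ocover B V" and U: "ocover B U"
    and g: "refines_by B V U g" and van: "x V \<subseteq> bdries B V q"
  shows "x U \<subseteq> bdries B U q"
proof -
  note A = ocover_mono[OF V AB] ocover_mono[OF U AB] refines_mono[OF g AB]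
  obtain c where c: "c \<in> cycles A V q" "c \<in> x V" using cech_obtain[OF x A(1)] .
  have "chain_push A V q g c \<in> x U" by (rule cech_push[OF x A(2,1,3) c(2)])
  moreover have "chain_push B V q g c = chain_push A V q g c"
    by (rule chain_push_mono[OF ocover_finite[OF V] AB cycles_subset_chains[OF c(1)]])
  moreover have "chain_push B V q g c \<in> bdries B U q"
    by (rule push_bdries[OF ocover_finite[OF V] ocover_finite[OF U] refines_contig[OF g g]]) (use c van in blast)
  ultimately show ?thesis using cech_vanish[OF x AB U] by metis
qed

text \<open>\<open>M n\<close> collects the values at \<open>U0\<close> of the classes that die in
  \<open>B\<close> at \<open>V n\<close>. These are decreasing subspaces of functions on one finite
  nerve, so they stabilise, and the cover at the stable index is the detecting one.\<close>

lemma vanishing_detected: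
  fixes A B :: "'a::euclidean_space set"
  assumes A: "compact A" and AB: "nbhd_retracts_into A B" and B: "compact B"
  obtains U1 where "ocover B U1"
    "\<And>x U. x \<in> (cech A q :: ('a set set \<Rightarrow> ('a set list \<Rightarrow> 'f::field) set) set) \<Longrightarrow>
        x U1 \<subseteq> bdries B U1 q \<Longrightarrow> ocover B U \<Longrightarrow> x U \<subseteq> bdries B U q"
proof -
  have sub: "A \<subseteq> B" by (rule nbhd_retracts_into_subset[OF AB])
  obtain U0 where U0: "ocover A U0"
    "\<And>x z c U. x \<in> (cech A q :: ('a set set \<Rightarrow> ('a set list \<Rightarrow> 'f) set) set) \<Longrightarrow> z \<in> cech A q \<Longrightarrow>
        c \<in> x U0 \<Longrightarrow> c \<in> z U0 \<Longrightarrow> ocover B U \<Longrightarrow> \<exists>c\<in>x U. \<exists>d\<in>z U. homol B U q c d"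
    using cech_determined_by_cover[where q=q and 'f='f, OF A AB] by blast
  obtain V where cof: "cofinal B V" using cofinal_exists[OF B] .
  have oc: "ocover B (V n)" for n using cof by (simp add: cofinal_def)
  note ocA = ocover_mono[OF oc sub]
  define M :: "nat \<Rightarrow> ('a set list \<Rightarrow> 'f) set"
    where "M n = {c. \<exists>x\<in>cech A q. c \<in> x U0 \<and> x (V n) \<subseteq> bdries B (V n) q}" for n
  have "\<exists>n0. \<forall>n\<ge>n0. M n = M n0"
  proof (rule lin_subspace_decreasing_stabilises)
    show "finite (nerve A U0 q)" by (rule finite_nerve[OF ocover_finite[OF U0(1)]])
    show "lin_subspace (M n)" for n
      unfolding lin_subspace_def
    proof (intro conjI ballI allI)
      let ?w = "cech_lincomb A q (\<lambda>_. 0) [] :: 'a set set \<Rightarrow> ('a set list \<Rightarrow> 'f) set"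
      have w: "?w \<in> cech A q" by (rule lincomb_cech) simp
      have w0: "?w U = hclass A U q (\<lambda>_. 0)" if "ocover A U" for U
        using lincomb_mem[of "[]" A q U "[]" "\<lambda>_. 0"] that by simp
      have "(\<lambda>_. 0) \<in> ?w U0" using w0[OF U0(1)] hclass_self by blast
      moreover have "?w (V n) \<subseteq> bdries B (V n) q"
        using w0[OF ocA] bdries_mono[OF ocover_finite[OF oc] sub] by (simp add: hclass_zero)
      ultimately show "(\<lambda>_. 0) \<in> M n" unfolding M_def using w by blast
      fix c d a b assume "c \<in> M n" "d \<in> M n"
      then obtain x z where x: "x \<in> cech A q" "c \<in> x U0" "x (V n) \<subseteq> bdries B (V n) q"
        and z: "z \<in> cech A q" "d \<in> z U0" "z (V n) \<subseteq> bdries B (V n) q" unfolding M_def by blast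
      obtain w where w: "w \<in> cech A q"
        "\<And>U c d. ocover A U \<Longrightarrow> c \<in> x U \<Longrightarrow> d \<in> z U \<Longrightarrow> (\<lambda>\<sigma>. a * c \<sigma> + b * d \<sigma>) \<in> w U"
        using cech_comb2[where a=a and b=b, OF x(1) z(1)] by blast
      obtain c' where c': "c' \<in> x (V n)" using cech_obtain[OF x(1) ocA] by blast
      obtain d' where d': "d' \<in> z (V n)" using cech_obtain[OF z(1) ocA] by blast
      have "(\<lambda>\<sigma>. a * c' \<sigma> + b * d' \<sigma>) \<in> bdries B (V n) q"
        by (rule subspD[OF lin_subspace_bdries]) (use c' d' x z in auto)
      then have "w (V n) \<subseteq> bdries B (V n) q"
        by (rule cech_vanish[OF w(1) sub oc w(2)[OF ocA c' d']])
      then show "(\<lambda>\<sigma>. a * c \<sigma> + b * d \<sigma>) \<in> M n"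
        unfolding M_def using w(1) w(2)[OF U0(1) x(2) z(2)] by blast
    qed
    show "M (Suc n) \<subseteq> M n" for n
    proof -
      obtain g where "srefines (V (Suc n)) (V n) g" using cof unfolding cofinal_def by blast
      then have "refines_by B (V (Suc n)) (V n) g" by (rule srefines_refines)
      then show ?thesis unfolding M_def using vanish_push[OF _ sub oc oc] by blast
    qed
    show "c \<sigma> = 0" if "c \<in> M n" "\<sigma> \<notin> nerve A U0 q" for n c \<sigma>
      using that cech_cycle[OF _ U0(1)] cycles_subset_chains unfolding M_def chains_def by blast
  qed
  then obtain n0 where n0: "\<And>n. n \<ge> n0 \<Longrightarrow> M n = M n0" by blast
  show thesis
  proof (rule that[of "V n0"])
    show "ocover B (V n0)" by (rule oc)
    fix x :: "'a set set \<Rightarrow> ('a set list \<Rightarrow> 'f) set" and U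
    assume x: "x \<in> cech A q" "x (V n0) \<subseteq> bdries B (V n0) q" and U: "ocover B U"
    obtain c where c: "c \<in> x U0" using cech_obtain[OF x(1) U0(1)] by blast
    then have "c \<in> M n0" unfolding M_def using x by blast
    obtain m g where g: "srefines (V m) U g" using cof U unfolding cofinal_def by blast
    let ?m = "max m n0"
    obtain g' where g': "srefines (V ?m) (V m) g'" using cofinal_srefines[OF cof, of m ?m] by auto
    have "c \<in> M ?m" using \<open>c \<in> M n0\<close> n0[of ?m] by simp
    \<comment> \<open>Stability only yields some class \<open>z\<close>, depending on the stage,
      that dies there and shares its value at \<open>U0\<close> with \<open>x\<close>; agreement at
      \<open>U0\<close> then transfers the vanishing from \<open>z\<close> to
      \<open>x\<close>.\<close>
    then obtain z where z: "z \<in> cech A q" "c \<in> z U0" "z (V ?m) \<subseteq> bdries B (V ?m) q" unfolding M_def by blast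
    obtain c1 d1 where cd: "c1 \<in> x (V ?m)" "d1 \<in> z (V ?m)" "homol B (V ?m) q c1 d1"
      using U0(2)[OF x(1) z(1) c z(2) oc] by blast
    have "d1 \<in> bdries B (V ?m) q" using cd(2) z(3) by blast
    from lin_subspace_add[OF lin_subspace_bdries cd(3) this] have "c1 \<in> bdries B (V ?m) q" by simp
    then have "x (V ?m) \<subseteq> bdries B (V ?m) q" by (rule cech_vanish[OF x(1) sub oc cd(1)])
    then show "x U \<subseteq> bdries B U q"
      by (rule vanish_push[OF x(1) sub oc U srefines_refines[OF srefines_comp[OF g' g]]])
  qed
qed

text \<open>Only the kernels have to agree. A class dying in \<open>B'\<close> dies at the shrunk
  cover of \<open>G\<close>; the simplicial map back to the nerve on \<open>B\<close> carries the
  bounding chain to the detecting cover of \<open>B\<close>.\<close>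

lemma cech_rank_shrink_target:
  fixes A B :: "'a::euclidean_space set"
  assumes A: "compact A" and AB: "nbhd_retracts_into A B" and B: "compact B"
  obtains G where "open G" "B \<subseteq> G"
    "\<And>B'. B \<subseteq> B' \<Longrightarrow> B' \<subseteq> G \<Longrightarrow> cech_rank TYPE('f::field) q A B = cech_rank TYPE('f) q A B'"
proof -
  have sub: "A \<subseteq> B" by (rule nbhd_retracts_into_subset[OF AB])
  obtain U1 where U1: "ocover B U1"
    "\<And>x U. x \<in> (cech A q :: ('a set set \<Rightarrow> ('a set list \<Rightarrow> 'f) set) set) \<Longrightarrow>
        x U1 \<subseteq> bdries B U1 q \<Longrightarrow> ocover B U \<Longrightarrow> x U \<subseteq> bdries B U q"
    using vanishing_detected[where q=q and 'f='f, OF A AB B] by blast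
  obtain G V h where G: "open G" "B \<subseteq> G" "ocover G V" and h: "srefines V U1 h"
    and meet: "\<forall>s\<subseteq>V. \<Inter>s \<inter> G \<noteq> {} \<longrightarrow> \<Inter>(h ` s) \<inter> B \<noteq> {}"
    by (rule shrink_cover[OF B U1(1)]) (rule that)
  show thesis
  proof (rule that[OF G(1,2)])
    fix B' assume B': "B \<subseteq> B'" "B' \<subseteq> G"
    have sub': "A \<subseteq> B'" using sub B' by blast
    note V = ocover_mono[OF G(3) B'(2)]
    show "cech_rank TYPE('f) q A B = cech_rank TYPE('f) q A B'"
    proof (rule cech_rank_cong_kernel[OF sub sub'])
      fix x :: "'a set set \<Rightarrow> ('a set list \<Rightarrow> 'f) set" assume x: "x \<in> cech A q"
      show "cech_incl B q x = cech_zero B q \<longleftrightarrow> cech_incl B' q x = cech_zero B' q"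
        unfolding incl_zero_iff[OF x sub] incl_zero_iff[OF x sub']
      proof
        assume L: "\<forall>U. ocover B U \<longrightarrow> x U \<subseteq> bdries B U q"
        then show "\<forall>U. ocover B' U \<longrightarrow> x U \<subseteq> bdries B' U q"
          using bdries_mono[OF ocover_finite B'(1)] ocover_mono[OF _ B'(1)] by blast
      next
        assume R: "\<forall>U. ocover B' U \<longrightarrow> x U \<subseteq> bdries B' U q"
        have VA: "ocover A V" by (rule ocover_mono[OF V sub'])
        obtain c where c: "c \<in> cycles A V q" "c \<in> x V" using cech_obtain[OF x VA] .
        have "chain_push B' V q h c \<in> bdries B U1 q"
          by (rule push_bdries[OF ocover_finite[OF V] ocover_finite[OF U1(1)] shrink_contig[OF h meet B'(2)]])
            (use R V c in blast)+
        moreover have "chain_push B' V q h c = chain_push A V q h c"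
          by (rule chain_push_mono[OF ocover_finite[OF V] sub' cycles_subset_chains[OF c(1)]])
        moreover have "chain_push A V q h c \<in> x U1"
          by (rule cech_push[OF x ocover_mono[OF U1(1) sub] VA srefines_refines[OF h] c(2)])
        ultimately have "x U1 \<subseteq> bdries B U1 q" using cech_vanish[OF x sub U1(1)] by metis
        then show "\<forall>U. ocover B U \<longrightarrow> x U \<subseteq> bdries B U q" using U1(2)[OF x] by blast
      qed
    qed
  qed
qed

lemma incl_incl:
  fixes x :: "'a::topological_space set set \<Rightarrow> ('a set list \<Rightarrow> 'f::field) set"
  assumes "x \<in> cech X q" "X \<subseteq> Y" "Y \<subseteq> Z"
  shows "cech_incl Z q (cech_incl Y q x) = cech_incl Z q x"
proof (rule incl_eqI[OF incl_cech[OF assms(1,2)] assms(3,1)])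
  show "X \<subseteq> Z" using assms by blast
  fix U assume U: "ocover Z U"
  have Y: "ocover Y U" by (rule ocover_mono[OF U assms(3)])
  obtain c where c: "c \<in> x U" using cech_obtain[OF assms(1) ocover_mono[OF Y assms(2)]] by blast
  then have "c \<in> cech_incl Y q x U" using incl_class[OF assms(1,2) Y c] hclass_self by blast
  then show "\<exists>c\<in>cech_incl Y q x U. \<exists>d\<in>x U. homol Z U q c d" using c homol_refl by blast
qed

text \<open>Both images in the homology of \<open>B\<close> coincide. A cycle of \<open>A\<close> on
  the shrunk cover is carried to a cycle of \<open>A0\<close>, which by
  \<open>mittag_leffler\<close> comes, at \<open>U0\<close>, from a Cech class of \<open>A0\<close>.
  The two classes are compared inside the fixed set \<open>A'\<close>, since \<open>U0\<close>, and
  with it \<open>G\<close>, must be chosen before \<open>A\<close> is known.\<close>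

lemma cech_rank_shrink_source:
  fixes A0 A' B :: "'a::euclidean_space set"
  assumes A0: "compact A0" "A0 \<subseteq> A'" and A': "compact A'" and AB: "nbhd_retracts_into A' B"
  obtains G where "open G" "A0 \<subseteq> G"
    "\<And>A. A0 \<subseteq> A \<Longrightarrow> A \<subseteq> A' \<Longrightarrow> A \<subseteq> G \<Longrightarrow> cech_rank TYPE('f::field) q A0 B = cech_rank TYPE('f) q A B"
proof -
  have A'B: "A' \<subseteq> B" by (rule nbhd_retracts_into_subset[OF AB])
  obtain U0 where U0: "ocover A' U0"
    "\<And>x z c U. x \<in> (cech A' q :: ('a set set \<Rightarrow> ('a set list \<Rightarrow> 'f) set) set) \<Longrightarrow> z \<in> cech A' q \<Longrightarrow>
        c \<in> x U0 \<Longrightarrow> c \<in> z U0 \<Longrightarrow> ocover B U \<Longrightarrow> \<exists>c\<in>x U. \<exists>d\<in>z U. homol B U q c d"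
    using cech_determined_by_cover[where q=q and 'f='f, OF A' AB] by blast
  obtain V g where V: "ocover A0 V" and g: "srefines V U0 g"
    and ml: "\<forall>c\<in>cycles A0 V q. \<exists>x\<in>(cech A0 q :: ('a set set \<Rightarrow> ('a set list \<Rightarrow> 'f) set) set). chain_push A0 V q g c \<in> x U0"
    by (rule mittag_leffler[where q=q and 'f='f, OF A0(1) ocover_mono[OF U0(1) A0(2)]]) (rule that)
  obtain G V' h where G: "open G" "A0 \<subseteq> G" "ocover G V'" and h: "srefines V' V h"
    and meet: "\<forall>s\<subseteq>V'. \<Inter>s \<inter> G \<noteq> {} \<longrightarrow> \<Inter>(h ` s) \<inter> A0 \<noteq> {}"
    by (rule shrink_cover[OF A0(1) V]) (rule that)
  show thesis
  proof (rule that[OF G(1,2)])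
    fix A assume A: "A0 \<subseteq> A" "A \<subseteq> A'" "A \<subseteq> G"
    have AB': "A \<subseteq> B" "A0 \<subseteq> B" using A A'B by auto
    note oA = ocover_mono[OF G(3) A(3)]
    note U0A = ocover_mono[OF U0(1) A(2)]
    have "cech_incl B q ` (cech A0 q :: ('a set set \<Rightarrow> ('a set list \<Rightarrow> 'f) set) set) = cech_incl B q ` cech A q"
    proof (intro subset_antisym image_subsetI)
      fix x :: "'a set set \<Rightarrow> ('a set list \<Rightarrow> 'f) set" assume x: "x \<in> cech A0 q"
      show "cech_incl B q x \<in> cech_incl B q ` cech A q"
        using incl_incl[OF x A(1) AB'(1)] incl_cech[OF x A(1)] by (metis imageI)
    next
      fix x :: "'a set set \<Rightarrow> ('a set list \<Rightarrow> 'f) set" assume x: "x \<in> cech A q"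
      obtain c where c: "c \<in> cycles A V' q" "c \<in> x V'" using cech_obtain[OF x oA] .
      let ?hc = "chain_push A V' q h c"
      have con: "contig A V' A0 V h h" by (rule shrink_contig[OF h meet A(3)])
      have "?hc \<in> cycles A0 V q"
        by (rule push_cycles[OF ocover_finite[OF oA] ocover_finite[OF V] con c(1)])
      then obtain z where z: "z \<in> cech A0 q" "chain_push A0 V q g ?hc \<in> z U0" using ml by blast
      have "chain_push A0 V q g ?hc = chain_push A V' q (g \<circ> h) c"
        by (rule chain_push_comp[OF ocover_finite[OF oA] ocover_finite[OF V] con cycles_subset_chains[OF c(1)]])
      then have xU0: "chain_push A0 V q g ?hc \<in> x U0"
        using cech_push[OF x U0A oA srefines_refines[OF srefines_comp[OF h g]] c(2)] by simp
      let ?x = "cech_incl A' q x" and ?z = "cech_incl A' q z"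
      have A0A': "A0 \<subseteq> A'" using A by blast
      note x' = incl_cech[OF x A(2)] and z' = incl_cech[OF z(1) A0A']
      have 1: "chain_push A0 V q g ?hc \<in> ?x U0"
        using incl_class[OF x A(2) U0(1) xU0] hclass_self by blast
      have 2: "chain_push A0 V q g ?hc \<in> ?z U0"
        using incl_class[OF z(1) A0A' U0(1) z(2)] hclass_self by blast
      have "cech_incl B q ?x = cech_incl B q ?z"
        by (rule incl_eqI[OF x' A'B z' A'B U0(2)[OF x' z' 1 2]])
      then have "cech_incl B q x = cech_incl B q z"
        using incl_incl[OF x A(2) A'B] incl_incl[OF z(1) A0A' A'B] by simp
      then show "cech_incl B q x \<in> cech_incl B q ` cech A0 q" using z(1) by blast
    qed
    then show "cech_rank TYPE('f) q A0 B = cech_rank TYPE('f) q A B"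
      unfolding cech_rank_def by simp
  qed
qed

subsection \<open>Neighbourhood retractions and sublevel sets\<close>

lemma continuous_on_coordinate: "continuous_on S (\<lambda>t :: 'b \<Rightarrow> 'c::topological_space. t i)"
  by (rule continuous_on_product_then_coordinatewise) (rule continuous_on_id)

text \<open>The polyhedron is the finite union of its closed faces, because \<open>S\<close> is
  closed under nonempty subsets; each face is closed in a product of unit intervals.\<close>

lemma compact_polyhedron_of:
  assumes "abs_simplicial_complex V S"
  shows "compact (polyhedron_of V S)"
proof -
  define F where "F s = {t :: nat \<Rightarrow> real. (\<forall>i. i \<notin> s \<longrightarrow> t i = 0) \<and> (\<forall>i. 0 \<le> t i) \<and> sum t V = 1}" for s
  have V: "finite V" and S: "\<And>s. s \<in> S \<Longrightarrow> s \<subseteq> V" "\<And>s t. s \<in> S \<Longrightarrow> t \<subseteq> s \<Longrightarrow> t \<noteq> {} \<Longrightarrow> t \<in> S"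
    using assms unfolding abs_simplicial_complex_def by blast+
  have "finite S" using V S(1) by (meson Pow_iff finite_Pow_iff finite_subset subsetI)
  have "polyhedron_of V S = (\<Union>s\<in>S. F s)"
  proof (intro set_eqI iffI)
    fix t assume "t \<in> polyhedron_of V S"
    then have "t \<in> F {i. t i \<noteq> 0}" "{i. t i \<noteq> 0} \<in> S" by (auto simp: polyhedron_of_def F_def)
    then show "t \<in> (\<Union>s\<in>S. F s)" by blast
  next
    fix t assume "t \<in> (\<Union>s\<in>S. F s)"
    then obtain s where s: "s \<in> S" "t \<in> F s" by blast
    have "{i. t i \<noteq> 0} \<subseteq> s" using s(2) by (auto simp: F_def)
    moreover have "{i. t i \<noteq> 0} \<noteq> {}"
    proof
      assume "{i. t i \<noteq> 0} = {}"
      then have "sum t V = 0" by simp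
      then show False using s(2) by (simp add: F_def)
    qed
    ultimately have "{i. t i \<noteq> 0} \<in> S" using S(2)[OF s(1)] by blast
    moreover have "t i = 0" if "i \<notin> V" for i using that S(1)[OF s(1)] s(2) by (auto simp: F_def)
    ultimately show "t \<in> polyhedron_of V S" using s(2) by (simp add: polyhedron_of_def F_def)
  qed
  moreover have "compact (F s)" if "s \<in> S" for s
  proof -
    have "compactin (product_topology (\<lambda>_. euclidean) UNIV) (PiE UNIV (\<lambda>_::nat. {0..1::real}))"
      unfolding compactin_PiE by simp
    then have "compact (PiE UNIV (\<lambda>_::nat. {0..1::real}))"
      by (simp add: euclidean_product_topology)
    moreover have "closed (F s)"
      unfolding F_def
      by (intro closed_Collect_conj closed_Collect_all closed_Collect_imp closed_Collect_eq closed_Collect_le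
          open_Collect_const continuous_intros continuous_on_coordinate)
    moreover have "F s \<subseteq> PiE UNIV (\<lambda>_::nat. {0..1::real})"
    proof
      fix t assume t: "t \<in> F s"
      have "t i \<le> 1" for i
      proof (cases "i \<in> V")
        case True
        have "t i \<le> sum t V" using t V True by (intro member_le_sum) (auto simp: F_def)
        then show ?thesis using t by (simp add: F_def)
      next
        case False
        then have "t i = 0" using S(1)[OF that] t by (auto simp: F_def)
        then show ?thesis by simp
      qed
      then show "t \<in> PiE UNIV (\<lambda>_::nat. {0..1::real})" using t by (auto simp: F_def)
    qed
    ultimately show ?thesis by (metis compact_Int_closed inf.absorb_iff2)
  qed
  ultimately show ?thesis using \<open>finite S\<close> by (simp add: compact_UN)
qed

lemma continuous_on_Min:
  fixes f :: "'i \<Rightarrow> 'a::topological_space \<Rightarrow> real"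
  assumes "finite I" "I \<noteq> {}" "\<And>i. i \<in> I \<Longrightarrow> continuous_on X (f i)"
  shows "continuous_on X (\<lambda>x. Min ((\<lambda>i. f i x) ` I))"
  using assms
proof (induction I rule: finite_ne_induct)
  case (insert i I)
  then show ?case by (simp add: continuous_on_min)
qed auto

text \<open>Extend the barycentric coordinates to the ambient space by Tietze, then retract a neighbourhood of
  the polyhedron in coordinate space: subtract from every coordinate the amount \<open>c\<close> by which the
  support fails to be a simplex, truncate at \<open>0\<close> and normalise.\<close>

lemma triangulable_compact_nbhd_retract:
  fixes X :: "'a::euclidean_space set"
  assumes "triangulable X"
  shows "compact X" "nbhd_retracts_into X X"
proof -
  obtain V S where VS: "abs_simplicial_complex V S" "X homeomorphic polyhedron_of V S"
    using assms unfolding triangulable_def by blast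
  have V: "finite V" and S: "\<And>s. s \<in> S \<Longrightarrow> s \<subseteq> V" "\<And>s t. s \<in> S \<Longrightarrow> t \<subseteq> s \<Longrightarrow> t \<noteq> {} \<Longrightarrow> t \<in> S"
    using VS(1) unfolding abs_simplicial_complex_def by blast+
  obtain h k where hk: "homeomorphism X (polyhedron_of V S) h k"
    using VS(2) unfolding homeomorphic_def by blast
  have "polyhedron_of V S homeomorphic X" using VS(2) homeomorphic_sym by blast
  then show X: "compact X" using compact_polyhedron_of[OF VS(1)] homeomorphic_compactness by blast
  have hP: "h x \<in> polyhedron_of V S" if "x \<in> X" for x using hk that by (auto simp: homeomorphism_def)
  have "\<exists>g. continuous_on UNIV g \<and> (\<forall>x\<in>X. g x = h x i)" for i
  proof -
    have "continuous_on X (\<lambda>x. h x i)"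
      by (rule continuous_on_product_then_coordinatewise) (use hk in \<open>auto simp: homeomorphism_def\<close>)
    moreover have "closedin (top_of_set UNIV) X" by (rule closed_subset[OF subset_UNIV compact_imp_closed[OF X]])
    ultimately show ?thesis by (rule Tietze_unbounded) blast
  qed
  then obtain g where "\<forall>i. continuous_on UNIV (g i) \<and> (\<forall>x\<in>X. g i x = h x i)"
    using choice[of "\<lambda>i g. continuous_on UNIV g \<and> (\<forall>x\<in>X. g x = h x i)"] by auto
  then have g: "\<And>i. continuous_on UNIV (g i)" "\<And>i x. x \<in> X \<Longrightarrow> g i x = h x i" by blast+
  define p where "p i x = max 0 (g i x)" for i x
  have cp: "continuous_on UNIV (p i)" for i
    unfolding p_def by (intro continuous_intros g)
  define \<N> where "\<N> = {s. s \<subseteq> V \<and> s \<noteq> {} \<and> s \<notin> S}"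
  have \<N>: "finite \<N>" "\<And>s. s \<in> \<N> \<Longrightarrow> finite s \<and> s \<noteq> {}"
    using V finite_subset by (auto simp: \<N>_def)
  \<comment> \<open>On \<open>X\<close> this vanishes, as the support of a point of the polyhedron
    contains no non-simplex. Everywhere it dominates each single minimum, the summands being
    nonnegative.\<close>
  define c where "c x = (\<Sum>s\<in>\<N>. Min ((\<lambda>i. p i x) ` s))" for x
  have cc: "continuous_on UNIV c"
    unfolding c_def using \<N> cp by (intro continuous_on_sum continuous_on_Min) auto
  have Min_nonneg: "Min ((\<lambda>i. p i x) ` s) \<ge> 0" if "s \<in> \<N>" for s x
    using \<N>(2)[OF that] by (auto simp: p_def)
  have c0: "c x \<ge> 0" for x unfolding c_def by (rule sum_nonneg) (rule Min_nonneg)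
  define w where "w i x = max 0 (p i x - c x)" for i x
  have cw: "continuous_on UNIV (w i)" for i
    unfolding w_def by (intro continuous_intros cp cc)
  define m where "m x = (\<Sum>i\<in>V. w i x)" for x
  have cm: "continuous_on UNIV m" unfolding m_def by (intro continuous_on_sum cw)
  define \<rho> where "\<rho> x = (\<lambda>i. if i \<in> V then w i x / m x else 0)" for x
  define T where "T = {x. m x > 0}"
  have oT: "open T"
    unfolding T_def by (rule open_Collect_less) (use cm in \<open>auto intro: continuous_on_const\<close>)
  have \<rho>h: "\<rho> x = h x" and xT: "x \<in> T" if x: "x \<in> X" for x
  proof -
    have P: "\<And>i. i \<notin> V \<Longrightarrow> h x i = 0" "\<And>i. 0 \<le> h x i" "sum (h x) V = 1" "{i. h x i \<noteq> 0} \<in> S"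
      using hP[OF x] by (auto simp: polyhedron_of_def)
    have px: "p i x = h x i" for i using P(2)[of i] g(2)[OF x] by (simp add: p_def)
    have "Min ((\<lambda>i. p i x) ` s) = 0" if s: "s \<in> \<N>" for s
    proof -
      have "\<not> s \<subseteq> {i. h x i \<noteq> 0}" using S(2)[OF P(4), of s] s by (auto simp: \<N>_def)
      then obtain i where "i \<in> s" "p i x = 0" using px by auto
      then have "Min ((\<lambda>i. p i x) ` s) \<le> 0" using \<N>(2)[OF s] by (intro Min_le) force+
      then show ?thesis using Min_nonneg[OF s, of x] by linarith
    qed
    then have "c x = 0" by (simp add: c_def)
    then have wx: "w i x = h x i" for i using P(2)[of i] px by (simp add: w_def)
    then have "m x = 1" using P(3) by (simp add: m_def)
    then show "\<rho> x = h x" "x \<in> T" using wx P(1) by (auto simp: \<rho>_def T_def)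
  qed
  have \<rho>P: "\<rho> x \<in> polyhedron_of V S" if "x \<in> T" for x
  proof -
    have m: "m x > 0" using that by (simp add: T_def)
    have w0: "w i x \<ge> 0" for i by (simp add: w_def)
    define s where "s = {i\<in>V. p i x > c x}"
    have supp: "{i. \<rho> x i \<noteq> 0} = s"
      using m by (auto simp: \<rho>_def s_def w_def)
    have "s \<noteq> {}"
    proof
      assume "s = {}"
      then have "w i x = 0" if "i \<in> V" for i using that by (force simp: s_def w_def)
      then show False using m by (simp add: m_def)
    qed
    \<comment> \<open>Were the surviving vertices a non-simplex, their smallest coordinate would be
      a summand of \<open>c\<close> and yet exceed \<open>c\<close>.\<close>
    have "s \<in> S"
    proof (rule ccontr)
      assume "s \<notin> S"
      then have s: "s \<in> \<N>" using \<open>s \<noteq> {}\<close> by (auto simp: \<N>_def s_def)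
      have "Min ((\<lambda>i. p i x) ` s) > c x" using \<N>(2)[OF s] by (auto simp: s_def)
      moreover have "Min ((\<lambda>i. p i x) ` s) \<le> c x"
        unfolding c_def by (rule member_le_sum[OF s]) (use Min_nonneg \<N>(1) in auto)
      ultimately show False by linarith
    qed
    moreover have "sum (\<rho> x) V = 1"
      using m by (simp add: \<rho>_def sum_divide_distrib[symmetric] m_def[symmetric])
    moreover have "\<rho> x i \<ge> 0" for i using w0 m by (simp add: \<rho>_def)
    ultimately show ?thesis using supp by (simp add: polyhedron_of_def) (simp add: \<rho>_def)
  qed
  have "continuous_on T \<rho>"
  proof (rule continuous_on_coordinatewise_then_product)
    fix i
    have "continuous_on T (\<lambda>x. w i x / m x)"
      by (intro continuous_on_divide continuous_on_subset[OF cw] continuous_on_subset[OF cm]) (auto simp: T_def)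
    then show "continuous_on T (\<lambda>x. \<rho> x i)" by (cases "i \<in> V") (auto simp: \<rho>_def)
  qed
  then have "continuous_on T (k \<circ> \<rho>)"
    by (rule continuous_on_compose) (rule continuous_on_subset[of "polyhedron_of V S"], use hk \<rho>P in \<open>auto simp: homeomorphism_def\<close>)
  moreover have "(k \<circ> \<rho>) ` T \<subseteq> X" using \<rho>P hk by (auto simp: homeomorphism_def)
  moreover have "(k \<circ> \<rho>) x = x" if "x \<in> X" for x using \<rho>h[OF that] hk that by (simp add: homeomorphism_def)
  ultimately show "nbhd_retracts_into X X"
    unfolding nbhd_retracts_into_def using oT xT by blast
qed

text \<open>Restrict the retraction to the preimage of \<open>T\<close>, which is open and contains
  \<open>A\<close>.\<close>

lemma nbhd_retracts_into_openin:
  assumes "nbhd_retracts_into X X" "openin (top_of_set X) T" "A \<subseteq> T" "T \<subseteq> B"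
  shows "nbhd_retracts_into A B"
proof -
  obtain S r where S: "open S" "X \<subseteq> S" "continuous_on S r" "r ` S \<subseteq> X" "\<forall>x\<in>X. r x = x"
    using assms(1) unfolding nbhd_retracts_into_def by blast
  have "openin (top_of_set S) (S \<inter> r -` T)"
    by (rule continuous_openin_preimage[OF S(3) _ assms(2)]) (use S(4) in auto)
  then have "open (S \<inter> r -` T)" using S(1) openin_open_eq by blast
  moreover have "T \<subseteq> X" using assms(2) openin_imp_subset by blast
  then have "A \<subseteq> S \<inter> r -` T" "\<forall>x\<in>A. r x = x" using assms(3) S(2,5) by (auto simp: subset_iff)
  moreover have "continuous_on (S \<inter> r -` T) r" "r ` (S \<inter> r -` T) \<subseteq> B"
    using S(3) assms(4) by (auto intro: continuous_on_subset)
  ultimately show ?thesis unfolding nbhd_retracts_into_def by blast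
qed

section \<open>The distance function of a compact set\<close>

lemma is_norm_continuous:
  fixes N :: "'a::euclidean_space \<Rightarrow> real"
  assumes "is_norm N"
  shows "continuous_on UNIV N"
proof (rule convex_on_continuous)
  have N: "\<And>c x. N (c *\<^sub>R x) = \<bar>c\<bar> * N x" "\<And>x y. N (x + y) \<le> N x + N y"
    using assms by (auto simp: is_norm_def)
  show "convex_on UNIV N"
  proof (rule convex_onI)
    fix t :: real and x y assume "0 < t" "t < 1"
    then show "N ((1 - t) *\<^sub>R x + t *\<^sub>R y) \<le> (1 - t) * N x + t * N y"
      using N(2)[of "(1 - t) *\<^sub>R x" "t *\<^sub>R y"] by (simp add: N(1))
  qed simp
qed simp

context
  fixes N :: "'a::euclidean_space \<Rightarrow> real" and K :: "'a set"
  assumes N: "is_norm N" and K: "compact K" "K \<noteq> {}"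
begin

lemma dist_fun_le: "y \<in> K \<Longrightarrow> dist_fun N K x \<le> N (x - y)"
  unfolding dist_fun_def using N by (intro cINF_lower bdd_belowI2[of _ 0]) (auto simp: is_norm_def)

lemma dist_fun_attained: "\<exists>y\<in>K. dist_fun N K x = N (x - y)"
proof -
  have "continuous_on K (\<lambda>y. N (x - y))"
    by (rule continuous_on_compose2[OF is_norm_continuous[OF N]]) (auto intro!: continuous_intros)
  then obtain y where y: "y \<in> K" "\<And>z. z \<in> K \<Longrightarrow> N (x - y) \<le> N (x - z)"
    using continuous_attains_inf[OF K] by blast
  then have "N (x - y) \<le> dist_fun N K x" unfolding dist_fun_def using K(2) by (intro cINF_greatest)
  then show ?thesis using dist_fun_le[OF y(1), of x] y(1) by (intro bexI[of _ y]) auto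
qed

lemma dist_fun_zero_iff: "dist_fun N K x \<le> 0 \<longleftrightarrow> x \<in> K"
proof
  assume "dist_fun N K x \<le> 0"
  moreover obtain y where y: "y \<in> K" "dist_fun N K x = N (x - y)" using dist_fun_attained by blast
  moreover have "0 \<le> N (x - y)" using N unfolding is_norm_def by blast
  ultimately have "N (x - y) = 0" by linarith
  then have "x - y = 0" using N unfolding is_norm_def by blast
  then show "x \<in> K" using y(1) by simp
next
  assume "x \<in> K"
  moreover have "N 0 = 0" using N by (simp add: is_norm_def)
  ultimately show "dist_fun N K x \<le> 0" using dist_fun_le[of x x] by simp
qed

text \<open>The distance is 1-Lipschitz for \<open>N\<close>, and \<open>N\<close> is continuous at
  zero.\<close>

lemma dist_fun_continuous: "continuous_on UNIV (dist_fun N K)"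
proof -
  have tri: "dist_fun N K x - dist_fun N K y \<le> N (x - y)" for x y
  proof -
    obtain z where z: "z \<in> K" "dist_fun N K y = N (y - z)" using dist_fun_attained by blast
    have "N ((x - y) + (y - z)) \<le> N (x - y) + N (y - z)" using N unfolding is_norm_def by blast
    then show ?thesis using dist_fun_le[OF z(1), of x] z(2) by simp
  qed
  have sym: "N (x - y) = N (y - x)" for x y
  proof -
    have "N ((- 1) *\<^sub>R (y - x)) = \<bar>- 1\<bar> * N (y - x)" using N unfolding is_norm_def by blast
    then show ?thesis by simp
  qed
  have "((\<lambda>y. dist_fun N K y) \<longlongrightarrow> dist_fun N K x) (at x)" for x
  proof -
    have "isCont (\<lambda>y. N (y - x)) x"
      using continuous_on_compose2[OF is_norm_continuous[OF N], of UNIV "\<lambda>y. y - x"]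
      by (simp add: continuous_on_eq_continuous_at continuous_on_diff)
    moreover have "N 0 = 0" using N unfolding is_norm_def by blast
    ultimately have "((\<lambda>y. N (y - x)) \<longlongrightarrow> 0) (at x)" by (simp add: isCont_def)
    moreover have "\<forall>\<^sub>F y in at x. norm (dist_fun N K y - dist_fun N K x) \<le> N (y - x)"
    proof (rule always_eventually, rule allI)
      show "norm (dist_fun N K y - dist_fun N K x) \<le> N (y - x)" for y
        using tri[of y x] tri[of x y] sym[of x y] by auto
    qed
    ultimately have "((\<lambda>y. dist_fun N K y - dist_fun N K x) \<longlongrightarrow> 0) (at x)"
      by (rule Lim_null_comparison[rotated])
    then show ?thesis by (simp add: LIM_zero_iff)
  qed
  then show ?thesis by (simp add: continuous_on_def)
qed

end

section \<open>Sublevel sets\<close>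

lemma closed_vle: "closed {w. vle w u}"
  unfolding vle_def by (intro closed_Collect_all closed_Collect_le continuous_intros)

lemma open_vlt: "open {w :: real^'m. vlt w u}"
proof -
  have "{w. vlt w u} = (\<Inter>i\<in>UNIV. {w. w $ i < u $ i})" by (auto simp: vlt_def)
  also have "open \<dots>" by (intro open_INT ballI open_Collect_less continuous_intros) auto
  finally show ?thesis .
qed

lemma sublevel_Phi:
  "sublevel D (Phi N K \<phi>) (vcons a u) = {x \<in> D. dist_fun N K x \<le> a \<and> vle (\<phi> x) u}"
  by (auto simp: sublevel_def vle_def Phi_def vcons_def split_option_all)

text \<open>On the compact set \<open>C - G\<close>, if it is nonempty, \<open>d\<close> has a
  positive minimum; half of it serves.\<close>

lemma compact_sublevel_nbhd:
  fixes C :: "'a::topological_space set" and d :: "'a \<Rightarrow> real"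
  assumes "compact C" "continuous_on C d" "open G" "\<And>x. x \<in> C \<Longrightarrow> d x \<le> 0 \<Longrightarrow> x \<in> G"
  obtains e where "e > 0" "\<And>x. x \<in> C \<Longrightarrow> d x \<le> e \<Longrightarrow> x \<in> G"
proof (cases "C - G = {}")
  case True
  then show thesis using that[of 1] by auto
next
  case False
  have "compact (C - G)" using assms(1,3) by (simp add: compact_diff)
  moreover have "continuous_on (C - G) d" using assms(2) continuous_on_subset by blast
  ultimately obtain z where z: "z \<in> C - G" "\<And>y. y \<in> C - G \<Longrightarrow> d z \<le> d y"
    using continuous_attains_inf[of "C - G" d] False by blast
  have "d z > 0" using assms(4)[of z] z(1) by force
  then show thesis using that[of "d z / 2"] z(2) by force
qed

theorem theorem2p2:
  fixes D K :: "'a::euclidean_space set"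
    and N :: "'a \<Rightarrow> real"
    and \<phi> :: "'a \<Rightarrow> real^'k"
    and q :: int
    and u v :: "real^'k"
  assumes "is_norm N"
    and "triangulable D"
    and "triangulable K" and "K \<subseteq> D" and "K \<noteq> {}"
    and "continuous_on D \<phi>"
    and "vlt u v"
  shows "(\<exists>\<beta>h>0. \<forall>\<beta>. 0 < \<beta> \<and> \<beta> \<le> \<beta>h \<longrightarrow>
            (\<exists>\<alpha>h. 0 < \<alpha>h \<and> \<alpha>h < \<beta> \<and>
               (\<forall>\<alpha>. 0 \<le> \<alpha> \<and> \<alpha> \<le> \<alpha>h \<longrightarrow>
                  rank_inv TYPE('f::field) q K \<phi> u v
                  = rank_inv TYPE('f) q D (Phi N K \<phi>) (vcons \<alpha> u) (vcons \<beta> v))))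
         \<and> ((\<lambda>\<beta>. rank_inv TYPE('f) q D (Phi N K \<phi>) (vcons 0 u) (vcons \<beta> v))
               \<longlongrightarrow> rank_inv TYPE('f) q K \<phi> u v) (at_right 0)"
proof -
  note D = triangulable_compact_nbhd_retract[OF assms(2)]
  note K = triangulable_compact_nbhd_retract[OF assms(3)]
  let ?d = "dist_fun N K"
  note d0 = dist_fun_zero_iff[OF assms(1) K(1) assms(5)]
  note dc = dist_fun_continuous[OF assms(1) K(1) assms(5)]
  have vle_vlt: "vlt w v" if "vle w u" for w
    using that assms(7) unfolding vle_def vlt_def by (metis le_less_trans)
  have vlt_vle: "vle w v" if "vlt w v" for w
    using that by (simp add: vlt_def vle_def less_imp_le)
  define A where "A a = {x \<in> D. ?d x \<le> a \<and> vle (\<phi> x) u}" for a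
  define B where "B b = {x \<in> D. ?d x \<le> b \<and> vle (\<phi> x) v}" for b
  have comp: "compact {x \<in> D. ?d x \<le> a \<and> vle (\<phi> x) w}" "compact {x \<in> D. vle (\<phi> x) w}" for a w
  proof -
    have "closed (D \<inter> \<phi> -` {y. vle y w})"
      by (rule continuous_closed_preimage[OF assms(6) compact_imp_closed[OF D(1)] closed_vle])
    moreover have "closed {x. ?d x \<le> a}" by (intro closed_Collect_le dc continuous_on_const)
    ultimately have "compact (D \<inter> ((D \<inter> \<phi> -` {y. vle y w}) \<inter> {x. ?d x \<le> a}))" "compact (D \<inter> (D \<inter> \<phi> -` {y. vle y w}))"
      using compact_Int_closed[OF D(1)] closed_Int by blast+
    moreover have "D \<inter> ((D \<inter> \<phi> -` {y. vle y w}) \<inter> {x. ?d x \<le> a}) = {x \<in> D. ?d x \<le> a \<and> vle (\<phi> x) w}"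
      "D \<inter> (D \<inter> \<phi> -` {y. vle y w}) = {x \<in> D. vle (\<phi> x) w}" by auto
    ultimately show "compact {x \<in> D. ?d x \<le> a \<and> vle (\<phi> x) w}" "compact {x \<in> D. vle (\<phi> x) w}" by simp_all
  qed
  \<comment> \<open>The condition that the distance be at most 0 cuts \<open>K\<close> out of
    \<open>D\<close>, so both rank invariants live in the same two families \<open>A\<close> and
    \<open>B\<close>.\<close>
  have A0: "sublevel K \<phi> u = A 0" and B0: "sublevel K \<phi> v = B 0"
    using assms(4) d0 by (auto simp: sublevel_def A_def B_def)
  have rankK: "rank_inv TYPE('f) q K \<phi> u v = cech_rank TYPE('f) q (A 0) (B 0)"
    by (simp add: rank_inv_def A0 B0)
  have rankD: "rank_inv TYPE('f) q D (Phi N K \<phi>) (vcons a u) (vcons b v) = cech_rank TYPE('f) q (A a) (B b)" for a b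
    by (simp add: rank_inv_def sublevel_Phi A_def B_def)
  have shrink: "\<exists>e>0. {x \<in> D. ?d x \<le> e \<and> vle (\<phi> x) w} \<subseteq> G"
    if G: "open G" "{x \<in> D. ?d x \<le> 0 \<and> vle (\<phi> x) w} \<subseteq> G" for G w
  proof -
    have "continuous_on {x \<in> D. vle (\<phi> x) w} ?d" using dc continuous_on_subset by blast
    then obtain e where "e > 0" "\<And>x. x \<in> {x \<in> D. vle (\<phi> x) w} \<Longrightarrow> ?d x \<le> e \<Longrightarrow> x \<in> G"
      by (rule compact_sublevel_nbhd[OF comp(2) _ G(1)]) (use G(2) in auto)
    then show ?thesis by auto
  qed
  have cA: "compact (A a)" and cB: "compact (B a)" for a using comp(1) by (simp_all add: A_def B_def)
  \<comment> \<open>Here the strict inequality between \<open>u\<close> and \<open>v\<close> enters: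
    it leaves room for a relatively open subset of \<open>K\<close> between the two sets.\<close>
  have nb0: "nbhd_retracts_into (A 0) (B 0)"
  proof (rule nbhd_retracts_into_openin[OF K(2)])
    show "openin (top_of_set K) (K \<inter> \<phi> -` {w. vlt w v})"
      by (rule continuous_openin_preimage_gen[OF continuous_on_subset[OF assms(6,4)] open_vlt])
    show "A 0 \<subseteq> K \<inter> \<phi> -` {w. vlt w v}" using vle_vlt d0 by (auto simp: A_def)
    show "K \<inter> \<phi> -` {w. vlt w v} \<subseteq> B 0" using vlt_vle d0 assms(4) by (auto simp: B_def)
  qed
  obtain G1 where G1: "open G1" "B 0 \<subseteq> G1"
    and rank1: "\<And>B'. B 0 \<subseteq> B' \<Longrightarrow> B' \<subseteq> G1 \<Longrightarrow> cech_rank TYPE('f) q (A 0) (B 0) = cech_rank TYPE('f) q (A 0) B'"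
    using cech_rank_shrink_target[where q=q and 'f='f, OF cA nb0 cB] by blast
  obtain \<beta>h where \<beta>h: "\<beta>h > 0" "B \<beta>h \<subseteq> G1" using shrink[OF G1[unfolded B_def]] unfolding B_def by blast
  have main: "\<exists>\<alpha>h. 0 < \<alpha>h \<and> \<alpha>h < \<beta> \<and> (\<forall>\<alpha>. 0 \<le> \<alpha> \<and> \<alpha> \<le> \<alpha>h \<longrightarrow>
      cech_rank TYPE('f) q (A 0) (B 0) = cech_rank TYPE('f) q (A \<alpha>) (B \<beta>))"
    if \<beta>: "0 < \<beta>" "\<beta> \<le> \<beta>h" for \<beta>
  proof -
    have "B 0 \<subseteq> B \<beta>" "B \<beta> \<subseteq> G1" using \<beta> \<beta>h(2) by (auto simp: B_def)
    then have eq1: "cech_rank TYPE('f) q (A 0) (B 0) = cech_rank TYPE('f) q (A 0) (B \<beta>)" by (rule rank1)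
    \<comment> \<open>Halving \<beta> leaves room in the distance coordinate as well, and
      \<open>A (\<beta> / 2)\<close> becomes the fixed set in which the sources are
      compared.\<close>
    have nb: "nbhd_retracts_into (A (\<beta> / 2)) (B \<beta>)"
    proof (rule nbhd_retracts_into_openin[OF D(2)])
      have "openin (top_of_set D) (D \<inter> \<phi> -` {w. vlt w v})"
        by (rule continuous_openin_preimage_gen[OF assms(6) open_vlt])
      moreover have "openin (top_of_set D) (D \<inter> ?d -` {..<\<beta>})"
        by (rule continuous_openin_preimage_gen[OF continuous_on_subset[OF dc] open_lessThan]) auto
      ultimately show "openin (top_of_set D) ((D \<inter> \<phi> -` {w. vlt w v}) \<inter> (D \<inter> ?d -` {..<\<beta>}))" by (rule openin_Int)
      show "A (\<beta> / 2) \<subseteq> (D \<inter> \<phi> -` {w. vlt w v}) \<inter> (D \<inter> ?d -` {..<\<beta>})" using vle_vlt \<beta>(1) by (auto simp: A_def)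
      show "(D \<inter> \<phi> -` {w. vlt w v}) \<inter> (D \<inter> ?d -` {..<\<beta>}) \<subseteq> B \<beta>" using vlt_vle by (auto simp: B_def)
    qed
    have sub: "A 0 \<subseteq> A (\<beta> / 2)" using \<beta>(1) by (auto simp: A_def)
    obtain G2 where G2: "open G2" "A 0 \<subseteq> G2"
      and rank2: "\<And>A'. A 0 \<subseteq> A' \<Longrightarrow> A' \<subseteq> A (\<beta> / 2) \<Longrightarrow> A' \<subseteq> G2 \<Longrightarrow> cech_rank TYPE('f) q (A 0) (B \<beta>) = cech_rank TYPE('f) q A' (B \<beta>)"
      using cech_rank_shrink_source[where q=q and 'f='f, OF cA sub cA nb] by blast
    obtain e where e: "e > 0" "A e \<subseteq> G2" using shrink[OF G2[unfolded A_def]] unfolding A_def by blast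
    \<comment> \<open>The two bounds put \<open>A \<alpha>\<close> into \<open>G2\<close> and into
      \<open>A (\<beta> / 2)\<close>; the second also gives
      \<open>\<alpha>h < \<beta>\<close>.\<close>
    define \<alpha>h where "\<alpha>h = min e (\<beta> / 2)"
    have "cech_rank TYPE('f) q (A 0) (B 0) = cech_rank TYPE('f) q (A \<alpha>) (B \<beta>)" if \<alpha>: "0 \<le> \<alpha>" "\<alpha> \<le> \<alpha>h" for \<alpha>
    proof -
      have "A 0 \<subseteq> A \<alpha>" using \<alpha>(1) by (auto simp: A_def)
      moreover have "A \<alpha> \<subseteq> A (\<beta> / 2)" using \<alpha>(2) by (auto simp: A_def \<alpha>h_def)
      moreover have "A \<alpha> \<subseteq> G2" using \<alpha>(2) e(2) by (auto simp: A_def \<alpha>h_def)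
      ultimately show ?thesis using eq1 rank2 by simp
    qed
    moreover have "0 < \<alpha>h" "\<alpha>h < \<beta>" using e(1) \<beta>(1) by (auto simp: \<alpha>h_def)
    ultimately show ?thesis by blast
  qed
  \<comment> \<open>The case \<open>\<alpha> = 0\<close> gives equality for all small \<beta>, so
    the limit is that of an eventually constant function.\<close>
  have "eventually (\<lambda>\<beta>. cech_rank TYPE('f) q (A 0) (B \<beta>) = cech_rank TYPE('f) q (A 0) (B 0)) (at_right 0)"
    unfolding eventually_at_right_field
  proof (intro exI conjI allI impI)
    show "0 < \<beta>h" by (rule \<beta>h(1))
    fix \<beta> :: real assume "0 < \<beta>" "\<beta> < \<beta>h"
    then obtain \<alpha>h where "0 < \<alpha>h" "\<forall>\<alpha>. 0 \<le> \<alpha> \<and> \<alpha> \<le> \<alpha>h \<longrightarrow>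
      cech_rank TYPE('f) q (A 0) (B 0) = cech_rank TYPE('f) q (A \<alpha>) (B \<beta>)" using main[of \<beta>] by auto
    from this(2)[rule_format, of 0] this(1)
    show "cech_rank TYPE('f) q (A 0) (B \<beta>) = cech_rank TYPE('f) q (A 0) (B 0)" by simp
  qed
  then have "((\<lambda>\<beta>. cech_rank TYPE('f) q (A 0) (B \<beta>)) \<longlongrightarrow> cech_rank TYPE('f) q (A 0) (B 0)) (at_right 0)"
    by (rule tendsto_eventually)
  then show ?thesis unfolding rankK rankD using main \<beta>h(1) by blast
qed

end
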